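(* Let $D\subset L^2(T)$ be a finite dimensional identifiable sub-space, and let $\widehat\beta^D_n=\arg\min_{b\in D}\sum_{i=1}^n(y_i-\langle x_i,b\rangle)^2$ be the least square estimator in $D$. Let $\pi:D\to E$ be the (invertible) projection of $D$ on $S$, with $E=\pi(D)$, $F=S\cap E^\perp$, $\beta=\beta^E+\beta^F+\beta^{S^\perp}$, and let $\gamma_n,\gamma\in E$ be the bias terms defined in the context. Then, as $n\to\infty$, $$\widehat\beta^D_n\to\pi^{-1}(\beta^E+\gamma)\quad\text{almost surely}.$$ Consequently: (a) If $\beta\in D$, then $\beta^F=0$, $\gamma_n=\gamma=0$ for any $n\ge1$, $\pi^{-1}(\beta^E)=\beta^E+\beta^{S^\perp}$, and $\|\widehat\beta^D_n-\beta\|\to0$ almost surely. (b) If $\beta\notin D$ but $\beta^F=0$, then $\gamma_n=\gamma=0$ for any $n\ge1$, and $\|\widehat\beta^D_n-\beta\|\to\left\|\left(\pi^{-1}(\beta^E)-\beta^E\right)-\beta^{S^\perp}\right\|$ almost surely, where $\left(\pi^{-1}(\beta^E)-\beta^E\right)-\beta^{S^\perp}\in S^\perp$ and $\pi^{-1}(\beta^E)\neq\beta^E+\beta^{S^\perp}$, so that $\widehat\beta^D_n$ is not consistent for $\beta$. (c) If $\beta\notin D$ and $\beta^F\neq0$ (in which case, in general, $\gamma_n\neq0$ and $\gamma\neq0$), then almost surely $$\|\widehat\beta^D_n-\beta\|^2\to\|\beta^F\|^2+\|\gamma\|^2+\left\|\left(\pi^{-1}(\beta^E+\gamma)-(\beta^E+\gamma)\right)-\beta^{S^\perp}\right\|^2,$$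 where $\beta^F\in F$, $\gamma\in E$ and $\left(\pi^{-1}(\beta^E+\gamma)-(\beta^E+\gamma)\right)-\beta^{S^\perp}\in S^\perp$.
   Context: $T\subset\mathbb{R}$ is compact, $\langle a,b\rangle=\int_T a(t)b(t)\,dt$ is the inner product of $L^2(T)$ and $\|\cdot\|$ its norm. The model is $y_i=\langle x_i,\beta\rangle+\epsilon_i$, $i=1,\dots,n$, where $\beta\in L^2(T)$ is deterministic, $x_1,\dots,x_n$ are i.i.d. realizations of an $L^2(T)$-valued process $X$ with $\mathbb{E}[X]=0$ and $\mathbb{E}\|X\|^2<\infty$, and $\epsilon_1,\dots,\epsilon_n$ are real random variables independent of $x_1,\dots,x_n$, with $\mathbb{E}[\epsilon_i]=0$ and $\mathrm{Var}[\epsilon_i]=\sigma^2>0$. $S$ is the smallest closed linear sub-space of $L^2(T)$ containing the support of $X$; $S^\perp$ is its orthogonal complement. A linear sub-space $D$ is identifiable if $D\cap S^\perp=\{0\}$. $\pi$ is the restriction to $D$ of the orthogonal projection onto $S$, $E=\pi(D)$, $F=S\cap E^\perp$, so $L^2(T)=E\oplus F\oplus S^\perp$ (orthogonal sum), and $\beta^E,\beta^F,\beta^{S^\perp}$ are the corresponding orthogonal projections of $\beta$. For an orthonormal basis $\varphi^E_1,\dots,\varphi^E_d$ of $E$ let $X^E$ be the $n\times d$ matrix with entries $[X^E]_{ij}=\langle x_i,\varphi^E_j\rangle$ and put $\mathbf{X}^E=(\langle X,\varphi^E_1\rangle,\dots,\langle X,\varphi^E_d\rangle)^T$. Set $\boldsymbol{\gamma_n}=((X^E)^TX^E)^{-1}(X^E)^T(\langle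 x_1,\beta^F\rangle,\dots,\langle x_n,\beta^F\rangle)^T$ and $\boldsymbol\gamma=\left(\mathbb{E}[\mathbf{X}^E(\mathbf{X}^E)^T]\right)^{-1}\mathbb{E}[\mathbf{X}^E\langle X,\beta^F\rangle]$, both in $\mathbb{R}^d$; $\gamma_n$ and $\gamma$ are the elements of $E$ with these coordinate vectors in the basis $\varphi^E_1,\dots,\varphi^E_d$. The estimator $\widehat\beta^D_n$ (and $\gamma_n$) is considered for those $n$ for which the minimizer is unique, i.e. $(X^E)^TX^E$ is invertible. *)

theory Defs
  imports "HOL-Probability.Probability" "Jordan_Normal_Form.Gauss_Jordan_Elimination"
begin

section \<open>The Hilbert space of square-integrable functions on the real line\<close>

text \<open>
  Borel representatives suffice, since a Lebesgue measurable function agrees almost everywhere with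
  a Borel one. The completeness and separability instances make the Bochner integral of
  \<open>L2\<close>-valued random elements available.
\<close>

definition square_integrable :: "(real \<Rightarrow> real) \<Rightarrow> bool" where
  "square_integrable f \<longleftrightarrow> f \<in> borel_measurable lborel \<and> integrable lborel (\<lambda>t. (f t)\<^sup>2)"

lemma square_integrable_mult:
  assumes "square_integrable f" "square_integrable g"
  shows "integrable lborel (\<lambda>t. f t * g t)"
proof (rule Bochner_Integration.integrable_bound)
  show "integrable lborel (\<lambda>t. (f t)\<^sup>2 + (g t)\<^sup>2)"
    using assms by (auto simp: square_integrable_def)
  show "(\<lambda>t. f t * g t) \<in> borel_measurable lborel"
    using assms by (auto simp: square_integrable_def)
  have "\<bar>a * b\<bar> \<le> a\<^sup>2 + b\<^sup>2" for a b :: real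
  proof -
    have "0 \<le> (\<bar>a\<bar> - \<bar>b\<bar>)\<^sup>2" by simp
    then have "2 * (\<bar>a\<bar> * \<bar>b\<bar>) \<le> a\<^sup>2 + b\<^sup>2" by (simp add: power2_diff)
    moreover have "0 \<le> \<bar>a\<bar> * \<bar>b\<bar>" by simp
    ultimately show ?thesis unfolding abs_mult by linarith
  qed
  then show "AE t in lborel. norm (f t * g t) \<le> norm ((f t)\<^sup>2 + (g t)\<^sup>2)"
    by simp
qed

lemma square_integrable_add:
  assumes "square_integrable f" "square_integrable g"
  shows "square_integrable (\<lambda>t. f t + g t)"
  using assms square_integrable_mult[OF assms]
  by (auto simp: square_integrable_def power2_sum mult.assoc)

lemma square_integrable_scale:
  "square_integrable f \<Longrightarrow> square_integrable (\<lambda>t. c * f t)"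
  by (auto simp: square_integrable_def power_mult_distrib)

lemma square_integrable_zero: "square_integrable (\<lambda>t. 0)"
  by (simp add: square_integrable_def)

definition L2_rel :: "(real \<Rightarrow> real) \<Rightarrow> (real \<Rightarrow> real) \<Rightarrow> bool" where
  "L2_rel f g \<longleftrightarrow> square_integrable f \<and> square_integrable g \<and> (AE t in lborel. f t = g t)"

quotient_type L2 = "real \<Rightarrow> real" / partial: L2_rel
proof (rule part_equivpI)
  show "\<exists>f. L2_rel f f"
    using square_integrable_zero by (auto simp: L2_rel_def intro!: exI[of _ "\<lambda>_. 0"])
  show "symp L2_rel"
    unfolding symp_def L2_rel_def by (auto simp: eq_commute)
  show "transp L2_rel"
    unfolding transp_def L2_rel_def by (auto elim: AE_mp)
qed

instantiation L2 :: real_inner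
begin

lift_definition zero_L2 :: L2 is "\<lambda>t. 0"
  by (simp add: L2_rel_def square_integrable_zero)

lift_definition plus_L2 :: "L2 \<Rightarrow> L2 \<Rightarrow> L2" is "\<lambda>f g t. f t + g t"
  unfolding L2_rel_def by (auto simp: square_integrable_add elim!: AE_mp)

lift_definition scaleR_L2 :: "real \<Rightarrow> L2 \<Rightarrow> L2" is "\<lambda>c f t. c * f t"
  unfolding L2_rel_def by (auto simp: square_integrable_scale elim!: AE_mp)

lift_definition uminus_L2 :: "L2 \<Rightarrow> L2" is "\<lambda>f t. - f t"
  unfolding L2_rel_def using square_integrable_scale[of _ "-1"] by (auto elim: AE_mp)

lift_definition minus_L2 :: "L2 \<Rightarrow> L2 \<Rightarrow> L2" is "\<lambda>f g t. f t - g t"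
proof -
  fix f1 f2 g1 g2 assume "L2_rel f1 f2" "L2_rel g1 g2"
  then show "L2_rel (\<lambda>t. f1 t - g1 t) (\<lambda>t. f2 t - g2 t)"
    using square_integrable_add[OF _ square_integrable_scale[of _ "-1"]]
    unfolding L2_rel_def by (auto elim: AE_mp)
qed

lift_definition inner_L2 :: "L2 \<Rightarrow> L2 \<Rightarrow> real" is "\<lambda>f g. integral\<^sup>L lborel (\<lambda>t. f t * g t)"
  unfolding L2_rel_def square_integrable_def
  by (rule integral_cong_AE) (auto elim: AE_mp)

definition norm_L2 :: "L2 \<Rightarrow> real" where "norm_L2 f = sqrt (inner f f)"

definition sgn_L2 :: "L2 \<Rightarrow> L2" where "sgn_L2 f = scaleR (inverse (norm f)) f"

definition dist_L2 :: "L2 \<Rightarrow> L2 \<Rightarrow> real" where "dist_L2 f g = norm (f - g)"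

definition uniformity_L2 :: "(L2 \<times> L2) filter" where
  "uniformity_L2 = (INF e\<in>{0<..}. principal {(f, g). dist f g < e})"

definition open_L2 :: "L2 set \<Rightarrow> bool" where
  "open_L2 U \<longleftrightarrow> (\<forall>f\<in>U. eventually (\<lambda>(f', g). f' = f \<longrightarrow> g \<in> U) uniformity)"

instance
proof
  fix f g h :: L2 and r s :: real and U :: "L2 set"
  show "f + g + h = f + (g + h)"
    by transfer (auto simp: L2_rel_def algebra_simps intro!: square_integrable_add)
  show "f + g = g + f"
    by transfer (auto simp: L2_rel_def algebra_simps intro!: square_integrable_add)
  show "0 + f = f"
    by transfer (auto simp: L2_rel_def)
  show "- f + f = 0"
    by transfer (auto simp: L2_rel_def square_integrable_zero)
  show "f - g = f + - g"
  proof transfer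
    fix f g assume "L2_rel f f" "L2_rel g g"
    then show "L2_rel (\<lambda>t. f t - g t) (\<lambda>t. f t + - g t)"
      using square_integrable_add[OF _ square_integrable_scale[of _ "-1"], of f g]
      by (auto simp: L2_rel_def)
  qed
  show "r *\<^sub>R (f + g) = r *\<^sub>R f + r *\<^sub>R g"
    by transfer (auto simp: L2_rel_def algebra_simps
        intro!: square_integrable_add square_integrable_scale)
  show "(r + s) *\<^sub>R f = r *\<^sub>R f + s *\<^sub>R f"
    by transfer (auto simp: L2_rel_def algebra_simps
        intro!: square_integrable_add square_integrable_scale)
  show "r *\<^sub>R s *\<^sub>R f = (r * s) *\<^sub>R f"
    by transfer (auto simp: L2_rel_def algebra_simps
        intro!: square_integrable_scale)
  show "1 *\<^sub>R f = f"
    by transfer (auto simp: L2_rel_def)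
  show "dist f g = norm (f - g)" by (rule dist_L2_def)
  show "sgn f = scaleR (inverse (norm f)) f" by (rule sgn_L2_def)
  show "uniformity = (INF e\<in>{0<..}. principal {(f, g). dist f (g::L2) < e})"
    by (rule uniformity_L2_def)
  show "open U \<longleftrightarrow> (\<forall>f\<in>U. \<forall>\<^sub>F (f', g) in uniformity. f' = f \<longrightarrow> g \<in> U)"
    by (rule open_L2_def)
  show "inner f g = inner g f"
    by transfer (simp add: mult.commute)
  show "inner (f + g) h = inner f h + inner g h"
    by transfer (auto simp: L2_rel_def algebra_simps square_integrable_mult)
  show "inner (r *\<^sub>R f) g = r * inner f g"
    by transfer (auto simp: L2_rel_def mult.assoc)
  show "0 \<le> inner f f"
    by transfer auto
  show "inner f f = 0 \<longleftrightarrow> f = 0"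
  proof transfer
    fix f assume "L2_rel f f"
    then have f: "square_integrable f" by (simp add: L2_rel_def)
    have "integral\<^sup>L lborel (\<lambda>t. f t * f t) = 0 \<longleftrightarrow> (AE t in lborel. f t * f t = 0)"
      using square_integrable_mult[OF f f] by (intro integral_nonneg_eq_0_iff_AE) auto
    then show "integral\<^sup>L lborel (\<lambda>t. f t * f t) = 0 \<longleftrightarrow> L2_rel f (\<lambda>t. 0)"
      using f by (auto simp: L2_rel_def square_integrable_zero)
  qed
  show "norm f = sqrt (inner f f)" by (rule norm_L2_def)
qed

end

lemma norm_abs_L2:
  assumes "square_integrable f"
  shows "(norm (abs_L2 f))\<^sup>2 = integral\<^sup>L lborel (\<lambda>t. (f t)\<^sup>2)"
  using assms 
  by (simp add: norm_eq_sqrt_inner inner_L2.abs_eq L2_rel_def power2_eq_square)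

lemma abs_L2_diff:
  assumes "square_integrable f" "square_integrable g"
  shows "abs_L2 f - abs_L2 g = abs_L2 (\<lambda>t. f t - g t)"
  using assms by (simp add: minus_L2.abs_eq L2_rel_def)

lemma square_integrable_diff:
  assumes "square_integrable f" "square_integrable g"
  shows "square_integrable (\<lambda>t. f t - g t)"
  using square_integrable_add[OF assms(1) square_integrable_scale[OF assms(2), of "-1"]] by simp

lemma L2_cases: obtains g where "square_integrable g" "f = abs_L2 g"
  by (metis L2_rel_def Quotient3_L2 Quotient3_abs_rep Quotient3_rep_reflp)

lemma abs_L2_add:
  assumes "square_integrable f" "square_integrable g"
  shows "abs_L2 (\<lambda>t. f t + g t) = abs_L2 f + abs_L2 g"
  using assms by (simp add: plus_L2.abs_eq L2_rel_def)

lemma abs_L2_scale: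
  assumes "square_integrable f"
  shows "abs_L2 (\<lambda>t. c * f t) = c *\<^sub>R abs_L2 f"
  using assms by (simp add: scaleR_L2.abs_eq L2_rel_def)

lemma square_integrable_abs: "square_integrable f \<Longrightarrow> square_integrable (\<lambda>t. \<bar>f t\<bar>)"
  by (auto simp: square_integrable_def)

lemma norm_abs_L2_abs:
  assumes "square_integrable f"
  shows "norm (abs_L2 (\<lambda>t. \<bar>f t\<bar>)) = norm (abs_L2 f)"
  using norm_abs_L2[OF assms] norm_abs_L2[OF square_integrable_abs[OF assms]]
  by (intro power2_eq_imp_eq[OF _ norm_ge_zero norm_ge_zero]) simp

lemma nn_integral_square:
  assumes "square_integrable f"
  shows "(\<integral>\<^sup>+t. ennreal ((f t)\<^sup>2) \<partial>lborel) = ennreal ((norm (abs_L2 f))\<^sup>2)"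
  using assms unfolding norm_abs_L2[OF assms]
  by (intro nn_integral_eq_integral) (auto simp: square_integrable_def)

lemma Cauchy_fast_subseq:
  fixes X :: "nat \<Rightarrow> 'a :: metric_space"
  assumes "Cauchy X"
  obtains r where "strict_mono r" "\<And>k. dist (X (r (Suc k))) (X (r k)) < (1/2)^k"
proof -
  have "\<forall>k. \<exists>N. \<forall>m\<ge>N. \<forall>n\<ge>N. dist (X m) (X n) < (1/2)^k"
    using assms by (auto intro!: metric_CauchyD)
  then obtain N where N: "\<And>k m n. m \<ge> N k \<Longrightarrow> n \<ge> N k \<Longrightarrow> dist (X m) (X n) < (1/2)^k"
    by metis
  define r where "r k = (\<Sum>j\<le>k. N j) + k" for k
  have "strict_mono r"
    by (auto simp: strict_mono_Suc_iff r_def)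
  moreover have "dist (X (r (Suc k))) (X (r k)) < (1/2)^k" for k
  proof (rule N)
    have "N k \<le> (\<Sum>j\<le>k. N j)"
      by (rule member_le_sum) auto
    then show "N k \<le> r k" "N k \<le> r (Suc k)"
      by (auto simp: r_def)
  qed
  ultimately show ?thesis by (rule that)
qed

instance L2 :: complete_space
proof
  fix X :: "nat \<Rightarrow> L2"
  assume "Cauchy X"
  from Cauchy_fast_subseq[OF this] obtain r where r: "strict_mono r"
    and fast: "\<And>k. dist (X (r (Suc k))) (X (r k)) < (1/2)^k" by blast
  have "\<exists>g. square_integrable g \<and> X (r k) = abs_L2 g" for k
    by (metis L2_cases)
  then obtain g where g: "\<And>k. square_integrable (g k)" "\<And>k. X (r k) = abs_L2 (g k)"
    by metis
  have [measurable]: "g k \<in> borel_measurable borel" for k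
    using g(1)[of k] by (auto simp: square_integrable_def)
  define h where "h n t = (\<Sum>k<n. \<bar>g (Suc k) t - g k t\<bar>)" for n t
  have h: "square_integrable (h n) \<and> norm (abs_L2 (h n)) \<le> (\<Sum>k<n. (1/2)^k)" for n
  proof (induction n)
    case 0
    then show ?case
      using norm_abs_L2[OF square_integrable_zero]
      by (simp add: h_def[abs_def] square_integrable_zero)
  next
    case (Suc n)
    let ?d = "\<lambda>t. g (Suc n) t - g n t"
    have d: "square_integrable ?d"
      by (intro square_integrable_diff g)
    have eq: "h (Suc n) = (\<lambda>t. h n t + \<bar>?d t\<bar>)"
      by (auto simp: h_def)
    have "norm (abs_L2 (h (Suc n))) \<le> norm (abs_L2 (h n)) + norm (abs_L2 (\<lambda>t. \<bar>?d t\<bar>))"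
      unfolding eq using Suc d square_integrable_abs
      by (subst abs_L2_add) (auto intro: norm_triangle_ineq)
    also have "norm (abs_L2 (\<lambda>t. \<bar>?d t\<bar>)) = dist (X (r (Suc n))) (X (r n))"
      using norm_abs_L2_abs[OF d] abs_L2_diff[OF g(1) g(1), of "Suc n" n]
      by (simp add: dist_norm g(2))
    also have "norm (abs_L2 (h n)) + \<dots> \<le> (\<Sum>k<Suc n. (1/2)^k)"
      using Suc fast[of n] by simp
    finally show ?case
      using Suc d unfolding eq by (auto intro!: square_integrable_add square_integrable_abs)
  qed
  have h_meas [measurable]: "h n \<in> borel_measurable borel" for n
    using h[of n] by (auto simp: square_integrable_def)
  have h2: "(\<integral>\<^sup>+t. ennreal ((h n t)\<^sup>2) \<partial>lborel) \<le> ennreal 4" for n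
  proof -
    have "(\<Sum>k<n. (1/2::real)^k) \<le> 2"
      by (simp add: geometric_sum)
    with h[of n] have "norm (abs_L2 (h n)) \<le> 2" by linarith
    then have "ennreal ((norm (abs_L2 (h n)))\<^sup>2) \<le> ennreal (2\<^sup>2)"
      by (intro ennreal_leI power_mono) auto
    then show ?thesis
      using nn_integral_square[of "h n"] h[of n] by simp
  qed
  have h_mono: "h m t \<le> h n t" if "m \<le> n" for m n t
    unfolding h_def using that by (intro sum_mono2) auto
  have h_nonneg: "0 \<le> h n t" for n t
    unfolding h_def by (intro sum_nonneg) auto
  have "(\<integral>\<^sup>+t. (SUP n. ennreal ((h n t)\<^sup>2)) \<partial>lborel) = (SUP n. \<integral>\<^sup>+t. ennreal ((h n t)\<^sup>2) \<partial>lborel)"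
    by (rule nn_integral_monotone_convergence_SUP)
       (auto simp: incseq_def le_fun_def intro!: ennreal_leI power_mono h_mono h_nonneg)
  also have "\<dots> \<le> ennreal 4"
    by (intro SUP_least h2)
  also have "ennreal 4 < \<infinity>" by simp
  finally have "AE t in lborel. (SUP n. ennreal ((h n t)\<^sup>2)) \<noteq> \<infinity>"
    by (intro nn_integral_PInf_AE) auto
  then have conv: "AE t in lborel. (\<lambda>k. g k t) \<longlonglongrightarrow> lim (\<lambda>k. g k t)"
  proof eventually_elim
    case (elim t)
    obtain c where c: "0 \<le> c" "(SUP n. ennreal ((h n t)\<^sup>2)) = ennreal c"
      using elim by (metis ennreal_cases infinity_ennreal_def)
    have "h n t \<le> sqrt c" for n
    proof -
      have "ennreal ((h n t)\<^sup>2) \<le> ennreal c"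
        unfolding c(2)[symmetric] by (rule SUP_upper) simp
      then show ?thesis
        using c(1) by (intro real_le_rsqrt) (simp add: ennreal_le_iff)
    qed
    then have "summable (\<lambda>k. \<bar>g (Suc k) t - g k t\<bar>)"
      unfolding h_def by (rule summableI_nonneg_bounded[rotated]) simp
    then have "summable (\<lambda>k. g (Suc k) t - g k t)"
      by (rule summable_rabs_cancel)
    then have "convergent (\<lambda>n. \<Sum>k<n. g (Suc k) t - g k t)"
      by (simp add: summable_iff_convergent)
    then have "convergent (\<lambda>n. (\<Sum>k<n. g (Suc k) t - g k t) + g 0 t)"
      by (intro convergent_add convergent_const)
    moreover have "(\<Sum>k<n. g (Suc k) t - g k t) + g 0 t = g n t" for n
      by (induction n) auto
    ultimately have "convergent (\<lambda>n. g n t)" by simp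
    then show ?case by (simp add: convergent_LIMSEQ_iff)
  qed
  define f where "f t = lim (\<lambda>k. g k t)" for t
  have [measurable]: "f \<in> borel_measurable borel"
    unfolding f_def[abs_def] by measurable
  have key: "square_integrable (\<lambda>t. g k t - f t) \<and> norm (abs_L2 (\<lambda>t. g k t - f t)) \<le> e"
    if "0 \<le> e" and *: "\<And>m. m \<ge> k \<Longrightarrow> norm (X (r k) - X (r m)) \<le> e" for k e
  proof -
    have "(\<integral>\<^sup>+t. ennreal ((g k t - f t)\<^sup>2) \<partial>lborel)
        = (\<integral>\<^sup>+t. liminf (\<lambda>m. ennreal ((g k t - g m t)\<^sup>2)) \<partial>lborel)"
    proof (rule nn_integral_cong_AE)
      show "AE t in lborel. ennreal ((g k t - f t)\<^sup>2) = liminf (\<lambda>m. ennreal ((g k t - g m t)\<^sup>2))"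
        using conv
      proof eventually_elim
        case (elim t)
        have "(\<lambda>m. ennreal ((g k t - g m t)\<^sup>2)) \<longlonglongrightarrow> ennreal ((g k t - f t)\<^sup>2)"
          unfolding f_def by (intro tendsto_ennrealI tendsto_intros elim)
        then show ?case by (rule lim_imp_Liminf[OF sequentially_bot, symmetric])
      qed
    qed
    also have "\<dots> \<le> liminf (\<lambda>m. \<integral>\<^sup>+t. ennreal ((g k t - g m t)\<^sup>2) \<partial>lborel)"
      by (rule nn_integral_liminf) measurable
    also have "\<dots> \<le> liminf (\<lambda>m::nat. ennreal (e\<^sup>2))"
    proof (rule Liminf_mono, rule eventually_mono[OF eventually_ge_at_top[of k]])
      fix m assume "k \<le> m"
      have "(\<integral>\<^sup>+t. ennreal ((g k t - g m t)\<^sup>2) \<partial>lborel) = ennreal ((norm (X (r k) - X (r m)))\<^sup>2)"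
        using nn_integral_square[OF square_integrable_diff[OF g(1) g(1), of k m]]
        by (simp add: g(2) abs_L2_diff g(1))
      also have "\<dots> \<le> ennreal (e\<^sup>2)"
        using *[OF \<open>k \<le> m\<close>] by (intro ennreal_leI power_mono) auto
      finally show "(\<integral>\<^sup>+t. ennreal ((g k t - g m t)\<^sup>2) \<partial>lborel) \<le> ennreal (e\<^sup>2)" .
    qed
    also have "\<dots> = ennreal (e\<^sup>2)"
      by (intro lim_imp_Liminf) auto
    finally have le: "(\<integral>\<^sup>+t. ennreal ((g k t - f t)\<^sup>2) \<partial>lborel) \<le> ennreal (e\<^sup>2)" .
    also have "\<dots> < \<infinity>" by simp
    finally have "integrable lborel (\<lambda>t. (g k t - f t)\<^sup>2)"
      by (intro integrableI_nonneg) auto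
    then have sq: "square_integrable (\<lambda>t. g k t - f t)"
      by (simp add: square_integrable_def)
    have "(norm (abs_L2 (\<lambda>t. g k t - f t)))\<^sup>2 \<le> e\<^sup>2"
      using le unfolding nn_integral_square[OF sq] by (simp add: ennreal_le_iff)
    with sq \<open>0 \<le> e\<close> show ?thesis by (simp add: power2_le_iff_abs_le)
  qed
  have Cr: "Cauchy (X \<circ> r)"
    using \<open>Cauchy X\<close> r by (rule Cauchy_subseq_Cauchy)
  have tail: "\<exists>K. \<forall>k\<ge>K. \<forall>m\<ge>K. norm (X (r k) - X (r m)) \<le> e" if "e > 0" for e
    using CauchyD[OF Cr that] by (auto intro: less_imp_le)
  obtain K1 where K1: "\<forall>k\<ge>K1. \<forall>m\<ge>K1. norm (X (r k) - X (r m)) \<le> 1"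
    using tail[of 1] by auto
  have "square_integrable (\<lambda>t. g K1 t - f t)"
    using key[of 1 K1] K1 by auto
  then have "square_integrable (\<lambda>t. g K1 t - (g K1 t - f t))"
    by (rule square_integrable_diff[OF g(1)])
  then have f: "square_integrable f" by simp
  have "(X \<circ> r) \<longlonglongrightarrow> abs_L2 f"
  proof (rule LIMSEQ_I)
    fix e :: real assume "0 < e"
    then obtain K where K: "\<forall>k\<ge>K. \<forall>m\<ge>K. norm (X (r k) - X (r m)) \<le> e/2"
      using tail[of "e/2"] by auto
    have "norm ((X \<circ> r) k - abs_L2 f) < e" if "k \<ge> K" for k
    proof -
      have "norm (abs_L2 (\<lambda>t. g k t - f t)) \<le> e/2"
        using key[of "e/2" k] K that \<open>0 < e\<close> by auto
      then show ?thesis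
        using \<open>0 < e\<close> by (simp add: g(2) abs_L2_diff g(1) f)
    qed
    then show "\<exists>K. \<forall>k\<ge>K. norm ((X \<circ> r) k - abs_L2 f) < e" by blast
  qed
  with \<open>Cauchy X\<close> r show "convergent X"
    by (meson Cauchy_converges_subseq convergent_def)
qed

instance L2 :: banach ..

lemma square_integrable_indicator:
  assumes "A \<in> sets borel" "emeasure lborel A < \<infinity>"
  shows "square_integrable (indicat_real A)"
  using assms by (auto simp: square_integrable_def power2_eq_square indicator_inter_arith[symmetric]
      integrable_indicator_iff)

lemma norm_L2_indicator_diff:
  assumes "A \<in> sets borel" "emeasure lborel A < \<infinity>" "B \<in> sets borel" "B \<subseteq> A"
  shows "(norm (abs_L2 (indicat_real A) - abs_L2 (indicat_real B)))\<^sup>2 = measure lborel (A - B)"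
proof -
  have "emeasure lborel B \<le> emeasure lborel A"
    using assms by (intro emeasure_mono) auto
  then have B: "square_integrable (indicat_real B)"
    using assms by (intro square_integrable_indicator) auto
  have A: "square_integrable (indicat_real A)"
    using assms by (intro square_integrable_indicator) auto
  have "(\<lambda>t. (indicat_real A t - indicat_real B t)\<^sup>2) = indicat_real (A - B)"
    using assms(4) by (auto simp: indicator_def fun_eq_iff)
  then show ?thesis
    using A B norm_abs_L2[OF square_integrable_diff[OF A B]] assms
    by (simp add: abs_L2_diff)
qed

definition rat_union :: "(rat \<times> rat) list \<Rightarrow> real set" where
  "rat_union l = (\<Union>(a, b)\<in>set l. {of_rat a<..<of_rat b})"

definition L2_dense :: "L2 set" where
  "L2_dense = range (\<lambda>l :: (rat \<times> (rat \<times> rat) list) list.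
     \<Sum>(q, c)\<leftarrow>l. of_rat q *\<^sub>R abs_L2 (indicat_real (rat_union c)))"

lemma countable_L2_dense: "countable L2_dense"
  unfolding L2_dense_def by auto

lemma L2_dense_basic: "abs_L2 (indicat_real (rat_union c)) \<in> L2_dense"
  unfolding L2_dense_def by (rule range_eqI[of _ _ "[(1, c)]"]) simp

lemma L2_dense_zero: "0 \<in> L2_dense"
  unfolding L2_dense_def by (rule range_eqI[of _ _ "[]"]) simp

lemma L2_dense_add: "f \<in> L2_dense \<Longrightarrow> g \<in> L2_dense \<Longrightarrow> f + g \<in> L2_dense"
  unfolding L2_dense_def
proof (elim imageE)
  fix k l :: "(rat \<times> (rat \<times> rat) list) list"
  let ?s = "\<lambda>l. \<Sum>(q, c)\<leftarrow>l. of_rat q *\<^sub>R abs_L2 (indicat_real (rat_union c))"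
  assume "f = ?s k" "g = ?s l"
  then have "f + g = ?s (k @ l)" by simp
  then show "f + g \<in> range ?s" by (rule range_eqI)
qed

lemma L2_dense_scale: "f \<in> L2_dense \<Longrightarrow> of_rat r *\<^sub>R f \<in> L2_dense"
  unfolding L2_dense_def
proof (elim imageE)
  fix k :: "(rat \<times> (rat \<times> rat) list) list"
  let ?s = "\<lambda>l. \<Sum>(q, c)\<leftarrow>l. of_rat q *\<^sub>R abs_L2 (indicat_real (rat_union c))"
  have "of_rat r *\<^sub>R ?s k = ?s (map (\<lambda>(q, c). (r * q, c)) k)"
    by (induction k) (auto simp: scaleR_add_right of_rat_mult)
  moreover assume "f = ?s k"
  ultimately have "of_rat r *\<^sub>R f = ?s (map (\<lambda>(q, c). (r * q, c)) k)" by simp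
  then show "of_rat r *\<^sub>R f \<in> range ?s" by (rule range_eqI)
qed

lemma subspace_closure_L2_dense: "subspace (closure L2_dense)"
proof (rule subspaceI)
  show "0 \<in> closure L2_dense"
    using L2_dense_zero closure_subset by blast
next
  fix f g assume "f \<in> closure L2_dense" "g \<in> closure L2_dense"
  then obtain F G where "\<And>n::nat. F n \<in> L2_dense" "F \<longlonglongrightarrow> f" "\<And>n::nat. G n \<in> L2_dense" "G \<longlonglongrightarrow> g"
    unfolding closure_sequential by blast
  then have "\<forall>n. F n + G n \<in> L2_dense" "(\<lambda>n. F n + G n) \<longlonglongrightarrow> f + g"
    by (auto intro: L2_dense_add tendsto_add)
  then show "f + g \<in> closure L2_dense"
    unfolding closure_sequential by (intro exI[of _ "\<lambda>n. F n + G n"]) simp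
next
  fix c :: real and f assume "f \<in> closure L2_dense"
  then obtain F where F: "\<And>n::nat. F n \<in> L2_dense" "F \<longlonglongrightarrow> f"
    unfolding closure_sequential by blast
  have "\<exists>q. \<bar>of_rat q - c\<bar> < inverse (real (Suc n))" for n
  proof -
    obtain q where "c < of_rat q" "of_rat q < c + inverse (real (Suc n))"
      using of_rat_dense[of c "c + inverse (real (Suc n))"] by auto
    then show ?thesis by (intro exI[of _ q]) linarith
  qed
  then obtain q where q: "\<And>n. \<bar>of_rat (q n) - c\<bar> < inverse (real (Suc n))" by metis
  have "(\<lambda>n. of_rat (q n) - c) \<longlonglongrightarrow> 0"
    by (rule Lim_null_comparison[OF _ LIMSEQ_inverse_real_of_nat])
       (use q in \<open>auto intro!: eventuallyI less_imp_le\<close>)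
  then have "(\<lambda>n. of_rat (q n)) \<longlonglongrightarrow> c"
    by (simp add: LIM_zero_iff)
  with F have "\<forall>n. of_rat (q n) *\<^sub>R F n \<in> L2_dense" "(\<lambda>n. of_rat (q n) *\<^sub>R F n) \<longlonglongrightarrow> c *\<^sub>R f"
    by (auto intro: L2_dense_scale tendsto_scaleR)
  then show "c *\<^sub>R f \<in> closure L2_dense"
    unfolding closure_sequential by (intro exI[of _ "\<lambda>n. of_rat (q n) *\<^sub>R F n"]) simp
qed

lemma open_in_closure_L2_dense:
  assumes "open U" "emeasure lborel U < \<infinity>"
  shows "abs_L2 (indicat_real U) \<in> closure L2_dense"
proof -
  define l where "l n = filter (\<lambda>(a, b). {of_rat a<..<of_rat b} \<subseteq> U) (map from_nat [0..<n])"
    for n :: nat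
  define W where "W n = rat_union (l n)" for n
  have W_sub: "W n \<subseteq> U" for n
    by (auto simp: W_def rat_union_def l_def)
  have W_sets [measurable]: "W n \<in> sets borel" for n
    by (auto simp: W_def rat_union_def intro!: borel_open)
  have W_mono: "incseq W"
    by (fastforce simp: incseq_def W_def rat_union_def l_def)
  have W_UN: "(\<Union>n. W n) = U"
  proof
    show "(\<Union>n. W n) \<subseteq> U" using W_sub by blast
    show "U \<subseteq> (\<Union>n. W n)"
    proof
      fix x assume "x \<in> U"
      then obtain e where e: "0 < e" "ball x e \<subseteq> U"
        using assms(1) open_contains_ball by blast
      obtain a where a: "x - e < of_rat a" "of_rat a < x"
        using of_rat_dense[of "x - e" x] e by auto
      obtain b where b: "x < of_rat b" "of_rat b < x + e"
        using of_rat_dense[of x "x + e"] e by auto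
      have "{of_rat a<..<of_rat b} \<subseteq> ball x e"
        using a b by (auto simp: dist_real_def)
      then have "{of_rat a<..<of_rat b} \<subseteq> U" using e by blast
      then have "(a, b) \<in> set (l (Suc (to_nat (a, b))))"
        by (auto simp: l_def intro!: image_eqI[of _ _ "to_nat (a, b)"])
      then have "x \<in> W (Suc (to_nat (a, b)))"
        unfolding W_def rat_union_def using a b by (intro UN_I[of "(a, b)"]) auto
      then show "x \<in> (\<Union>n. W n)" by blast
    qed
  qed
  have fin: "emeasure lborel (W n) < \<infinity>" for n
    using emeasure_mono[OF W_sub, of lborel n] assms by (auto simp: borel_open)
  have "(\<lambda>n. measure lborel (W n)) \<longlonglongrightarrow> measure lborel U"
  proof -
    have "range W \<subseteq> sets lborel" by auto
    from Lim_measure_incseq[OF this W_mono] show ?thesis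
      using assms(2) unfolding W_UN by simp
  qed
  then have "(\<lambda>n. sqrt (measure lborel U - measure lborel (W n))) \<longlonglongrightarrow> sqrt (measure lborel U - measure lborel U)"
    by (intro tendsto_intros)
  moreover have "sqrt (measure lborel U - measure lborel (W n))
    = norm (abs_L2 (indicat_real (W n)) - abs_L2 (indicat_real U))" for n
  proof -
    have "(norm (abs_L2 (indicat_real U) - abs_L2 (indicat_real (W n))))\<^sup>2
        = measure lborel U - measure lborel (W n)"
      using assms W_sub[of n] fin[of n]
      by (subst norm_L2_indicator_diff) (auto simp: borel_open measure_Diff)
    then show ?thesis
      by (metis norm_ge_zero norm_minus_commute real_sqrt_unique)
  qed
  ultimately have "(\<lambda>n. abs_L2 (indicat_real (W n))) \<longlonglongrightarrow> abs_L2 (indicat_real U)"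
    by (subst LIM_zero_iff[symmetric], subst tendsto_norm_zero_iff[symmetric]) simp
  then show ?thesis
    unfolding closure_sequential W_def
    by (intro exI[of _ "\<lambda>n. abs_L2 (indicat_real (rat_union (l n)))"]) (simp add: L2_dense_basic)
qed

lemma indicator_in_closure_L2_dense:
  assumes A: "A \<in> sets borel" "emeasure lborel A < \<infinity>"
  shows "abs_L2 (indicat_real A) \<in> closure L2_dense"
proof -
  have "\<exists>v\<in>closure L2_dense. dist v (abs_L2 (indicat_real A)) < e" if "e > 0" for e
  proof -
    have "0 < e\<^sup>2" using that by simp
    then obtain U where U: "open U" "A \<subseteq> U" "emeasure lborel (U - A) < ennreal (e\<^sup>2)"
      using outer_regular_lborel[OF A(1), of "e\<^sup>2"] by auto
    have sets: "U \<in> sets lborel" "A \<in> sets lborel" using U A by auto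
    have "emeasure lborel U = emeasure lborel A + emeasure lborel (U - A)"
      using U sets by (subst plus_emeasure) (auto simp: Un_absorb1)
    then have fin: "emeasure lborel U < \<infinity>"
      using A U(3) by (auto simp: less_top[symmetric] top_unique)
    have "(norm (abs_L2 (indicat_real U) - abs_L2 (indicat_real A)))\<^sup>2 = measure lborel (U - A)"
      using U A fin sets by (intro norm_L2_indicator_diff) auto
    also have "\<dots> < e\<^sup>2"
    proof -
      have "emeasure lborel (U - A) \<noteq> \<infinity>"
        using U(3) by auto
      then have "ennreal (measure lborel (U - A)) < ennreal (e\<^sup>2)"
        using U(3) by (simp add: emeasure_eq_ennreal_measure)
      then show ?thesis by (simp add: ennreal_less_iff)
    qed
    finally have "norm (abs_L2 (indicat_real U) - abs_L2 (indicat_real A)) < e"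
      using that by (simp add: power2_less_imp_less)
    then show ?thesis
      using open_in_closure_L2_dense[OF U(1) fin] by (auto simp: dist_norm)
  qed
  then have "abs_L2 (indicat_real A) \<in> closure (closure L2_dense)"
    unfolding closure_approachable[of _ "closure L2_dense"] by blast
  then show ?thesis by simp
qed

lemma simple_in_closure_L2_dense:
  assumes s: "simple_function lborel s" and sq: "square_integrable s"
  shows "abs_L2 s \<in> closure L2_dense"
proof -
  let ?F = "range s - {0}"
  have meas: "s -` {y} \<in> sets borel" for y
    using simple_functionD(2)[OF s, of "{y}"] by simp
  have fin: "emeasure lborel (s -` {y}) < \<infinity>" if "y \<noteq> 0" for y
  proof -
    have "integrable lborel (\<lambda>t. (s t)\<^sup>2 / y\<^sup>2)"
      using sq by (auto simp: square_integrable_def)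
    then have "integrable lborel (indicat_real (s -` {y}))"
      by (rule Bochner_Integration.integrable_bound)
         (use meas that in \<open>auto simp: indicator_def\<close>)
    then show ?thesis
      by (simp add: integrable_indicator_iff)
  qed
  have part: "square_integrable (\<lambda>t. \<Sum>y\<in>G. y * indicat_real (s -` {y}) t) \<and>
      abs_L2 (\<lambda>t. \<Sum>y\<in>G. y * indicat_real (s -` {y}) t) \<in> closure L2_dense"
    if "finite G" "0 \<notin> G" for G
    using that
  proof (induction G rule: finite_induct)
    case empty
    have "abs_L2 (\<lambda>t. 0) = 0" by (simp add: zero_L2_def)
    then show ?case
      using square_integrable_zero subspace_0[OF subspace_closure_L2_dense] by simp
  next
    case (insert y G)
    have i: "square_integrable (indicat_real (s -` {y}))"
      using insert fin meas by (intro square_integrable_indicator) auto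
    have j: "square_integrable (\<lambda>t. y * indicat_real (s -` {y}) t)"
      by (rule square_integrable_scale[OF i])
    have "abs_L2 (\<lambda>t. y * indicat_real (s -` {y}) t + (\<Sum>y\<in>G. y * indicat_real (s -` {y}) t))
       = y *\<^sub>R abs_L2 (indicat_real (s -` {y})) + abs_L2 (\<lambda>t. \<Sum>y\<in>G. y * indicat_real (s -` {y}) t)"
      using insert i j by (simp add: abs_L2_add abs_L2_scale)
    then have "abs_L2 (\<lambda>t. y * indicat_real (s -` {y}) t + (\<Sum>y\<in>G. y * indicat_real (s -` {y}) t))
       \<in> closure L2_dense"
      using insert fin meas
      by (auto intro!: subspace_add subspace_scale subspace_closure_L2_dense indicator_in_closure_L2_dense)
    moreover have "(\<Sum>z\<in>insert y G. z * indicat_real (s -` {z}) t)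
        = y * indicat_real (s -` {y}) t + (\<Sum>z\<in>G. z * indicat_real (s -` {z}) t)" for t
      by (rule sum.insert[OF insert(1,2)])
    ultimately show ?case
      using insert j by (simp only: square_integrable_add insert_iff de_Morgan_disj not_False_eq_True simp_thms)
  qed
  have fr: "finite ?F" using simple_functionD(1)[OF s] by simp
  have "s t = (\<Sum>y\<in>?F. y * indicat_real (s -` {y}) t)" for t
  proof -
    have "(\<Sum>y\<in>?F. y * indicat_real (s -` {y}) t) = (\<Sum>y\<in>?F. if y = s t then s t else 0)"
      by (intro sum.cong) (auto simp: indicator_def)
    also have "\<dots> = s t"
      using fr by (auto simp: sum.delta)
    finally show ?thesis by simp
  qed
  then have "s = (\<lambda>t. \<Sum>y\<in>?F. y * indicat_real (s -` {y}) t)" by blast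
  then show ?thesis
    using part[OF fr] by simp
qed

lemma closure_L2_dense: "closure L2_dense = UNIV"
proof -
  have "f \<in> closure L2_dense" for f
  proof -
    obtain g where g: "square_integrable g" "f = abs_L2 g"
      by (rule L2_cases)
    then have [measurable]: "g \<in> borel_measurable borel" and gi: "integrable lborel (\<lambda>t. (g t)\<^sup>2)"
      by (auto simp: square_integrable_def)
    have "g \<in> borel_measurable lborel" by simp
    from borel_measurable_implies_sequence_metric[OF this, of 0]
    obtain s where s: "\<And>i. simple_function lborel (s i)" "\<And>t. (\<lambda>i. s i t) \<longlonglongrightarrow> g t"
      "\<And>i t. \<bar>s i t\<bar> \<le> 2 * \<bar>g t\<bar>"
      by (auto simp: dist_real_def)
    have [measurable]: "s i \<in> borel_measurable borel" for i
      using borel_measurable_simple_function[OF s(1)] by simp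
    have bnd: "(s i t)\<^sup>2 \<le> 4 * (g t)\<^sup>2" for i t
      using power_mono[OF s(3)[of i t], of 2] by (simp add: power_mult_distrib)
    have sq: "square_integrable (s i)" for i
      unfolding square_integrable_def
    proof
      show "integrable lborel (\<lambda>t. (s i t)\<^sup>2)"
        by (rule Bochner_Integration.integrable_bound[of _ "\<lambda>t. 4 * (g t)\<^sup>2"])
           (use gi bnd in auto)
    qed simp
    have "(\<lambda>i. integral\<^sup>L lborel (\<lambda>t. (s i t - g t)\<^sup>2)) \<longlonglongrightarrow> integral\<^sup>L lborel (\<lambda>t::real. 0)"
    proof (rule integral_dominated_convergence[where w="\<lambda>t. 10 * (g t)\<^sup>2"])
      show "integrable lborel (\<lambda>t. 10 * (g t)\<^sup>2)" using gi by simp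
      show "AE t in lborel. (\<lambda>i. (s i t - g t)\<^sup>2) \<longlonglongrightarrow> 0"
      proof (rule AE_I2)
        fix t
        have "(\<lambda>i. (s i t - g t)\<^sup>2) \<longlonglongrightarrow> (g t - g t)\<^sup>2"
          by (intro tendsto_intros s)
        then show "(\<lambda>i. (s i t - g t)\<^sup>2) \<longlonglongrightarrow> 0" by simp
      qed
      fix i
      have "(s i t - g t)\<^sup>2 \<le> 10 * (g t)\<^sup>2" for t
      proof -
        have "0 \<le> (s i t + g t)\<^sup>2" by simp
        then have "(s i t - g t)\<^sup>2 \<le> 2 * (s i t)\<^sup>2 + 2 * (g t)\<^sup>2"
          by (simp add: power2_eq_square algebra_simps)
        with bnd[of i t] show ?thesis by simp
      qed
      then show "AE t in lborel. norm ((s i t - g t)\<^sup>2) \<le> 10 * (g t)\<^sup>2" by simp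
    qed simp_all
    then have "(\<lambda>i. (norm (abs_L2 (s i) - f))\<^sup>2) \<longlonglongrightarrow> 0"
      using norm_abs_L2[OF square_integrable_diff[OF sq g(1)]] by (simp add: g abs_L2_diff sq)
    then have "(\<lambda>i. sqrt ((norm (abs_L2 (s i) - f))\<^sup>2)) \<longlonglongrightarrow> sqrt 0"
      by (rule tendsto_real_sqrt)
    then have "(\<lambda>i. abs_L2 (s i)) \<longlonglongrightarrow> f"
      by (subst LIM_zero_iff[symmetric], subst tendsto_norm_zero_iff[symmetric]) simp
    moreover have "\<forall>i. abs_L2 (s i) \<in> closure L2_dense"
      using simple_in_closure_L2_dense s sq by blast
    ultimately have "f \<in> closure (closure L2_dense)"
      unfolding closure_sequential[of _ "closure L2_dense"] by (intro exI[of _ "\<lambda>i. abs_L2 (s i)"]) simp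
    then show ?thesis by simp
  qed
  then show ?thesis by blast
qed

instance L2 :: second_countable_topology
proof
  let ?B = "(\<lambda>(f, q). ball f (of_rat q)) ` (L2_dense \<times> (UNIV :: rat set))"
  have "topological_basis ?B"
  proof (rule topological_basisI)
    show "open B" if "B \<in> ?B" for B
      using that by auto
  next
    fix U :: "L2 set" and f assume "open U" "f \<in> U"
    then obtain e where e: "0 < e" "ball f e \<subseteq> U"
      using open_contains_ball by blast
    obtain q where q: "0 < real_of_rat q" "real_of_rat q < e / 2"
      using of_rat_dense[of 0 "e / 2"] e by auto
    obtain g where g: "g \<in> L2_dense" "dist g f < of_rat q"
      using closure_L2_dense q(1) closure_approachable[of f L2_dense] by blast
    have "f \<in> ball g (of_rat q)" using g by simp
    moreover have "ball g (of_rat q) \<subseteq> U"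
    proof
      fix h assume "h \<in> ball g (of_rat q)"
      then have "dist f h < e"
        using g q dist_triangle[of f h g] by (simp add: dist_commute)
      then show "h \<in> U" using e by auto
    qed
    ultimately show "\<exists>B\<in>?B. f \<in> B \<and> B \<subseteq> U"
      using g(1) by (intro bexI[of _ "ball g (of_rat q)"]) auto
  qed
  moreover have "countable ?B"
    using countable_L2_dense by auto
  ultimately show "\<exists>B :: L2 set set. countable B \<and> open = generate_topology B"
    using topological_basis_imp_subbasis by blast
qed

section \<open>The subspace $L^2(T)$\<close>

text \<open>
  A function on \<open>T\<close> is identified with its extension by zero to the real line. The two lemmas
  below show that this turns $L^2(T)$, with inner product $\int_T a(t) b(t)\,dt$, into \<open>L2_on T\<close>.
\<close>

lift_definition vanishes_outside :: "real set \<Rightarrow> L2 \<Rightarrow> bool"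
  is "\<lambda>T f. AE t in lborel. t \<notin> T \<longrightarrow> f t = 0"
  unfolding L2_rel_def by (auto elim: AE_mp)

definition L2_on :: "real set \<Rightarrow> L2 set" where
  "L2_on T = {f. vanishes_outside T f}"

lemma extend_by_zero_in_L2_on:
  assumes T: "T \<in> sets borel" and f: "f \<in> borel_measurable borel"
    and fi: "set_integrable lborel T (\<lambda>t. (f t)\<^sup>2)"
  shows "square_integrable (\<lambda>t. indicator T t * f t)"
    and "abs_L2 (\<lambda>t. indicator T t * f t) \<in> L2_on T"
proof -
  have "(\<lambda>t. (indicator T t * f t)\<^sup>2) = (\<lambda>t. indicator T t *\<^sub>R (f t)\<^sup>2)"
    by (auto simp: indicator_def)
  then show sq: "square_integrable (\<lambda>t. indicator T t * f t)"
    using assms by (auto simp: square_integrable_def set_integrable_def)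
  show "abs_L2 (\<lambda>t. indicator T t * f t) \<in> L2_on T"
    using sq by (simp add: L2_on_def vanishes_outside.abs_eq L2_rel_def)
qed

lemma inner_L2_on:
  assumes T: "T \<in> sets borel" and f: "f \<in> borel_measurable borel" and g: "g \<in> borel_measurable borel"
    and fi: "set_integrable lborel T (\<lambda>t. (f t)\<^sup>2)" and gi: "set_integrable lborel T (\<lambda>t. (g t)\<^sup>2)"
  shows "inner (abs_L2 (\<lambda>t. indicator T t * f t)) (abs_L2 (\<lambda>t. indicator T t * g t))
    = (LBINT t:T. f t * g t)"
proof -
  have "inner (abs_L2 (\<lambda>t. indicator T t * f t)) (abs_L2 (\<lambda>t. indicator T t * g t))
      = (LBINT t. (indicator T t * f t) * (indicator T t * g t))"
    using extend_by_zero_in_L2_on(1)[OF T f fi] extend_by_zero_in_L2_on(1)[OF T g gi]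
    by (simp add: inner_L2.abs_eq L2_rel_def)
  also have "\<dots> = (LBINT t:T. f t * g t)"
    unfolding set_lebesgue_integral_def
    by (intro Bochner_Integration.integral_cong) (auto simp: indicator_def)
  finally show ?thesis .
qed

section \<open>Supports, projections and least squares\<close>

definition rv_support :: "'w measure \<Rightarrow> ('w \<Rightarrow> 'a :: topological_space) \<Rightarrow> 'a set" where
  "rv_support M X = {a. \<forall>U. open U \<and> a \<in> U \<longrightarrow> 0 < measure (distr M borel X) U}"

definition closed_span :: "'a :: real_normed_vector set \<Rightarrow> 'a set" where
  "closed_span A = (\<lambda>V. closed V \<and> subspace V) hull A"

definition orth_proj :: "'a :: real_inner set \<Rightarrow> 'a \<Rightarrow> 'a" where
  "orth_proj V f = (THE p. p \<in> V \<and> f - p \<in> orthogonal_comp V)"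

definition sum_sq_resid :: "(nat \<Rightarrow> L2) \<Rightarrow> (nat \<Rightarrow> real) \<Rightarrow> nat \<Rightarrow> L2 \<Rightarrow> real" where
  "sum_sq_resid xs ys n b = (\<Sum>i<n. (ys i - inner (xs i) b)\<^sup>2)"

definition least_squares :: "L2 set \<Rightarrow> (nat \<Rightarrow> L2) \<Rightarrow> (nat \<Rightarrow> real) \<Rightarrow> nat \<Rightarrow> L2" where
  "least_squares D xs ys n = arg_min_on (sum_sq_resid xs ys n) D"

definition least_squares_unique :: "L2 set \<Rightarrow> (nat \<Rightarrow> L2) \<Rightarrow> (nat \<Rightarrow> real) \<Rightarrow> nat \<Rightarrow> bool" where
  "least_squares_unique D xs ys n \<longleftrightarrow> (\<exists>!b. is_arg_min (sum_sq_resid xs ys n) (\<lambda>b. b \<in> D) b)"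

text \<open>
  Convergence in probability of \<open>b n\<close> to \<open>c\<close>. The deviation events are covered by measurable
  sets because \<open>least_squares\<close>, being an arbitrary selection where the minimizer is not unique,
  need not be measurable there; for measurable \<open>b n\<close> this is the usual notion.
\<close>

definition consistent_estimator ::
    "'w measure \<Rightarrow> (nat \<Rightarrow> 'w \<Rightarrow> 'a :: metric_space) \<Rightarrow> 'a \<Rightarrow> bool" where
  "consistent_estimator M b c \<longleftrightarrow>
     (\<forall>e>0. \<exists>A. (\<forall>n. A n \<in> sets M \<and> {\<omega> \<in> space M. e < dist (b n \<omega>) c} \<subseteq> A n) \<and>
       (\<lambda>n. measure M (A n)) \<longlonglongrightarrow> 0)"

section \<open>The bias terms\<close>

text \<open>
  \<open>phi\<close> enumerates an orthonormal basis \<open>phi 0, \<dots>, phi (d - 1)\<close>. Where the matrix to be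
  inverted is singular, \<open>bias_n\<close> and \<open>bias\<close> have no meaning.
\<close>

definition of_coords :: "(nat \<Rightarrow> L2) \<Rightarrow> real Matrix.vec \<Rightarrow> L2" where
  "of_coords phi v = (\<Sum>j<dim_vec v. vec_index v j *\<^sub>R phi j)"

definition design_mat :: "(nat \<Rightarrow> L2) \<Rightarrow> nat \<Rightarrow> (nat \<Rightarrow> L2) \<Rightarrow> nat \<Rightarrow> real Matrix.mat" where
  "design_mat phi d xs n = Matrix.mat n d (\<lambda>(i, j). inner (xs i) (phi j))"

definition gram_mat :: "(nat \<Rightarrow> L2) \<Rightarrow> nat \<Rightarrow> (nat \<Rightarrow> L2) \<Rightarrow> nat \<Rightarrow> real Matrix.mat" where
  "gram_mat phi d xs n = transpose_mat (design_mat phi d xs n) * design_mat phi d xs n"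

definition bias_n :: "(nat \<Rightarrow> L2) \<Rightarrow> nat \<Rightarrow> (nat \<Rightarrow> L2) \<Rightarrow> L2 \<Rightarrow> nat \<Rightarrow> L2" where
  "bias_n phi d xs bF n = of_coords phi
     (the (mat_inverse (gram_mat phi d xs n)) *\<^sub>v
       (transpose_mat (design_mat phi d xs n) *\<^sub>v Matrix.vec n (\<lambda>i. inner (xs i) bF)))"

definition bias :: "'w measure \<Rightarrow> ('w \<Rightarrow> L2) \<Rightarrow> (nat \<Rightarrow> L2) \<Rightarrow> nat \<Rightarrow> L2 \<Rightarrow> L2" where
  "bias M X phi d bF = of_coords phi
     (the (mat_inverse (Matrix.mat d d
         (\<lambda>(j, k). integral\<^sup>L M (\<lambda>\<omega>. inner (X \<omega>) (phi j) * inner (X \<omega>) (phi k))))) *\<^sub>v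
       Matrix.vec d (\<lambda>j. integral\<^sup>L M (\<lambda>\<omega>. inner (X \<omega>) (phi j) * inner (X \<omega>) bF)))"

end

(* Over D the residual sum of squares only sees the projections <x_i, pi b>, since almost surely all
   x_i lie in S. Hence in the coordinates of E the estimator solves the normal equations of the
   regression on E, in which the normalised Gram matrix converges to the second moment matrix of X on E
   by the strong law of large numbers. That matrix is invertible: a vector of the closed span of the
   support on which the quadratic form vanishes is orthogonal to itself. So the limit is a = beta^E +
   gamma as soon as the empirical covariances of the <x_i, phi_j> with the residuals
   <x_i, beta^F - gamma> + eps_i vanish in the limit; for the first summand this is the definition of
   gamma. The eps_i need not be independent, or even uncorrelated, but the products <x_i, phi_j> eps_i
   are uncorrelated because the x_i are independent and centred, and uncorrelated variables with bounded
   variance satisfy the strong law. *)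

theory Submission
  imports Defs "HOL-Library.Discrete_Functions" "Jordan_Normal_Form.Determinant"
begin

section \<open>Strong laws of large numbers\<close>

text \<open>The two strong laws answer to different moment conditions. The products
  \<open><x_i, v> <x_i, w>\<close> are integrable but may have infinite variance, since only the
  second moment of the norm of X is assumed. They call for an i.i.d. law under a first moment,
  reached by truncation and a maximal inequality that rests on stationarity. The products
  \<open><x_i, v> eps_i\<close> do have bounded second moments, because independence factors them,
  but neither a common law nor independence among themselves, so orthogonality is what is left to
  exploit. The passage from E to D is made by a basis instead of a norm bound on the inverse of
  \<pi>: the preimages \<open>\<psi> j\<close> of the \<open>\<phi> j\<close> span D and, though in
  general not orthonormal, have the same inner products with every x_i in S. The Gram matrices
  therefore coincide, and convergence of coordinates is already convergence in D. Accordingly the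
  limit theorem for least squares is pathwise and for a family that need not be orthonormal;
  probability enters only through the limits that it assumes. Since the Gram matrix may be singular
  for small n, eventual invertibility and uniqueness are proved along with the limit.\<close>

lemma integral_cong_distr:
  fixes h :: "'b :: topological_space \<Rightarrow> real"
  assumes distr: "distr M borel X = distr N borel Y"
    and [measurable]: "X \<in> borel_measurable M" "Y \<in> borel_measurable N" "h \<in> borel_measurable borel"
  shows "integrable M (\<lambda>\<omega>. h (X \<omega>)) \<longleftrightarrow> integrable N (\<lambda>\<omega>. h (Y \<omega>))"
    and "(\<integral>\<omega>. h (X \<omega>) \<partial>M) = (\<integral>\<omega>. h (Y \<omega>) \<partial>N)"
  using integrable_distr_eq[of X M borel h] integrable_distr_eq[of Y N borel h]
    integral_distr[of X M borel h] integral_distr[of Y N borel h]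
  by (simp_all add: distr)

text \<open>By Tonelli the series of the \<open>W n\<close> has a finite integral, hence is finite
  almost everywhere. This takes the place of Chebyshev with Borel-Cantelli.\<close>

lemma AE_LIMSEQ_zero_of_summable_integral:
  fixes W :: "nat \<Rightarrow> 'a \<Rightarrow> real"
  assumes int: "\<And>n. integrable M (W n)" and nonneg: "\<And>n \<omega>. 0 \<le> W n \<omega>"
    and sum: "summable (\<lambda>n. integral\<^sup>L M (W n))"
  shows "AE \<omega> in M. (\<lambda>n. W n \<omega>) \<longlonglongrightarrow> 0"
proof -
  have [measurable]: "W n \<in> borel_measurable M" for n
    using int by auto
  have "(\<integral>\<^sup>+\<omega>. (\<Sum>n. ennreal (W n \<omega>)) \<partial>M) = (\<Sum>n. \<integral>\<^sup>+\<omega>. ennreal (W n \<omega>) \<partial>M)"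
    by (rule nn_integral_suminf) measurable
  also have "\<dots> = (\<Sum>n. ennreal (integral\<^sup>L M (W n)))"
    using int nonneg by (subst nn_integral_eq_integral) auto
  also have "\<dots> = ennreal (\<Sum>n. integral\<^sup>L M (W n))"
    using sum nonneg by (intro suminf_ennreal2) auto
  finally have "AE \<omega> in M. (\<Sum>n. ennreal (W n \<omega>)) \<noteq> \<infinity>"
    by (intro nn_integral_PInf_AE) auto
  then show ?thesis
  proof eventually_elim
    case (elim \<omega>)
    then have "summable (\<lambda>n. W n \<omega>)"
      using nonneg by (intro summable_suminf_not_top) auto
    then show ?case by (rule summable_LIMSEQ_zero)
  qed
qed

text \<open>The off-diagonal terms of the expanded square integrate to zero. A general
  \<open>A\<close> is allowed because the sums between consecutive squares start at
  \<open>m\<^sup>2\<close>.\<close>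

lemma second_moment_sum_uncorrelated:
  fixes Z :: "'i \<Rightarrow> 'a \<Rightarrow> real"
  assumes int: "\<And>i j. integrable M (\<lambda>\<omega>. Z i \<omega> * Z j \<omega>)"
    and orth: "\<And>i j. i \<noteq> j \<Longrightarrow> (\<integral>\<omega>. Z i \<omega> * Z j \<omega> \<partial>M) = 0"
    and bound: "\<And>i. (\<integral>\<omega>. (Z i \<omega>)\<^sup>2 \<partial>M) \<le> C"
    and fin: "finite A"
  shows "integrable M (\<lambda>\<omega>. (\<Sum>i\<in>A. Z i \<omega>)\<^sup>2)"
    and "(\<integral>\<omega>. (\<Sum>i\<in>A. Z i \<omega>)\<^sup>2 \<partial>M) \<le> real (card A) * C"
proof -
  have eq: "(\<Sum>i\<in>A. Z i \<omega>)\<^sup>2 = (\<Sum>i\<in>A. \<Sum>j\<in>A. Z i \<omega> * Z j \<omega>)" for \<omega>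
    by (simp add: power2_eq_square sum_product)
  show "integrable M (\<lambda>\<omega>. (\<Sum>i\<in>A. Z i \<omega>)\<^sup>2)"
    unfolding eq using int by auto
  have "(\<integral>\<omega>. (\<Sum>i\<in>A. Z i \<omega>)\<^sup>2 \<partial>M) = (\<Sum>i\<in>A. \<Sum>j\<in>A. \<integral>\<omega>. Z i \<omega> * Z j \<omega> \<partial>M)"
    unfolding eq using int by (simp add: Bochner_Integration.integral_sum)
  also have "\<dots> = (\<Sum>i\<in>A. \<Sum>j\<in>A. if j = i then \<integral>\<omega>. (Z i \<omega>)\<^sup>2 \<partial>M else 0)"
    using orth by (intro sum.cong refl) (auto simp: power2_eq_square)
  also have "\<dots> = (\<Sum>i\<in>A. \<integral>\<omega>. (Z i \<omega>)\<^sup>2 \<partial>M)"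
    using fin by simp
  also have "\<dots> \<le> (\<Sum>i\<in>A. C)"
    by (intro sum_mono bound)
  finally show "(\<integral>\<omega>. (\<Sum>i\<in>A. Z i \<omega>)\<^sup>2 \<partial>M) \<le> real (card A) * C" by simp
qed

lemma filterlim_floor_sqrt: "filterlim floor_sqrt at_top sequentially"
  unfolding filterlim_at_top
proof
  fix k :: nat
  have "k \<le> floor_sqrt n" if "k\<^sup>2 \<le> n" for n
    using that by (simp add: le_floor_sqrt_iff)
  then show "\<forall>\<^sub>F n in sequentially. k \<le> floor_sqrt n"
    by (auto simp: eventually_sequentially)
qed

text \<open>Rajchman's argument: the averages converge along the squares by Chebyshev, and the
  fluctuation between consecutive squares is small in mean square as well.\<close>
theorem strong_law_uncorrelated:
  fixes Z :: "nat \<Rightarrow> 'a \<Rightarrow> real"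
  assumes int: "\<And>i j. integrable M (\<lambda>\<omega>. Z i \<omega> * Z j \<omega>)"
    and orth: "\<And>i j. i \<noteq> j \<Longrightarrow> (\<integral>\<omega>. Z i \<omega> * Z j \<omega> \<partial>M) = 0"
    and bound: "\<And>i. (\<integral>\<omega>. (Z i \<omega>)\<^sup>2 \<partial>M) \<le> C"
  shows "AE \<omega> in M. (\<lambda>n. (\<Sum>i<n. Z i \<omega>) / real n) \<longlonglongrightarrow> 0"
proof -
  \<comment> \<open>The first term is the squared average at time \<open>m\<^sup>2\<close>. The
    second controls all fluctuations up to the next square, their maximum being replaced by their
    sum.\<close>
  define W where "W m \<omega> = ((\<Sum>i<m\<^sup>2. Z i \<omega>) / (real m)\<^sup>2)\<^sup>2
    + (\<Sum>n\<in>{m\<^sup>2..<(Suc m)\<^sup>2}. ((\<Sum>i\<in>{m\<^sup>2..<n}. Z i \<omega>) / (real m)\<^sup>2)\<^sup>2)" for m \<omega>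
  note sm = second_moment_sum_uncorrelated[OF int orth bound]
  have C: "0 \<le> C"
    using order_trans[OF _ bound[of 0]] by simp
  have W_int: "integrable M (W m)" for m
    unfolding W_def[abs_def] power_divide by (intro Bochner_Integration.integrable_add
      Bochner_Integration.integrable_sum integrable_divide sm(1)) auto
  have W_nonneg: "0 \<le> W m \<omega>" for m \<omega>
    unfolding W_def by (intro add_nonneg_nonneg sum_nonneg) auto
  \<comment> \<open>The constant is 1 + 3 * 3: the average contributes \<open>C / m\<^sup>2\<close>,
    and each of the 2m + 1 \<le> 3m fluctuations, having at most 3m terms, contributes at most
    \<open>3 * m * C / m^4\<close>.\<close>
  have W_le: "integral\<^sup>L M (W m) \<le> 10 * C * (1 / (real m)\<^sup>2)" for m
  proof (cases "m = 0")
    case True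
    \<comment> \<open>Division by zero yields 0, so the claimed bound is 0 here and
      \<open>W 0\<close> has to vanish exactly.\<close>
    moreover have "W 0 = (\<lambda>_. 0)" by (simp add: W_def fun_eq_iff)
    ultimately show ?thesis by simp
  next
    case False
    then have m: "1 \<le> real m" by simp
    have card: "real (n - m\<^sup>2) \<le> 3 * real m" if "n \<in> {m\<^sup>2..<(Suc m)\<^sup>2}" for n
    proof -
      have "n - m\<^sup>2 \<le> 3 * m" using that False by (auto simp: power2_eq_square)
      then show ?thesis by linarith
    qed
    have i: "integrable M (\<lambda>\<omega>. ((\<Sum>i\<in>A. Z i \<omega>) / (real m)\<^sup>2)\<^sup>2)" if "finite A" for A
      unfolding power_divide by (intro integrable_divide sm(1) that)
    have "integral\<^sup>L M (W m) = (\<integral>\<omega>. ((\<Sum>i<m\<^sup>2. Z i \<omega>) / (real m)\<^sup>2)\<^sup>2 \<partial>M)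
        + (\<integral>\<omega>. (\<Sum>n\<in>{m\<^sup>2..<(Suc m)\<^sup>2}. ((\<Sum>i\<in>{m\<^sup>2..<n}. Z i \<omega>) / (real m)\<^sup>2)\<^sup>2) \<partial>M)"
      unfolding W_def
      by (intro Bochner_Integration.integral_add Bochner_Integration.integrable_sum i) auto
    also have "(\<integral>\<omega>. (\<Sum>n\<in>{m\<^sup>2..<(Suc m)\<^sup>2}. ((\<Sum>i\<in>{m\<^sup>2..<n}. Z i \<omega>) / (real m)\<^sup>2)\<^sup>2) \<partial>M)
        = (\<Sum>n\<in>{m\<^sup>2..<(Suc m)\<^sup>2}. \<integral>\<omega>. ((\<Sum>i\<in>{m\<^sup>2..<n}. Z i \<omega>) / (real m)\<^sup>2)\<^sup>2 \<partial>M)"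
      by (intro Bochner_Integration.integral_sum i) auto
    also have "(\<integral>\<omega>. ((\<Sum>i<m\<^sup>2. Z i \<omega>) / (real m)\<^sup>2)\<^sup>2 \<partial>M) + \<dots>
        = (\<integral>\<omega>. (\<Sum>i<m\<^sup>2. Z i \<omega>)\<^sup>2 \<partial>M) / ((real m)\<^sup>2)\<^sup>2
        + (\<Sum>n\<in>{m\<^sup>2..<(Suc m)\<^sup>2}. (\<integral>\<omega>. (\<Sum>i\<in>{m\<^sup>2..<n}. Z i \<omega>)\<^sup>2 \<partial>M) / ((real m)\<^sup>2)\<^sup>2)"
      by (simp only: power_divide integral_divide_zero)
    also have "\<dots> \<le> (real (m\<^sup>2) * C) / ((real m)\<^sup>2)\<^sup>2
        + (\<Sum>n\<in>{m\<^sup>2..<(Suc m)\<^sup>2}. (3 * real m * C) / ((real m)\<^sup>2)\<^sup>2)"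
    proof (intro add_mono sum_mono divide_right_mono)
      show "(\<integral>\<omega>. (\<Sum>i<m\<^sup>2. Z i \<omega>)\<^sup>2 \<partial>M) \<le> real (m\<^sup>2) * C"
        using sm(2)[where A="{..<m\<^sup>2}"] by simp
      show "(\<integral>\<omega>. (\<Sum>i\<in>{m\<^sup>2..<n}. Z i \<omega>)\<^sup>2 \<partial>M) \<le> 3 * real m * C"
        if "n \<in> {m\<^sup>2..<(Suc m)\<^sup>2}" for n
      proof -
        have "(\<integral>\<omega>. (\<Sum>i\<in>{m\<^sup>2..<n}. Z i \<omega>)\<^sup>2 \<partial>M) \<le> real (n - m\<^sup>2) * C"
          using sm(2)[where A="{m\<^sup>2..<n}"] by simp
        also have "\<dots> \<le> 3 * real m * C"
          using C card[OF that] by (intro mult_right_mono) auto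
        finally show ?thesis .
      qed
    qed auto
    also have "\<dots> = C / (real m)\<^sup>2 + real ((Suc m)\<^sup>2 - m\<^sup>2) * (3 * C) / (real m)^3"
      using m by (simp add: field_simps power2_eq_square power3_eq_cube)
    also have "\<dots> \<le> C / (real m)\<^sup>2 + (3 * real m) * (3 * C) / (real m)^3"
    proof -
      have "(Suc m)\<^sup>2 - m\<^sup>2 \<le> 3 * m" using False by (auto simp: power2_eq_square)
      then have "real ((Suc m)\<^sup>2 - m\<^sup>2) \<le> 3 * real m" by linarith
      then show ?thesis
        using C by (intro add_left_mono divide_right_mono mult_right_mono) auto
    qed
    also have "\<dots> = 10 * C * (1 / (real m)\<^sup>2)"
      using m by (simp add: field_simps power2_eq_square power3_eq_cube)
    finally show ?thesis .
  qed
  have "summable (\<lambda>m. integral\<^sup>L M (W m))"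
  proof (rule summable_comparison_test)
    show "summable (\<lambda>m. 10 * C * (1 / (real m)\<^sup>2))"
      using inverse_power_summable[of 2, where 'a=real]
      by (intro summable_mult) (simp add: field_simps)
    show "\<exists>N. \<forall>m\<ge>N. norm (integral\<^sup>L M (W m)) \<le> 10 * C * (1 / (real m)\<^sup>2)"
      using W_le W_nonneg by (auto simp: integral_nonneg)
  qed
  from AE_LIMSEQ_zero_of_summable_integral[OF W_int W_nonneg this] show ?thesis
  proof eventually_elim
    case (elim \<omega>)
    show ?case
    proof (rule Lim_null_comparison)
      have "(\<lambda>m. 2 * sqrt (W m \<omega>)) \<longlonglongrightarrow> 2 * sqrt 0"
        by (intro tendsto_intros elim)
      then show "(\<lambda>n. 2 * sqrt (W (floor_sqrt n) \<omega>)) \<longlonglongrightarrow> 0"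
        using filterlim_compose[OF _ filterlim_floor_sqrt] by simp
      \<comment> \<open>With m the integer square root of n, the sum splits at
        \<open>m\<^sup>2\<close>. Dividing by \<open>m\<^sup>2\<close> instead of n only enlarges
        it, and each of the two pieces is then at most \<open>sqrt (W m \<omega>)\<close>.\<close>
      show "\<forall>\<^sub>F n in sequentially.
          norm ((\<Sum>i<n. Z i \<omega>) / real n) \<le> 2 * sqrt (W (floor_sqrt n) \<omega>)"
        using eventually_gt_at_top[of 0]
      proof eventually_elim
        case (elim n)
        define m where "m = floor_sqrt n"
        have m: "0 < m" "m\<^sup>2 \<le> n" "n < (Suc m)\<^sup>2"
          using elim floor_sqrt_power2_le[of n] Suc_floor_sqrt_power2_gt[of n]
          by (auto simp: m_def)
        have split: "(\<Sum>i<n. Z i \<omega>) = (\<Sum>i<m\<^sup>2. Z i \<omega>) + (\<Sum>i\<in>{m\<^sup>2..<n}. Z i \<omega>)"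
          using m(2) by (subst sum.union_disjoint[symmetric]) (auto intro!: sum.cong)
        have W1: "\<bar>(\<Sum>i<m\<^sup>2. Z i \<omega>) / (real m)\<^sup>2\<bar> \<le> sqrt (W m \<omega>)"
          unfolding W_def by (intro real_le_rsqrt) (simp add: sum_nonneg power2_abs del: abs_divide)
        have "((\<Sum>i\<in>{m\<^sup>2..<n}. Z i \<omega>) / (real m)\<^sup>2)\<^sup>2
            \<le> (\<Sum>n\<in>{m\<^sup>2..<(Suc m)\<^sup>2}. ((\<Sum>i\<in>{m\<^sup>2..<n}. Z i \<omega>) / (real m)\<^sup>2)\<^sup>2)"
          using m by (intro member_le_sum) auto
        then have W2: "\<bar>(\<Sum>i\<in>{m\<^sup>2..<n}. Z i \<omega>) / (real m)\<^sup>2\<bar> \<le> sqrt (W m \<omega>)"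
          unfolding W_def by (intro real_le_rsqrt) (simp add: add_increasing power2_abs del: abs_divide)
        have "\<bar>(\<Sum>i<n. Z i \<omega>) / real n\<bar> \<le> \<bar>(\<Sum>i<n. Z i \<omega>) / (real m)\<^sup>2\<bar>"
        proof -
          have "(real m)\<^sup>2 \<le> real n" using m(2) by (metis of_nat_le_iff of_nat_power)
          then show ?thesis
            using m(1) elim by (auto simp: abs_divide intro!: divide_left_mono mult_pos_pos)
        qed
        also have "\<dots> \<le> 2 * sqrt (W m \<omega>)"
          using W1 W2 unfolding split add_divide_distrib by linarith
        finally show ?case by (simp add: m_def)
      qed
    qed
  qed
qed

text \<open>A greedy covering: from a bad index, jump past the block on which the average is large.\<close>
lemma card_large_average_le:
  fixes a :: "nat \<Rightarrow> real"
  assumes nonneg: "\<And>i. 0 \<le> a i" and c: "0 \<le> c"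
  shows "c * real (card {i. j \<le> i \<and> i < K \<and> (\<exists>n\<in>{1..N}. c * real n < (\<Sum>l<n. a (i + l)))})
    \<le> (\<Sum>i\<in>{j..<K+N}. a i)" (is "c * real (card (?B j)) \<le> _")
proof (induction "K - j" arbitrary: j rule: less_induct)
  case less
  have fin: "finite (?B j)" for j
    by (rule finite_subset[of _ "{..<K}"]) auto
  show ?case
  proof (cases "j < K")
    case False
    then have "?B j = {}" by auto
    then show ?thesis using nonneg by (simp only: card.empty) (simp add: sum_nonneg)
  next
    case jK: True
    show ?thesis
    proof (cases "j \<in> ?B j")
      \<comment> \<open>A good index is not counted and its nonnegative term is given away.\<close>
      case False
      then have "?B j = ?B (Suc j)"
        by (auto simp: Suc_le_eq order.order_iff_strict)
      then have "c * real (card (?B j)) \<le> (\<Sum>i\<in>{Suc j..<K+N}. a i)"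
        using less[of "Suc j"] jK by simp
      also have "\<dots> \<le> (\<Sum>i\<in>{j..<K+N}. a i)"
        using nonneg by (intro sum_mono2) auto
      finally show ?thesis .
    next
      case True
      then obtain n where n: "n \<in> {1..N}" "c * real n < (\<Sum>l<n. a (j + l))" by auto
      \<comment> \<open>All \<open>n\<close> indices of the block count as bad, at cost
        \<open>c * n\<close>, which the block sum pays. A block starting before \<open>K\<close>
        ends no later than \<open>K + N\<close>; hence the upper limit of the sum.\<close>
      have "card (?B j) \<le> card ({j..<j+n} \<union> ?B (j + n))"
        by (intro card_mono finite_UnI fin) auto
      also have "\<dots> \<le> n + card (?B (j + n))"
        using card_Un_le[of "{j..<j+n}" "?B (j + n)"] by simp
      finally have "c * real (card (?B j)) \<le> c * real (n + card (?B (j + n)))"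
        using c by (intro mult_left_mono) linarith+
      also have "\<dots> \<le> (\<Sum>l<n. a (j + l)) + (\<Sum>i\<in>{j+n..<K+N}. a i)"
        using less[of "j + n"] jK n by (simp only: of_nat_add distrib_left) (auto intro!: add_mono)
      also have "(\<Sum>l<n. a (j + l)) = (\<Sum>i\<in>{j..<j+n}. a i)"
        by (rule sum.reindex_bij_witness[of _ "\<lambda>i. i - j" "\<lambda>l. j + l"]) auto
      also have "(\<Sum>i\<in>{j..<j+n}. a i) + (\<Sum>i\<in>{j+n..<K+N}. a i) = (\<Sum>i\<in>{j..<K+N}. a i)"
        using jK n by (intro sum.atLeastLessThan_concat) auto
      finally show ?thesis .
    qed
  qed
qed

section \<open>The strong law under a first moment\<close>

context prob_space
begin

lemma indep_vars_reindex_inj: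
  assumes indep: "indep_vars M' X (h ` I)" and h: "inj_on h I"
  shows "indep_vars (\<lambda>i. M' (h i)) (\<lambda>i. X (h i)) I"
  unfolding indep_vars_def2 indep_sets_def
proof (intro conjI ballI allI impI)
  let ?F = "\<lambda>i. {X i -` A \<inter> space M | A. A \<in> sets (M' i)}"
  show "random_variable (M' (h i)) (X (h i))" if "i \<in> I" for i
    using indep that by (auto simp: indep_vars_def2)
  show "?F (h i) \<subseteq> events" if "i \<in> I" for i
    using indep that by (auto simp: indep_vars_def2 indep_sets_def)
  fix J A assume J: "J \<subseteq> I" "J \<noteq> {}" "finite J" and A: "A \<in> (\<Pi> i\<in>J. ?F (h i))"
  have inj: "inj_on h J" using h J(1) by (rule inj_on_subset)
  define A' where "A' k = A (inv_into J h k)" for k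
  have A': "A' (h i) = A i" if "i \<in> J" for i
    using inj that by (simp add: A'_def)
  have "prob (\<Inter>k\<in>h ` J. A' k) = (\<Prod>k\<in>h ` J. prob (A' k))"
  proof (rule indep_setsD[where F="?F" and I="h ` I"])
    show "\<forall>k\<in>h ` J. A' k \<in> ?F k"
      using A A' by (auto simp: Pi_def)
  qed (use indep J in \<open>auto simp: indep_vars_def2\<close>)
  then show "prob (\<Inter>i\<in>J. A i) = (\<Prod>i\<in>J. prob (A i))"
    using A' by (simp add: prod.reindex[OF inj])
qed

text \<open>Stationarity: the right-hand side does not mention \<open>i\<close>. Besides the
  equality of the means, this is what the maximal inequality takes from the i.i.d.
  assumption.\<close>

lemma iid_shift_distr:
  fixes Y :: "nat \<Rightarrow> 'a \<Rightarrow> real"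
  assumes indep: "indep_vars (\<lambda>_. borel) Y UNIV"
    and distr: "\<And>i. distr M borel (Y i) = distr M borel (Y 0)"
    and N: "0 < N"
  shows "distr M (\<Pi>\<^sub>M l\<in>{..<N::nat}. borel) (\<lambda>\<omega>. \<lambda>l\<in>{..<N}. Y (i + l) \<omega>)
    = (\<Pi>\<^sub>M l\<in>{..<N}. distr M borel (Y 0))"
proof -
  have rv: "random_variable borel (Y i)" for i
    using indep by (auto simp: indep_vars_def)
  have "indep_vars (\<lambda>_. borel) (\<lambda>l. Y (i + l)) {..<N}"
    by (intro indep_vars_reindex_inj[where X=Y and h="\<lambda>l. i + l"] indep_vars_subset[OF indep])
      (auto simp: inj_on_def)
  then show ?thesis
    using N by (subst (asm) indep_vars_iff_distr_eq_PiM) (auto simp: rv distr[of "i + _"])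
qed

text \<open>A maximal ergodic inequality: integrate the pathwise covering bound over many starting
  indices, all of which are bad with the same probability, and divide by their number.\<close>

lemma maximal_inequality_iid:
  fixes Y :: "nat \<Rightarrow> 'a \<Rightarrow> real"
  assumes indep: "indep_vars (\<lambda>_. borel) Y UNIV"
    and distr: "\<And>i. distr M borel (Y i) = distr M borel (Y 0)"
    and int: "integrable M (Y 0)" and nonneg: "\<And>i \<omega>. 0 \<le> Y i \<omega>" and c: "0 < c"
  shows "c * prob {\<omega>\<in>space M. \<exists>n\<ge>1. c * real n < (\<Sum>l<n. Y l \<omega>)} \<le> expectation (Y 0)"
proof -
  have rv [measurable]: "random_variable borel (Y i)" for i
    using indep by (auto simp: indep_vars_def)
  have intY: "integrable M (Y i)" for i
  proof -
    have "integrable (distr M borel (Y i)) (\<lambda>x. x)"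
      unfolding distr[of i] using int by (subst integrable_distr_eq) auto
    then show ?thesis by (subst (asm) integrable_distr_eq) auto
  qed
  have EY: "expectation (Y i) = expectation (Y 0)" for i
  proof -
    have "expectation (Y i) = integral\<^sup>L (distr M borel (Y i)) (\<lambda>x. x)"
      by (subst integral_distr) auto
    also have "\<dots> = expectation (Y 0)"
      unfolding distr[of i] by (subst integral_distr) auto
    finally show ?thesis .
  qed
  \<comment> \<open>The finite horizon \<open>N\<close> makes the event at time \<open>i\<close> a
    function of a window of \<open>N\<close> variables, so its probability does not depend on
    \<open>i\<close>.\<close>
  define B where "B N i = {\<omega>\<in>space M. \<exists>n\<in>{1..N}. c * real n < (\<Sum>l<n. Y (i + l) \<omega>)}" for N i
  have B [measurable]: "B N i \<in> events" for N i
    unfolding B_def by measurable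
  have B_shift: "prob (B N i) = prob (B N 0)" for N i
  proof (cases "N = 0")
    case True
    then show ?thesis by (simp add: B_def)
  next
    case False
    then have N: "0 < N" by simp
    let ?P = "\<Pi>\<^sub>M l\<in>{..<N}. borel :: real measure"
    let ?A = "{f\<in>space ?P. \<exists>n\<in>{1..N}. c * real n < (\<Sum>l<n. f l)}"
    have A: "?A \<in> sets ?P" by measurable
    have m: "(\<lambda>\<omega>. \<lambda>l\<in>{..<N}. Y (i + l) \<omega>) \<in> measurable M ?P" for i
      by measurable
    have "(\<Sum>l<n. (\<lambda>l\<in>{..<N}. Y (i + l) \<omega>) l) = (\<Sum>l<n. Y (i + l) \<omega>)" if "n \<in> {1..N}" for n i \<omega>
      using that by (intro sum.cong) auto
    then have "B N i = (\<lambda>\<omega>. \<lambda>l\<in>{..<N}. Y (i + l) \<omega>) -` ?A \<inter> space M" for i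
      unfolding B_def by (auto simp: space_PiM)
    then have "prob (B N i) = measure (distr M ?P (\<lambda>\<omega>. \<lambda>l\<in>{..<N}. Y (i + l) \<omega>)) ?A" for i
      using A by (simp add: measure_distr[OF m])
    then show ?thesis
      using iid_shift_distr[OF indep distr N, of i] iid_shift_distr[OF indep distr N, of 0] by simp
  qed
  \<comment> \<open>\<open>Suc K\<close> starting indices draw on \<open>Suc K + N\<close>
    variables. The overrun costs the factor 1 + N / Suc K, which tends to 1 for fixed
    \<open>N\<close>; the horizon is released only afterwards.\<close>
  have fin: "c * prob (B N 0) \<le> expectation (Y 0)" for N
  proof (rule LIMSEQ_le_const)
    have "(\<lambda>K. (1 + real N * inverse (real (Suc K))) * expectation (Y 0))
        \<longlonglongrightarrow> (1 + real N * 0) * expectation (Y 0)"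
      by (intro tendsto_intros LIMSEQ_inverse_real_of_nat)
    then show "(\<lambda>K. (1 + real N * inverse (real (Suc K))) * expectation (Y 0))
        \<longlonglongrightarrow> expectation (Y 0)" by simp
    show "\<exists>K0. \<forall>K\<ge>K0. c * prob (B N 0) \<le> (1 + real N * inverse (real (Suc K))) * expectation (Y 0)"
    proof (intro exI allI impI)
      fix K :: nat
      have "real (Suc K) * (c * prob (B N 0)) = c * (\<Sum>i<Suc K. prob (B N i))"
      proof -
        have "(\<Sum>i<Suc K. prob (B N i)) = (\<Sum>i<Suc K. prob (B N 0))"
          by (intro sum.cong refl B_shift)
        then show ?thesis by (simp only: sum_constant card_lessThan) simp
      qed
      also have "\<dots> = expectation (\<lambda>\<omega>. c * (\<Sum>i<Suc K. indicat_real (B N i) \<omega>))"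
        by (subst integral_mult_right_zero, subst Bochner_Integration.integral_sum)
          (auto simp: less_top[symmetric] simp del: sum.lessThan_Suc)
      also have "\<dots> \<le> expectation (\<lambda>\<omega>. \<Sum>i<Suc K + N. Y i \<omega>)"
      proof (rule integral_mono)
        show "integrable M (\<lambda>\<omega>. c * (\<Sum>i<Suc K. indicat_real (B N i) \<omega>))"
          by (intro integrable_mult_right Bochner_Integration.integrable_sum)
            (auto simp: less_top[symmetric])
        show "integrable M (\<lambda>\<omega>. \<Sum>i<Suc K + N. Y i \<omega>)"
          by (intro Bochner_Integration.integrable_sum intY)
        fix \<omega> assume \<omega>: "\<omega> \<in> space M"
        have "(\<Sum>i<Suc K. indicat_real (B N i) \<omega>)
            = real (card {i. 0 \<le> i \<and> i < Suc K \<and> (\<exists>n\<in>{1..N}. c * real n < (\<Sum>l<n. Y (i + l) \<omega>))})"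
          using \<omega> by (auto simp: B_def indicator_def sum.If_cases intro!: arg_cong[where f=card] simp del: sum.lessThan_Suc)
        then show "c * (\<Sum>i<Suc K. indicat_real (B N i) \<omega>) \<le> (\<Sum>i<Suc K + N. Y i \<omega>)"
          using card_large_average_le[of "\<lambda>i. Y i \<omega>" c 0 "Suc K" N] nonneg c
          by (simp add: atLeast0LessThan)
      qed
      also have "\<dots> = real (Suc K + N) * expectation (Y 0)"
      proof -
        have "(\<Sum>i<Suc K + N. expectation (Y i)) = (\<Sum>i<Suc K + N. expectation (Y 0))"
          by (intro sum.cong refl EY)
        then show ?thesis
          by (subst Bochner_Integration.integral_sum) (simp_all only: intY sum_constant card_lessThan)
      qed
      finally show "c * prob (B N 0) \<le> (1 + real N * inverse (real (Suc K))) * expectation (Y 0)"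
        by (simp add: field_simps)
    qed
  qed
  have "(\<lambda>N. prob (B N 0)) \<longlonglongrightarrow> prob (\<Union>N. B N 0)"
    by (rule finite_Lim_measure_incseq) (auto simp: incseq_def B_def)
  then have "(\<lambda>N. c * prob (B N 0)) \<longlonglongrightarrow> c * prob (\<Union>N. B N 0)"
    by (intro tendsto_intros)
  moreover have "(\<Union>N. B N 0) = {\<omega>\<in>space M. \<exists>n\<ge>1. c * real n < (\<Sum>l<n. Y l \<omega>)}"
    unfolding B_def by (auto simp del: of_nat_Suc) force
  ultimately have "(\<lambda>N. c * prob (B N 0))
      \<longlonglongrightarrow> c * prob {\<omega>\<in>space M. \<exists>n\<ge>1. c * real n < (\<Sum>l<n. Y l \<omega>)}"
    by simp
  then show ?thesis
    by (rule LIMSEQ_le_const2) (use fin in blast)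
qed

lemma indep_vars_expectation_mult:
  fixes Y :: "'i \<Rightarrow> 'a \<Rightarrow> real"
  assumes "indep_vars (\<lambda>_. borel) Y I" "i \<in> I" "j \<in> I" "i \<noteq> j"
    and "\<And>i. integrable M (Y i)"
  shows "integrable M (\<lambda>\<omega>. Y i \<omega> * Y j \<omega>)"
    and "expectation (\<lambda>\<omega>. Y i \<omega> * Y j \<omega>) = expectation (Y i) * expectation (Y j)"
proof -
  have "indep_vars (\<lambda>_. borel) Y {i, j}"
    using assms by (intro indep_vars_subset[OF assms(1)]) auto
  from indep_vars_integrable[OF _ this] indep_vars_lebesgue_integral[OF _ this] assms
  show "integrable M (\<lambda>\<omega>. Y i \<omega> * Y j \<omega>)"
    and "expectation (\<lambda>\<omega>. Y i \<omega> * Y j \<omega>) = expectation (Y i) * expectation (Y j)"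
    by auto
qed

text \<open>Centring turns independence into orthogonality, and boundedness supplies the variances.
  The truncated variables of the general case are of this kind.\<close>

theorem strong_law_iid_bounded:
  fixes Y :: "nat \<Rightarrow> 'a \<Rightarrow> real"
  assumes indep: "indep_vars (\<lambda>_. borel) Y UNIV"
    and distr: "\<And>i. distr M borel (Y i) = distr M borel (Y 0)"
    and bound: "\<And>i \<omega>. \<bar>Y i \<omega>\<bar> \<le> c"
  shows "AE \<omega> in M. (\<lambda>n. (\<Sum>i<n. Y i \<omega>) / real n) \<longlonglongrightarrow> expectation (Y 0)"
proof -
  have rv [measurable]: "random_variable borel (Y i)" for i
    using indep by (auto simp: indep_vars_def)
  have int: "integrable M (Y i)" for i
    by (rule integrable_const_bound[where B=c]) (use bound in auto)
  define Z where "Z i \<omega> = Y i \<omega> - expectation (Y 0)" for i \<omega>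
  have Z [measurable]: "random_variable borel (Z i)" for i
    unfolding Z_def by measurable
  have Z_int: "integrable M (Z i)" for i
    unfolding Z_def by (intro Bochner_Integration.integrable_diff int) auto
  have Z_0: "expectation (Z i) = 0" for i
    using integral_cong_distr(2)[OF distr rv rv, of "\<lambda>x. x" i] int
    by (simp add: Z_def[abs_def] prob_space)
  have Z_indep: "indep_vars (\<lambda>_. borel) Z UNIV"
    unfolding Z_def by (rule indep_vars_compose2[OF indep]) measurable
  define b where "b = c + \<bar>expectation (Y 0)\<bar>"
  have Z_bound: "\<bar>Z i \<omega>\<bar> \<le> b" for i \<omega>
    using bound[of i \<omega>] unfolding Z_def b_def by linarith
  have b: "0 \<le> b" using Z_bound[of 0] abs_ge_zero order_trans by blast
  have ZZ: "\<bar>Z i \<omega> * Z j \<omega>\<bar> \<le> b * b" for i j \<omega>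
    unfolding abs_mult using Z_bound b by (intro mult_mono) auto
  have ZZ_int: "integrable M (\<lambda>\<omega>. Z i \<omega> * Z j \<omega>)" for i j
    by (rule integrable_const_bound[where B="b * b"]) (use ZZ in auto)
  have "AE \<omega> in M. (\<lambda>n. (\<Sum>i<n. Z i \<omega>) / real n) \<longlonglongrightarrow> 0"
  proof (rule strong_law_uncorrelated[where C="b * b"])
    show "expectation (\<lambda>\<omega>. Z i \<omega> * Z j \<omega>) = 0" if "i \<noteq> j" for i j
      using indep_vars_expectation_mult(2)[OF Z_indep _ _ that Z_int] Z_0 by simp
    show "expectation (\<lambda>\<omega>. (Z i \<omega>)\<^sup>2) \<le> b * b" for i
      by (intro integral_le_const AE_I2) (use ZZ ZZ_int in \<open>auto simp: power2_eq_square abs_le_iff\<close>)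
  qed (rule ZZ_int)
  then show ?thesis
  proof eventually_elim
    case (elim \<omega>)
    have "(\<lambda>n. (\<Sum>i<n. Z i \<omega>) / real n + expectation (Y 0)) \<longlonglongrightarrow> 0 + expectation (Y 0)"
      by (intro tendsto_intros elim)
    moreover have "\<forall>\<^sub>F n in sequentially. (\<Sum>i<n. Z i \<omega>) / real n + expectation (Y 0)
        = (\<Sum>i<n. Y i \<omega>) / real n"
      using eventually_gt_at_top[of 0]
      by eventually_elim (simp add: Z_def sum_subtractf field_simps)
    ultimately show ?case by (simp add: tendsto_cong)
  qed
qed

text \<open>Truncation at a level \<open>L\<close> reduces the claim to bounded variables; by the maximal inequality the
  averages of the tails are uniformly small outside an event of probability tending to zero
  as \<open>L \<rightarrow> \<infinity>\<close>.\<close>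
theorem strong_law_iid:
  fixes Y :: "nat \<Rightarrow> 'a \<Rightarrow> real"
  assumes indep: "indep_vars (\<lambda>_. borel) Y UNIV"
    and distr: "\<And>i. distr M borel (Y i) = distr M borel (Y 0)"
    and int: "integrable M (Y 0)"
  shows "AE \<omega> in M. (\<lambda>n. (\<Sum>i<n. Y i \<omega>) / real n) \<longlonglongrightarrow> expectation (Y 0)"
proof -
  have rv [measurable]: "random_variable borel (Y i)" for i
    using indep by (auto simp: indep_vars_def)
  define g where "g L y = (if \<bar>y\<bar> \<le> real L then y else 0)" for L and y :: real
  define T where "T L y = (if \<bar>y\<bar> \<le> real L then 0 else \<bar>y\<bar>)" for L and y :: real
  have [measurable]: "g L \<in> borel_measurable borel" "T L \<in> borel_measurable borel" for L
    unfolding g_def[abs_def] T_def[abs_def] by measurable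
  have gT: "\<bar>y - g L y\<bar> = T L y" for y L
    by (auto simp: g_def T_def)
  have compose: "indep_vars (\<lambda>_. borel) (\<lambda>i \<omega>. h (Y i \<omega>)) UNIV"
      "distr M borel (\<lambda>\<omega>. h (Y i \<omega>)) = distr M borel (\<lambda>\<omega>. h (Y 0 \<omega>))"
    if [measurable]: "h \<in> borel_measurable borel" for h :: "real \<Rightarrow> real" and i
  proof -
    show "indep_vars (\<lambda>_. borel) (\<lambda>i \<omega>. h (Y i \<omega>)) UNIV"
      by (rule indep_vars_compose2[OF indep]) measurable
    have "distr M borel (\<lambda>\<omega>. h (Y i \<omega>)) = distr (distr M borel (Y i)) borel h" for i
      by (subst distr_distr) (auto simp: comp_def)
    then show "distr M borel (\<lambda>\<omega>. h (Y i \<omega>)) = distr M borel (\<lambda>\<omega>. h (Y 0 \<omega>))"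
      by (simp add: distr[of i])
  qed
  have T_int: "integrable M (\<lambda>\<omega>. T L (Y 0 \<omega>))" for L
    by (rule Bochner_Integration.integrable_bound[OF int]) (auto simp: T_def)
  have g_int: "integrable M (\<lambda>\<omega>. g L (Y 0 \<omega>))" for L
    by (rule Bochner_Integration.integrable_bound[OF int]) (auto simp: g_def)
  define \<tau> where "\<tau> L = expectation (\<lambda>\<omega>. T L (Y 0 \<omega>))" for L
  have \<tau>: "\<tau> \<longlonglongrightarrow> 0"
  proof -
    have "\<tau> \<longlonglongrightarrow> expectation (\<lambda>_. 0)"
      unfolding \<tau>_def
    proof (rule integral_dominated_convergence[where w="\<lambda>\<omega>. \<bar>Y 0 \<omega>\<bar>"])
      show "AE \<omega> in M. (\<lambda>L. T L (Y 0 \<omega>)) \<longlonglongrightarrow> 0"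
      proof (rule AE_I2)
        fix \<omega>
        have "\<forall>\<^sub>F L in sequentially. T L (Y 0 \<omega>) = 0"
          using eventually_ge_at_top[of "nat \<lceil>\<bar>Y 0 \<omega>\<bar>\<rceil>"]
          by eventually_elim (auto simp: T_def)
        then show "(\<lambda>L. T L (Y 0 \<omega>)) \<longlonglongrightarrow> 0"
          by (rule tendsto_eventually)
      qed
    qed (use int in \<open>auto simp: T_def\<close>)
    then show ?thesis by simp
  qed
  define B where "B \<delta> L = {\<omega>\<in>space M. \<exists>n\<ge>1. \<delta> * real n < (\<Sum>l<n. T L (Y l \<omega>))}" for \<delta> L
  have [measurable]: "B \<delta> L \<in> events" for \<delta> L
    unfolding B_def by measurable
  have B: "\<delta> * prob (B \<delta> L) \<le> \<tau> L" if "0 < \<delta>" for \<delta> L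
    unfolding B_def \<tau>_def
    by (rule maximal_inequality_iid[OF compose(1) compose(2) T_int _ that]) (auto simp: T_def)
  \<comment> \<open>The level that tames the tail averages may depend on \<omega>. An outcome for
    which no level from \<open>L0\<close> on works lies in every \<open>B \<delta> L\<close>, and
    these events have probability at most \<open>\<tau> L / \<delta>\<close>, which tends to
    zero.\<close>
  have null: "AE \<omega> in M. \<exists>L\<ge>L0. \<omega> \<notin> B \<delta> L" if "0 < \<delta>" for \<delta> L0
  proof -
    let ?N = "\<Inter>L\<in>{L0..}. B \<delta> L"
    have [measurable]: "?N \<in> events" by (rule sets.countable_INT') auto
    have "\<delta> * prob ?N \<le> 0"
    proof (rule LIMSEQ_le_const[OF \<tau>], intro exI allI impI)
      fix L assume "L0 \<le> L"
      then have "prob ?N \<le> prob (B \<delta> L)" by (intro finite_measure_mono) auto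
      with B[OF that, of L] show "\<delta> * prob ?N \<le> \<tau> L"
        using that by (meson mult_left_mono order_trans less_imp_le)
    qed
    then have "prob ?N = 0"
      using that measure_nonneg[of M ?N] by (auto simp: mult_le_0_iff intro!: antisym)
    then have "AE \<omega> in M. \<omega> \<notin> ?N"
      by (simp add: prob_eq_0)
    then show ?thesis by eventually_elim auto
  qed
  \<comment> \<open>One null set for all levels at once, because the level is chosen after
    \<omega>.\<close>
  have bdd: "AE \<omega> in M. \<forall>L. (\<lambda>n. (\<Sum>i<n. g L (Y i \<omega>)) / real n)
      \<longlonglongrightarrow> expectation (\<lambda>\<omega>. g L (Y 0 \<omega>))"
    unfolding AE_all_countable
    by (intro allI strong_law_iid_bounded compose) (auto simp: g_def)
  \<comment> \<open>Three errors of size \<open>\<delta>\<close>: replacing the variables by their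
    truncations, replacing the truncated average by its mean, and replacing the truncated mean by
    the mean.\<close>
  have main: "AE \<omega> in M. \<forall>\<^sub>F n in sequentially.
      \<bar>(\<Sum>i<n. Y i \<omega>) / real n - expectation (Y 0)\<bar> < 3 * \<delta>" if \<delta>: "0 < \<delta>" for \<delta>
  proof -
    obtain L0 where L0: "\<And>L. L \<ge> L0 \<Longrightarrow> \<tau> L < \<delta>"
      using order_tendstoD(2)[OF \<tau> \<delta>] by (auto simp: eventually_sequentially)
    from bdd null[OF \<delta>, of L0] AE_space show ?thesis
    proof eventually_elim
      case (elim \<omega>)
      then obtain L where L: "L \<ge> L0" "\<omega> \<notin> B \<delta> L" by blast
      let ?m = "expectation (\<lambda>\<omega>. g L (Y 0 \<omega>))"
      have "\<bar>expectation (Y 0) - ?m\<bar> = \<bar>expectation (\<lambda>\<omega>. Y 0 \<omega> - g L (Y 0 \<omega>))\<bar>"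
        using int g_int by simp
      also have "\<dots> \<le> \<tau> L"
        unfolding \<tau>_def gT[symmetric] by (rule integral_abs_bound)
      finally have m: "\<bar>expectation (Y 0) - ?m\<bar> < \<delta>"
        using L0[OF L(1)] by simp
      have "\<forall>\<^sub>F n in sequentially. \<bar>(\<Sum>i<n. g L (Y i \<omega>)) / real n - ?m\<bar> < \<delta>"
        using tendstoD[OF elim(1)[rule_format, of L] \<delta>] by (simp add: dist_real_def)
      with eventually_ge_at_top[of 1] show ?case
      proof eventually_elim
        case (elim n)
        have "\<bar>(\<Sum>i<n. Y i \<omega>) - (\<Sum>i<n. g L (Y i \<omega>))\<bar> \<le> (\<Sum>i<n. T L (Y i \<omega>))"
          unfolding sum_subtractf[symmetric] gT[symmetric] by (rule sum_abs)
        also have "\<dots> \<le> \<delta> * real n"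
          using L(2) \<open>\<omega> \<in> space M\<close> elim(1) by (force simp: B_def)
        finally have "\<bar>(\<Sum>i<n. Y i \<omega>) / real n - (\<Sum>i<n. g L (Y i \<omega>)) / real n\<bar> \<le> \<delta>"
          using elim(1) by (simp add: diff_divide_distrib[symmetric] field_simps)
        with elim(2) m show ?case by linarith
      qed
    qed
  qed
  have "AE \<omega> in M. \<forall>k. \<forall>\<^sub>F n in sequentially.
      \<bar>(\<Sum>i<n. Y i \<omega>) / real n - expectation (Y 0)\<bar> < 3 * inverse (real (Suc k))"
    unfolding AE_all_countable by (intro allI main) simp
  then show ?thesis
  proof eventually_elim
    case (elim \<omega>)
    show ?case
    proof (rule tendstoI)
      fix e :: real assume "0 < e"
      then obtain k where k: "inverse (real (Suc k)) < e / 3"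
        using reals_Archimedean[of "e / 3"] by auto
      from elim[rule_format, of k]
      show "\<forall>\<^sub>F n in sequentially. dist ((\<Sum>i<n. Y i \<omega>) / real n) (expectation (Y 0)) < e"
        by eventually_elim (use k in \<open>simp add: dist_real_def\<close>)
    qed
  qed
qed

text \<open>A function of \<open>X\<close> generates a smaller sigma-algebra than \<open>X\<close>
  does. This passes from independence of two whole sequences to independence of functions of
  finitely many of their members.\<close>

lemma indep_var_of_vimage_algebras:
  assumes indep: "indep_set (sets (vimage_algebra (space M) X N)) (sets (vimage_algebra (space M) Y N'))"
    and X: "X \<in> space M \<rightarrow> space N" and Y: "Y \<in> space M \<rightarrow> space N'"
    and f: "f \<in> measurable N K" and g: "g \<in> measurable N' K'"
  shows "indep_var K (\<lambda>\<omega>. f (X \<omega>)) K' (\<lambda>\<omega>. g (Y \<omega>))"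
proof -
  have fX: "(\<lambda>\<omega>. f (X \<omega>)) \<in> measurable (vimage_algebra (space M) X N) K"
    by (rule measurable_compose[OF measurable_vimage_algebra1[OF X] f])
  have gY: "(\<lambda>\<omega>. g (Y \<omega>)) \<in> measurable (vimage_algebra (space M) Y N') K'"
    by (rule measurable_compose[OF measurable_vimage_algebra1[OF Y] g])
  have sub: "sigma_sets (space M) {f -` A \<inter> space M | A. A \<in> sets K} \<subseteq> sets A'"
    if "f \<in> measurable A' K" "space A' = space M" for A' K and f :: "'a \<Rightarrow> 'z"
    using that sets.sigma_sets_subset[of "{f -` A \<inter> space M | A. A \<in> sets K}" A']
    by (auto simp: measurable_def)
  have 1: "sets (vimage_algebra (space M) X N) \<subseteq> events" "sets (vimage_algebra (space M) Y N') \<subseteq> events"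
    using indep by (auto dest: indep_setD_ev1 indep_setD_ev2)
  have "random_variable K (\<lambda>\<omega>. f (X \<omega>))"
    using fX 1 by (auto simp: measurable_def)
  moreover have "random_variable K' (\<lambda>\<omega>. g (Y \<omega>))"
    using gY 1 by (auto simp: measurable_def)
  moreover have "indep_set (sigma_sets (space M) {(\<lambda>\<omega>. f (X \<omega>)) -` A \<inter> space M | A. A \<in> sets K})
      (sigma_sets (space M) {(\<lambda>\<omega>. g (Y \<omega>)) -` A \<inter> space M | A. A \<in> sets K'})"
    using indep unfolding indep_set_def
    by (rule indep_sets_mono_sets)
      (use sub[OF fX space_vimage_algebra] sub[OF gY space_vimage_algebra] in \<open>simp split: bool.split\<close>)
  ultimately show ?thesis by (simp add: indep_var_eq)
qed

end

text \<open>A product of four square-integrable factors need not be integrable. Here it is grouped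
  into an x-part and a noise part, each a product of two such factors, and independence of the parts
  yields both integrability and the value.\<close>

lemma (in prob_space) strong_law_independent_noise:
  fixes x :: "nat \<Rightarrow> 'a \<Rightarrow> 'b :: topological_space" and \<epsilon> :: "nat \<Rightarrow> 'a \<Rightarrow> real" and h :: "'b \<Rightarrow> real"
  assumes x: "\<And>i. random_variable borel (x i)" "indep_vars (\<lambda>_. borel) x UNIV"
      "\<And>i. distr M borel (x i) = distr M borel (x 0)"
    and \<epsilon>: "\<And>i. random_variable borel (\<epsilon> i)" "\<And>i. integrable M (\<lambda>\<omega>. (\<epsilon> i \<omega>)\<^sup>2)"
      "\<And>i. expectation (\<lambda>\<omega>. (\<epsilon> i \<omega>)\<^sup>2) \<le> s"
    and indep: "indep_set
           (sets (vimage_algebra (space M) (\<lambda>\<omega> i. x i \<omega>) (\<Pi>\<^sub>M i\<in>UNIV. borel)))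
           (sets (vimage_algebra (space M) (\<lambda>\<omega> i. \<epsilon> i \<omega>) (\<Pi>\<^sub>M i\<in>UNIV. borel)))"
    and h [measurable]: "h \<in> borel_measurable borel"
    and h2: "integrable M (\<lambda>\<omega>. (h (x 0 \<omega>))\<^sup>2)" and h0: "expectation (\<lambda>\<omega>. h (x 0 \<omega>)) = 0"
  shows "AE \<omega> in M. (\<lambda>n. (\<Sum>i<n. h (x i \<omega>) * \<epsilon> i \<omega>) / real n) \<longlonglongrightarrow> 0"
proof -
  note [measurable] = x(1) \<epsilon>(1)
  have sq: "integrable M (\<lambda>\<omega>. (h (x i \<omega>))\<^sup>2)" for i
    using integral_cong_distr(1)[OF x(3) x(1) x(1), of "\<lambda>a. (h a)\<^sup>2"] h2 by simp
  have prod: "integrable M (\<lambda>\<omega>. f \<omega> * g \<omega>)"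
    if [measurable]: "random_variable borel f" "random_variable borel g"
      and int: "integrable M (\<lambda>\<omega>. (f \<omega>)\<^sup>2)" "integrable M (\<lambda>\<omega>. (g \<omega>)\<^sup>2)"
    for f g :: "'a \<Rightarrow> real"
  proof (rule Bochner_Integration.integrable_bound)
    show "integrable M (\<lambda>\<omega>. (f \<omega>)\<^sup>2 + (g \<omega>)\<^sup>2)" using int by simp
    have "\<bar>a * b\<bar> \<le> a\<^sup>2 + b\<^sup>2" for a b :: real
      using sum_squares_bound[of "\<bar>a\<bar>" "\<bar>b\<bar>"] mult_nonneg_nonneg[of "\<bar>a\<bar>" "\<bar>b\<bar>"]
      unfolding abs_mult power2_abs mult.assoc by linarith
    then show "AE \<omega> in M. norm (f \<omega> * g \<omega>) \<le> norm ((f \<omega>)\<^sup>2 + (g \<omega>)\<^sup>2)" by simp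
  qed measurable
  have hx: "integrable M (\<lambda>\<omega>. h (x i \<omega>))" for i
    using prod[of "\<lambda>\<omega>. h (x i \<omega>)" "\<lambda>_. 1"] sq by simp
  have hx0: "expectation (\<lambda>\<omega>. h (x i \<omega>)) = 0" for i
    using integral_cong_distr(2)[OF x(3) x(1) x(1) h, of i] h0 by simp
  have h_indep: "indep_vars (\<lambda>_. borel) (\<lambda>i \<omega>. h (x i \<omega>)) UNIV"
    by (rule indep_vars_compose2[OF x(2)]) measurable
  have hh: "integrable M (\<lambda>\<omega>. h (x i \<omega>) * h (x j \<omega>))"
    and ee: "integrable M (\<lambda>\<omega>. \<epsilon> i \<omega> * \<epsilon> j \<omega>)" for i j
    using sq \<epsilon>(2) by (auto intro!: prod)
  have pair: "indep_var borel (\<lambda>\<omega>. h (x i \<omega>) * h (x j \<omega>)) borel (\<lambda>\<omega>. \<epsilon> i \<omega> * \<epsilon> j \<omega>)" for i j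
    by (rule indep_var_of_vimage_algebras[OF indep, where f="\<lambda>a. h (a i) * h (a j)"
          and g="\<lambda>a. a i * a j"]) (auto simp: space_PiM)
  have eq: "h (x i \<omega>) * \<epsilon> i \<omega> * (h (x j \<omega>) * \<epsilon> j \<omega>) = (h (x i \<omega>) * h (x j \<omega>)) * (\<epsilon> i \<omega> * \<epsilon> j \<omega>)"
    for i j \<omega> by simp
  show ?thesis
  proof (rule strong_law_uncorrelated[where C="expectation (\<lambda>\<omega>. (h (x 0 \<omega>))\<^sup>2) * s"])
    show "integrable M (\<lambda>\<omega>. h (x i \<omega>) * \<epsilon> i \<omega> * (h (x j \<omega>) * \<epsilon> j \<omega>))" for i j
      unfolding eq by (rule indep_var_integrable[OF pair hh ee])
    show "expectation (\<lambda>\<omega>. h (x i \<omega>) * \<epsilon> i \<omega> * (h (x j \<omega>) * \<epsilon> j \<omega>)) = 0" if "i \<noteq> j" for i j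
      unfolding eq indep_var_lebesgue_integral[OF pair hh ee]
      using indep_vars_expectation_mult(2)[OF h_indep _ _ that hx] hx0 by simp
    show "expectation (\<lambda>\<omega>. (h (x i \<omega>) * \<epsilon> i \<omega>)\<^sup>2) \<le> expectation (\<lambda>\<omega>. (h (x 0 \<omega>))\<^sup>2) * s" for i
    proof -
      have "expectation (\<lambda>\<omega>. (h (x i \<omega>) * \<epsilon> i \<omega>)\<^sup>2)
          = expectation (\<lambda>\<omega>. h (x i \<omega>) * h (x i \<omega>)) * expectation (\<lambda>\<omega>. \<epsilon> i \<omega> * \<epsilon> i \<omega>)"
        unfolding power2_eq_square eq by (rule indep_var_lebesgue_integral[OF pair hh ee])
      also have "expectation (\<lambda>\<omega>. h (x i \<omega>) * h (x i \<omega>)) = expectation (\<lambda>\<omega>. (h (x 0 \<omega>))\<^sup>2)"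
        using integral_cong_distr(2)[OF x(3) x(1) x(1), of "\<lambda>a. (h a)\<^sup>2" i] by (simp add: power2_eq_square)
      finally show ?thesis
        using \<epsilon>(3)[of i] by (auto simp: power2_eq_square[symmetric] intro!: mult_left_mono)
    qed
  qed
qed

section \<open>Orthogonal projections and supports\<close>

lemma mem_orthogonal_comp_iff: "u \<in> orthogonal_comp W \<longleftrightarrow> (\<forall>v\<in>W. inner v u = 0)"
  by (simp add: orthogonal_comp_def real_inner_class.orthogonal_def)

text \<open>The classical argument: a minimising sequence for the distance to \<open>V\<close> is
  Cauchy, and its limit satisfies the variational equation.\<close>

lemma orthogonal_projection_exists:
  fixes V :: "'a :: {real_inner, complete_space} set"
  assumes V: "closed V" "subspace V"
  obtains p where "p \<in> V" "f - p \<in> orthogonal_comp V"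
proof -
  define s where "s = (INF v\<in>V. (norm (f - v))\<^sup>2)"
  have ne: "V \<noteq> {}" using subspace_0[OF V(2)] by auto
  have bdd: "bdd_below ((\<lambda>v. (norm (f - v))\<^sup>2) ` V)"
    by (rule bdd_belowI[where m=0]) auto
  have s_le: "s \<le> (norm (f - v))\<^sup>2" if "v \<in> V" for v
    unfolding s_def using bdd that by (rule cINF_lower)
  have "\<exists>v\<in>V. (norm (f - v))\<^sup>2 < s + inverse (real (Suc n))" for n
  proof -
    have "s < s + inverse (real (Suc n))" by simp
    then show ?thesis unfolding s_def using cINF_less_iff[OF ne bdd] by blast
  qed
  then obtain q where q: "\<And>n. q n \<in> V" "\<And>n. (norm (f - q n))\<^sup>2 < s + inverse (real (Suc n))"
    by metis
  \<comment> \<open>The parallelogram law for \<open>f - u\<close> and \<open>f - v\<close>; the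
    midpoint of \<open>u\<close> and \<open>v\<close> lies in \<open>V\<close>, so its squared
    distance to \<open>f\<close> is at least \<open>s\<close>.\<close>
  have par: "(norm (u - v))\<^sup>2 \<le> 2 * ((norm (f - u))\<^sup>2 - s) + 2 * ((norm (f - v))\<^sup>2 - s)"
    if "u \<in> V" "v \<in> V" for u v
  proof -
    have "(1/2) *\<^sub>R (u + v) \<in> V" using that V(2) by (intro subspace_scale subspace_add)
    from s_le[OF this] show ?thesis
      by (simp add: power2_norm_eq_inner algebra_simps inner_commute)
  qed
  have "Cauchy q"
  proof (rule metric_CauchyI)
    fix e :: real assume e: "0 < e"
    then obtain N where N: "inverse (real (Suc N)) < e\<^sup>2 / 4"
      using reals_Archimedean[of "e\<^sup>2 / 4"] by auto
    have small: "(norm (f - q n))\<^sup>2 - s < e\<^sup>2 / 4" if "n \<ge> N" for n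
    proof -
      have "inverse (real (Suc n)) \<le> inverse (real (Suc N))" using that by simp
      with q(2)[of n] N show ?thesis by linarith
    qed
    show "\<exists>N. \<forall>m\<ge>N. \<forall>n\<ge>N. dist (q m) (q n) < e"
    proof (intro exI allI impI)
      fix m n assume mn: "N \<le> m" "N \<le> n"
      have "a < c" if "a \<le> 2 * x + 2 * y" "x < c / 4" "y < c / 4" for a x y c :: real
        using that by linarith
      from this[OF par[OF q(1) q(1)] small[OF mn(1)] small[OF mn(2)]]
      have "(norm (q m - q n))\<^sup>2 < e\<^sup>2" .
      then show "dist (q m) (q n) < e"
        unfolding dist_norm using e by (meson less_imp_le power2_less_imp_less)
    qed
  qed
  then obtain p where p: "q \<longlonglongrightarrow> p"
    using Cauchy_convergent convergent_def by blast
  have pV: "p \<in> V"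
    using V(1) q(1) p by (rule closed_sequentially)
  have "(norm (f - p))\<^sup>2 \<le> s"
  proof (rule LIMSEQ_le)
    show "(\<lambda>n. (norm (f - q n))\<^sup>2) \<longlonglongrightarrow> (norm (f - p))\<^sup>2"
      by (intro tendsto_intros p)
    have "(\<lambda>n. s + inverse (real (Suc n))) \<longlonglongrightarrow> s + 0"
      by (intro tendsto_intros LIMSEQ_inverse_real_of_nat)
    then show "(\<lambda>n. s + inverse (real (Suc n))) \<longlonglongrightarrow> s" by simp
    show "\<exists>N. \<forall>n\<ge>N. (norm (f - q n))\<^sup>2 \<le> s + inverse (real (Suc n))"
      using q(2) less_imp_le by blast
  qed
  then have min: "(norm (f - p))\<^sup>2 \<le> (norm (f - v))\<^sup>2" if "v \<in> V" for v
    using s_le[OF that] by linarith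
  have "inner v (f - p) = 0" if v: "v \<in> V" for v
  proof (cases "v = 0")
    case False
    \<comment> \<open>The minimiser of the quadratic function t \<mapsto> norm (f - p - t v)^2;
      minimality of \<open>p\<close> forces its gain to be zero.\<close>
    define t where "t = inner v (f - p) / inner v v"
    have pos: "0 < inner v v" using False by simp
    have "p + t *\<^sub>R v \<in> V" using V(2) pV v by (intro subspace_add subspace_scale)
    from min[OF this] have "0 \<le> t * t * inner v v - 2 * t * inner v (f - p)"
      by (simp add: power2_norm_eq_inner algebra_simps inner_commute)
    also have "\<dots> = - ((inner v (f - p))\<^sup>2 / inner v v)"
      using pos by (simp add: t_def field_simps power2_eq_square)
    finally have "(inner v (f - p))\<^sup>2 / inner v v \<le> 0" by simp
    then show ?thesis using pos by (simp add: divide_le_0_iff)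
  qed simp
  then have "f - p \<in> orthogonal_comp V"
    by (simp add: mem_orthogonal_comp_iff)
  with pV show ?thesis by (rule that)
qed

text \<open>The difference of two candidates lies in \<open>V\<close> and is orthogonal to
  \<open>V\<close>. Exhibiting a candidate thus evaluates the projection; those onto
  \<open>E\<close>, \<open>F\<close> and \<open>Sperp\<close> are found in this way.\<close>

lemma orth_proj_eqI:
  assumes V: "subspace V" and p: "p \<in> V" "f - p \<in> orthogonal_comp V"
  shows "orth_proj V f = p"
  unfolding orth_proj_def
proof (rule the_equality)
  fix q assume q: "q \<in> V \<and> f - q \<in> orthogonal_comp V"
  have "p - q \<in> V" using V p q by (intro subspace_diff) auto
  moreover have "(f - q) - (f - p) \<in> orthogonal_comp V"
    using p q subspace_diff[OF subspace_orthogonal_comp] by blast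
  ultimately have "inner (p - q) (p - q) = 0"
    by (simp add: mem_orthogonal_comp_iff)
  then show "q = p" by simp
qed (use p in simp)

lemma orth_proj:
  fixes V :: "'a :: {real_inner, complete_space} set"
  assumes V: "closed V" "subspace V"
  shows "orth_proj V f \<in> V" "f - orth_proj V f \<in> orthogonal_comp V"
  using orthogonal_projection_exists[OF V, of f] orth_proj_eqI[OF V(2)] by metis+

lemma linear_orth_proj:
  fixes V :: "'a :: {real_inner, complete_space} set"
  assumes V: "closed V" "subspace V"
  shows "linear (orth_proj V)"
proof
  note perp = subspace_orthogonal_comp[of V]
  show "orth_proj V (f + g) = orth_proj V f + orth_proj V g" for f g
  proof (rule orth_proj_eqI[OF V(2)])
    show "orth_proj V f + orth_proj V g \<in> V"
      using V orth_proj(1) by (blast intro: subspace_add)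
    show "f + g - (orth_proj V f + orth_proj V g) \<in> orthogonal_comp V"
      using subspace_add[OF perp orth_proj(2)[OF V, of f] orth_proj(2)[OF V, of g]]
      by (simp add: algebra_simps)
  qed
  show "orth_proj V (r *\<^sub>R f) = r *\<^sub>R orth_proj V f" for r f
  proof (rule orth_proj_eqI[OF V(2)])
    show "r *\<^sub>R orth_proj V f \<in> V"
      using V orth_proj(1) by (blast intro: subspace_scale)
    show "r *\<^sub>R f - r *\<^sub>R orth_proj V f \<in> orthogonal_comp V"
      using subspace_scale[OF perp orth_proj(2)[OF V, of f], of r]
      by (simp add: scaleR_diff_right)
  qed
qed

lemma closed_orthogonal_comp: "closed (orthogonal_comp W)"
proof -
  have "orthogonal_comp W = (\<Inter>y\<in>W. {x. inner y x = 0})"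
    by (auto simp: mem_orthogonal_comp_iff)
  also have "closed \<dots>"
    by (intro closed_INT ballI closed_Collect_eq continuous_intros)
  finally show ?thesis .
qed

lemma subset_closed_span: "A \<subseteq> closed_span A"
  unfolding closed_span_def by (rule hull_subset)

lemma closed_span_minimal: "A \<subseteq> V \<Longrightarrow> closed V \<Longrightarrow> subspace V \<Longrightarrow> closed_span A \<subseteq> V"
  unfolding closed_span_def by (rule hull_minimal) auto

lemma closed_closed_span: "closed (closed_span A)" and subspace_closed_span: "subspace (closed_span A)"
proof -
  have "closed (closed_span A) \<and> subspace (closed_span A)"
    unfolding closed_span_def by (rule hull_in) (auto intro: subspace_Inter)
  then show "closed (closed_span A)" "subspace (closed_span A)" by auto
qed

text \<open>For the harder inclusion, the part g of f outside \<open>T\<close> satisfies <g, f> =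
  <g, g>, so orthogonality kills it. The identity shows at once that \<open>L2_on T\<close> is a
  closed subspace.\<close>

lemma L2_on_eq_orthogonal_comp:
  assumes T: "T \<in> sets borel"
  shows "L2_on T = orthogonal_comp (L2_on (- T))"
proof (intro Set.set_eqI iffI)
  fix f assume f: "f \<in> L2_on T"
  have "inner g f = 0" if g: "g \<in> L2_on (- T)" for g
  proof -
    obtain f' where f': "square_integrable f'" "f = abs_L2 f'" by (rule L2_cases)
    obtain g' where g': "square_integrable g'" "g = abs_L2 g'" by (rule L2_cases)
    have "AE t in lborel. t \<notin> T \<longrightarrow> f' t = 0" "AE t in lborel. t \<in> T \<longrightarrow> g' t = 0"
      using f g f' g' by (simp_all add: L2_on_def vanishes_outside.abs_eq L2_rel_def)
    then have "AE t in lborel. g' t * f' t = 0" by eventually_elim auto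
    then show ?thesis
      using f' g' by (simp add: inner_L2.abs_eq L2_rel_def integral_eq_zero_AE)
  qed
  then show "f \<in> orthogonal_comp (L2_on (- T))"
    by (simp add: mem_orthogonal_comp_iff)
next
  fix f assume f: "f \<in> orthogonal_comp (L2_on (- T))"
  obtain h where h: "square_integrable h" "f = abs_L2 h" by (rule L2_cases)
  let ?g = "\<lambda>t. indicator (- T) t * h t"
  have h': "h \<in> borel_measurable borel" "integrable lborel (\<lambda>t. (h t)\<^sup>2)"
    using h(1) by (auto simp: square_integrable_def)
  have "set_integrable lborel (- T) (\<lambda>t. (h t)\<^sup>2)"
    using h' T unfolding set_integrable_def by (intro integrable_mult_indicator) auto
  note g = extend_by_zero_in_L2_on[OF _ h'(1) this]
  have g1: "square_integrable ?g" and g2: "abs_L2 ?g \<in> L2_on (- T)"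
    using g T by auto
  have "inner (abs_L2 ?g) f = 0"
    using f g2 by (simp add: mem_orthogonal_comp_iff)
  moreover have "inner (abs_L2 ?g) f = inner (abs_L2 ?g) (abs_L2 ?g)"
    using g1 h by (auto simp: inner_L2.abs_eq L2_rel_def indicator_def intro!: Bochner_Integration.integral_cong)
  ultimately have "abs_L2 ?g = abs_L2 (\<lambda>_. 0)" by (simp add: zero_L2_def)
  then have "L2_rel ?g (\<lambda>_. 0)"
    using g1 square_integrable_zero by (subst Quotient3_rel[OF Quotient3_L2, symmetric]) (auto simp: L2_rel_def)
  then have "AE t in lborel. t \<notin> T \<longrightarrow> h t = 0"
    unfolding L2_rel_def by (auto simp: indicator_def elim!: AE_mp)
  then show "f \<in> L2_on T"
    using h by (simp add: L2_on_def vanishes_outside.abs_eq L2_rel_def)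
qed

text \<open>The complement of \<open>C\<close> is an open null set, hence disjoint from the support.
  It is applied with \<open>L2_on T\<close> and with the hyperplane orthogonal to a vector.\<close>

lemma rv_support_subset_closed:
  assumes "prob_space M" and [measurable]: "X \<in> borel_measurable M"
    and C: "closed C" "AE \<omega> in M. X \<omega> \<in> C"
  shows "rv_support M X \<subseteq> C"
proof
  interpret prob_space M by fact
  fix a assume a: "a \<in> rv_support M X"
  show "a \<in> C"
  proof (rule ccontr)
    assume "a \<notin> C"
    with a C(1) have "0 < measure (distr M borel X) (- C)"
      by (auto simp: rv_support_def open_Compl)
    moreover have "measure (distr M borel X) (- C) = prob (X -` (- C) \<inter> space M)"
      using C(1) by (intro measure_distr) (auto intro: borel_open)
    moreover have "AE \<omega> in M. \<omega> \<notin> X -` (- C) \<inter> space M"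
      using C(2) by eventually_elim auto
    then have "prob (X -` (- C) \<inter> space M) = 0"
      using C(1) by (subst prob_eq_0) (auto intro!: measurable_sets[of X M borel] borel_open)
    ultimately show False by simp
  qed
qed

text \<open>Each point outside the support lies in a null set of a countable basis, so the
  complement of the support is covered by countably many null sets. This is where separability of
  \<open>L2\<close> enters.\<close>

lemma AE_in_rv_support:
  fixes X :: "'w \<Rightarrow> 'a :: second_countable_topology"
  assumes "prob_space M" and [measurable]: "X \<in> borel_measurable M"
  shows "AE \<omega> in M. X \<omega> \<in> rv_support M X"
proof -
  interpret prob_space M by fact
  obtain B :: "'a set set" where B: "countable B" "topological_basis B"
    using ex_countable_basis by blast
  have [measurable]: "b \<in> sets borel" if "b \<in> B" for b
    using that B(2) by (auto intro: borel_open topological_basis_open)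
  interpret D: prob_space "distr M borel X" by (rule prob_space_distr) simp
  define N where "N = {b\<in>B. measure (distr M borel X) b = 0}"
  have "AE \<omega> in M. \<forall>b\<in>N. X \<omega> \<notin> b"
  proof (subst AE_ball_countable)
    show "countable N" using B(1) by (auto simp: N_def intro: countable_subset)
    show "\<forall>b\<in>N. AE \<omega> in M. X \<omega> \<notin> b"
    proof
      fix b assume b: "b \<in> N"
      then have "b \<in> B" by (simp add: N_def)
      then have bs: "b \<in> sets borel" by measurable
      have "AE a in distr M borel X. a \<notin> b"
        using b bs by (subst D.prob_eq_0[symmetric]) (auto simp: N_def)
      then show "AE \<omega> in M. X \<omega> \<notin> b"
        using bs by (subst (asm) AE_distr_iff) auto
    qed
  qed
  then show ?thesis
  proof eventually_elim
    case (elim \<omega>)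
    show ?case
      unfolding rv_support_def
    proof (intro CollectI allI impI)
      fix U assume U: "open U \<and> X \<omega> \<in> U"
      then obtain b where b: "b \<in> B" "X \<omega> \<in> b" "b \<subseteq> U"
        using topological_basisE[OF B(2)] by metis
      with elim have "0 < measure (distr M borel X) b"
        by (auto simp: N_def less_le)
      also have "\<dots> \<le> measure (distr M borel X) U"
        using b U by (intro D.finite_measure_mono) (auto intro: borel_open)
      finally show "0 < measure (distr M borel X) U" .
    qed
  qed
qed

section \<open>Least squares\<close>

text \<open>The coefficients belong to indices and not to vectors, so that they can serve as matrix
  coordinates.\<close>

lemma span_image_lessThanE:
  fixes \<psi> :: "nat \<Rightarrow> 'a :: real_vector"
  assumes "b \<in> span (\<psi> ` {..<d})"
  obtains c where "b = (\<Sum>k<d. c k *\<^sub>R \<psi> k)"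
proof -
  let ?V = "range (\<lambda>c. \<Sum>k<d. c k *\<^sub>R \<psi> k)"
  have "subspace ?V"
  proof (rule subspaceI)
    show "0 \<in> ?V" by (rule image_eqI[where x="\<lambda>_. 0"]) auto
    show "x + y \<in> ?V" if "x \<in> ?V" "y \<in> ?V" for x y
    proof -
      from that obtain c c' where "x = (\<Sum>k<d. c k *\<^sub>R \<psi> k)" "y = (\<Sum>k<d. c' k *\<^sub>R \<psi> k)" by blast
      then show ?thesis
        by (intro image_eqI[where x="\<lambda>k. c k + c' k"]) (auto simp: scaleR_add_left sum.distrib)
    qed
    show "r *\<^sub>R x \<in> ?V" if "x \<in> ?V" for r x
    proof -
      from that obtain c where "x = (\<Sum>k<d. c k *\<^sub>R \<psi> k)" by blast
      then show ?thesis
        by (intro image_eqI[where x="\<lambda>k. r * c k"]) (auto simp: scaleR_sum_right)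
    qed
  qed
  moreover have "\<psi> ` {..<d} \<subseteq> ?V"
  proof
    fix v assume "v \<in> \<psi> ` {..<d}"
    then obtain j where j: "j < d" "v = \<psi> j" by auto
    then have "v = (\<Sum>k<d. (if k = j then 1 else 0) *\<^sub>R \<psi> k)"
      by (simp add: if_distrib[of "\<lambda>c. c *\<^sub>R _"] cong: if_cong)
    then show "v \<in> ?V" by (rule image_eqI[where x="\<lambda>k. if k = j then 1 else 0"]) simp
  qed
  ultimately have "span (\<psi> ` {..<d}) \<subseteq> ?V" by (intro span_minimal)
  with assms that show ?thesis by blast
qed

lemma orthonormal_expansion:
  fixes \<phi> :: "nat \<Rightarrow> 'a :: real_inner"
  assumes on: "\<forall>j<d. \<forall>k<d. inner (\<phi> j) (\<phi> k) = (if j = k then 1 else 0)"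
    and b: "b \<in> span (\<phi> ` {..<d})"
  shows "b = (\<Sum>k<d. inner b (\<phi> k) *\<^sub>R \<phi> k)"
proof -
  from b obtain c where c: "b = (\<Sum>k<d. c k *\<^sub>R \<phi> k)" by (rule span_image_lessThanE)
  have "inner b (\<phi> j) = c j" if "j < d" for j
  proof -
    have "inner b (\<phi> j) = (\<Sum>k<d. if k = j then c k else 0)"
      unfolding c inner_sum_left using on that by (intro sum.cong) auto
    then show ?thesis using that by simp
  qed
  then have "(\<Sum>k<d. inner b (\<phi> k) *\<^sub>R \<phi> k) = (\<Sum>k<d. c k *\<^sub>R \<phi> k)" by simp
  with c show ?thesis by simp
qed

text \<open>A trivial kernel gives a nonzero determinant, so \<open>mat_inverse\<close> returns a
  genuine two-sided inverse and \<open>the (mat_inverse A)\<close> is meaningful.\<close>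

lemma mat_inverse_of_trivial_kernel:
  fixes A :: "'a :: field mat"
  assumes A: "A \<in> carrier_mat d d"
    and ker: "\<And>v. v \<in> carrier_vec d \<Longrightarrow> A *\<^sub>v v = 0\<^sub>v d \<Longrightarrow> v = 0\<^sub>v d"
  obtains B where "mat_inverse A = Some B" "B \<in> carrier_mat d d" "A * B = 1\<^sub>m d" "B * A = 1\<^sub>m d"
    "invertible_mat A"
proof -
  have "det A \<noteq> 0" using det_0_iff_vec_prod_zero[OF A] ker by blast
  then have "A \<in> Units (ring_mat TYPE('a) d ())" by (rule det_non_zero_imp_unit[OF A])
  then obtain B where B: "mat_inverse A = Some B"
    using mat_inverse(1)[OF A, where b="()"] by (cases "mat_inverse A") auto
  note B' = mat_inverse(2)[OF A B]
  then have "invertible_mat A"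
    using A unfolding invertible_mat_def inverts_mat_def square_mat.simps
    by (intro conjI exI[of _ B]) auto
  with B B' that show ?thesis by blast
qed

lemma mult_mat_vec_index_sum:
  assumes "A \<in> carrier_mat n d" "v \<in> carrier_vec d" "j < n"
  shows "vec_index (A *\<^sub>v v) j = (\<Sum>k<d. A $$ (j, k) * vec_index v k)"
  using assms by (auto simp: scalar_prod_def atLeast0LessThan intro!: sum.cong)

lemma gram_mat_carrier: "gram_mat \<phi> d xs n \<in> carrier_mat d d"
  by (intro carrier_matI) (simp_all add: gram_mat_def design_mat_def)

lemma gram_mat_index:
  assumes "j < d" "k < d"
  shows "gram_mat \<phi> d xs n $$ (j, k) = (\<Sum>i<n. inner (xs i) (\<phi> j) * inner (xs i) (\<phi> k))"
  using assms by (auto simp: gram_mat_def design_mat_def scalar_prod_def atLeast0LessThan intro!: sum.cong)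

text \<open>If \<open>B A = 1\<close>, then \<open>v = B (A\<^sub>n v + (A - A\<^sub>n) v)\<close>, and the second summand is absorbed
  once \<open>A\<^sub>n\<close> is close to \<open>A\<close>.\<close>
lemma eventually_uniformly_injective:
  fixes A :: "nat \<Rightarrow> nat \<Rightarrow> real"
  assumes lim: "\<And>j k. j < d \<Longrightarrow> k < d \<Longrightarrow> (\<lambda>n. An n j k) \<longlonglongrightarrow> A j k"
    and inv: "\<And>v j. j < d \<Longrightarrow> (\<Sum>k<d. B j k * (\<Sum>l<d. A k l * v l)) = v j"
  obtains C where "0 \<le> C"
    "\<forall>\<^sub>F n in sequentially. \<forall>v. (\<Sum>j<d. \<bar>v j\<bar>) \<le> C * (\<Sum>j<d. \<bar>\<Sum>k<d. An n j k * v k\<bar>)"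
proof -
  \<comment> \<open>A crude bound for the operator norm of \<open>B\<close> in the l1 norm;
    \<open>\<delta> n\<close> plays the same role for \<open>An n - A\<close>.\<close>
  define K where "K = (\<Sum>j<d. \<Sum>k<d. \<bar>B j k\<bar>)"
  have K: "0 \<le> K" unfolding K_def by (intro sum_nonneg) auto
  define \<delta> where "\<delta> n = (\<Sum>j<d. \<Sum>k<d. \<bar>An n j k - A j k\<bar>)" for n
  have "\<delta> \<longlonglongrightarrow> (\<Sum>j<d. \<Sum>k<d. \<bar>A j k - A j k\<bar>)"
    unfolding \<delta>_def by (intro tendsto_intros lim) auto
  then have "(\<lambda>n. K * \<delta> n) \<longlonglongrightarrow> K * 0"
    by (intro tendsto_intros) simp
  \<comment> \<open>The estimate to come is |v| \<le> K (|A_n v| + \<delta>_n |v|). The threshold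
    1/2 lets half of |v| be absorbed, which gives the constant \<open>2 * K\<close>.\<close>
  then have small: "\<forall>\<^sub>F n in sequentially. K * \<delta> n < 1 / 2"
    by (intro order_tendstoD) auto
  have norm_le: "(\<Sum>j<d. \<bar>v j\<bar>) \<le> K * (\<Sum>j<d. \<bar>\<Sum>l<d. A j l * v l\<bar>)" for v
  proof -
    have "(\<Sum>j<d. \<bar>v j\<bar>) \<le> (\<Sum>j<d. \<Sum>k<d. \<bar>B j k\<bar> * (\<Sum>m<d. \<bar>\<Sum>l<d. A m l * v l\<bar>))"
    proof (rule sum_mono)
      fix j assume j: "j \<in> {..<d}"
      have "\<bar>v j\<bar> = \<bar>\<Sum>k<d. B j k * (\<Sum>l<d. A k l * v l)\<bar>"
        using inv[of j v] j by simp
      also have "\<dots> \<le> (\<Sum>k<d. \<bar>B j k\<bar> * \<bar>\<Sum>l<d. A k l * v l\<bar>)"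
        unfolding abs_mult[symmetric] by (rule sum_abs)
      also have "\<dots> \<le> (\<Sum>k<d. \<bar>B j k\<bar> * (\<Sum>m<d. \<bar>\<Sum>l<d. A m l * v l\<bar>))"
      proof (intro sum_mono mult_left_mono)
        fix k assume "k \<in> {..<d}"
        then show "\<bar>\<Sum>l<d. A k l * v l\<bar> \<le> (\<Sum>m<d. \<bar>\<Sum>l<d. A m l * v l\<bar>)"
          by (intro member_le_sum[where f="\<lambda>m. \<bar>\<Sum>l<d. A m l * v l\<bar>"]) auto
      qed auto
      finally show "\<bar>v j\<bar> \<le> (\<Sum>k<d. \<bar>B j k\<bar> * (\<Sum>m<d. \<bar>\<Sum>l<d. A m l * v l\<bar>))" .
    qed
    then show ?thesis by (simp add: K_def sum_distrib_right)
  qed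
  have diff: "(\<Sum>j<d. \<bar>\<Sum>l<d. A j l * v l\<bar>)
      \<le> (\<Sum>j<d. \<bar>\<Sum>l<d. An n j l * v l\<bar>) + \<delta> n * (\<Sum>j<d. \<bar>v j\<bar>)" for n v
  proof -
    have "(\<Sum>j<d. \<bar>\<Sum>l<d. A j l * v l\<bar>)
        \<le> (\<Sum>j<d. \<bar>\<Sum>l<d. An n j l * v l\<bar> + (\<Sum>l<d. \<bar>An n j l - A j l\<bar> * (\<Sum>m<d. \<bar>v m\<bar>)))"
    proof (rule sum_mono)
      fix j
      have "(\<Sum>l<d. A j l * v l) = (\<Sum>l<d. An n j l * v l) - (\<Sum>l<d. (An n j l - A j l) * v l)"
        by (simp add: sum_subtractf[symmetric] algebra_simps)
      then have "\<bar>\<Sum>l<d. A j l * v l\<bar>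
          \<le> \<bar>\<Sum>l<d. An n j l * v l\<bar> + \<bar>\<Sum>l<d. (An n j l - A j l) * v l\<bar>"
        by linarith
      also have "\<bar>\<Sum>l<d. (An n j l - A j l) * v l\<bar> \<le> (\<Sum>l<d. \<bar>An n j l - A j l\<bar> * \<bar>v l\<bar>)"
        unfolding abs_mult[symmetric] by (rule sum_abs)
      also have "\<dots> \<le> (\<Sum>l<d. \<bar>An n j l - A j l\<bar> * (\<Sum>m<d. \<bar>v m\<bar>))"
      proof (intro sum_mono mult_left_mono)
        fix l assume "l \<in> {..<d}"
        then show "\<bar>v l\<bar> \<le> (\<Sum>m<d. \<bar>v m\<bar>)"
          by (intro member_le_sum[where f="\<lambda>m. \<bar>v m\<bar>"]) auto
      qed auto
      finally show "\<bar>\<Sum>l<d. A j l * v l\<bar>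
          \<le> \<bar>\<Sum>l<d. An n j l * v l\<bar> + (\<Sum>l<d. \<bar>An n j l - A j l\<bar> * (\<Sum>m<d. \<bar>v m\<bar>))" by simp
    qed
    then show ?thesis by (simp add: \<delta>_def sum_distrib_right sum.distrib)
  qed
  show ?thesis
  proof (rule that[of "2 * K"])
    show "0 \<le> 2 * K" using K by simp
    show "\<forall>\<^sub>F n in sequentially. \<forall>v. (\<Sum>j<d. \<bar>v j\<bar>) \<le> 2 * K * (\<Sum>j<d. \<bar>\<Sum>k<d. An n j k * v k\<bar>)"
      using small
    proof eventually_elim
      case (elim n)
      show ?case
      proof
        fix v
        let ?v = "\<Sum>j<d. \<bar>v j\<bar>" and ?r = "\<Sum>j<d. \<bar>\<Sum>k<d. An n j k * v k\<bar>"
        have "?v \<le> K * (?r + \<delta> n * ?v)"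
          using norm_le[of v] mult_left_mono[OF diff K] by (rule order_trans)
        also have "\<dots> = K * ?r + (K * \<delta> n) * ?v" by (simp add: algebra_simps)
        also have "\<dots> \<le> K * ?r + 1 / 2 * ?v"
          using elim by (intro add_left_mono mult_right_mono sum_nonneg) auto
        finally show "?v \<le> 2 * K * ?r" by linarith
      qed
    qed
  qed
qed

text \<open>The normal equations remove the cross term, so the residual sum at \<open>b\<close>
  exceeds that at \<open>b0\<close> by the sum of the squares of \<open><x_i, b - b0>\<close>; by
  \<open>inj\<close> this excess vanishes only at \<open>b0\<close>.\<close>

lemma least_squares_eqI:
  assumes D: "subspace D" and b0: "b0 \<in> D"
    and normal: "\<And>b. b \<in> D \<Longrightarrow> (\<Sum>i<n. (ys i - inner (xs i) b0) * inner (xs i) b) = 0"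
    and inj: "\<And>b. b \<in> D \<Longrightarrow> (\<And>i. i < n \<Longrightarrow> inner (xs i) b = 0) \<Longrightarrow> b = 0"
  shows "least_squares_unique D xs ys n" "least_squares D xs ys n = b0"
proof -
  let ?f = "sum_sq_resid xs ys n"
  have split: "?f b = ?f b0 + (\<Sum>i<n. (inner (xs i) (b - b0))\<^sup>2)" if "b \<in> D" for b
  proof -
    have d: "b - b0 \<in> D" using D that b0 by (rule subspace_diff)
    have "?f b = (\<Sum>i<n. (ys i - inner (xs i) b0)\<^sup>2 + (inner (xs i) (b - b0))\<^sup>2
        - 2 * ((ys i - inner (xs i) b0) * inner (xs i) (b - b0)))"
      unfolding sum_sq_resid_def
      by (intro sum.cong refl) (simp add: inner_diff_right power2_eq_square algebra_simps)
    also have "\<dots> = ?f b0 + (\<Sum>i<n. (inner (xs i) (b - b0))\<^sup>2)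
        - 2 * (\<Sum>i<n. (ys i - inner (xs i) b0) * inner (xs i) (b - b0))"
      by (simp add: sum_sq_resid_def sum.distrib sum_subtractf sum_distrib_left)
    finally show ?thesis using normal[OF d] by simp
  qed
  have arg_min: "is_arg_min ?f (\<lambda>b. b \<in> D) b \<longleftrightarrow> b = b0" for b
  proof
    assume b: "is_arg_min ?f (\<lambda>b. b \<in> D) b"
    then have "b \<in> D" "\<not> ?f b0 < ?f b" using b0 by (auto simp: is_arg_min_def)
    then have "(\<Sum>i<n. (inner (xs i) (b - b0))\<^sup>2) \<le> 0"
      using split by fastforce
    moreover have "0 \<le> (\<Sum>i<n. (inner (xs i) (b - b0))\<^sup>2)" by (intro sum_nonneg) auto
    ultimately have "(\<Sum>i<n. (inner (xs i) (b - b0))\<^sup>2) = 0" by linarith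
    then have "inner (xs i) (b - b0) = 0" if "i < n" for i
      using that by (subst (asm) sum_nonneg_eq_0_iff) auto
    then have "b - b0 = 0"
      using D \<open>b \<in> D\<close> b0 by (intro inj subspace_diff)
    then show "b = b0" by simp
  next
    have "?f b0 \<le> ?f b" if "b \<in> D" for b
      unfolding split[OF that] by (simp add: sum_nonneg)
    then show "is_arg_min ?f (\<lambda>b. b \<in> D) b" if "b = b0"
      using b0 that by (auto simp: is_arg_min_def not_less)
  qed
  then show "least_squares_unique D xs ys n" by (simp add: least_squares_unique_def)
  show "least_squares D xs ys n = b0"
    using arg_min by (simp add: least_squares_def arg_min_on_def arg_min_def)
qed

text \<open>Coordinates \<open>a\<close> of the estimator and \<open>c\<close> of the limit satisfy
  \<open>A\<^sub>n (a - c) = r\<^sub>n\<close>, where \<open>A\<^sub>n\<close> is the normalised Gram matrix and \<open>r\<^sub>n\<close>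
  the vector of empirical covariances with the residuals \<open>y\<^sub>i - \<langle>x\<^sub>i, b\<rangle>\<close> at the limit.\<close>
theorem least_squares_LIMSEQ:
  fixes \<psi> :: "nat \<Rightarrow> L2" and c :: "nat \<Rightarrow> real" and d :: nat
  defines "b \<equiv> \<Sum>k<d. c k *\<^sub>R \<psi> k"
  assumes D: "D = span (\<psi> ` {..<d})"
    and lim: "\<And>j k. j < d \<Longrightarrow> k < d \<Longrightarrow>
      (\<lambda>n. (\<Sum>i<n. inner (xs i) (\<psi> j) * inner (xs i) (\<psi> k)) / real n) \<longlonglongrightarrow> A j k"
    and inv: "\<And>v j. j < d \<Longrightarrow> (\<Sum>k<d. B j k * (\<Sum>l<d. A k l * v l)) = v j"
    and res: "\<And>j. j < d \<Longrightarrow>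
      (\<lambda>n. (\<Sum>i<n. inner (xs i) (\<psi> j) * (ys i - inner (xs i) b)) / real n) \<longlonglongrightarrow> 0"
  shows "\<forall>\<^sub>F n in sequentially. invertible_mat (gram_mat \<psi> d xs n) \<and> least_squares_unique D xs ys n"
    and "(\<lambda>n. least_squares D xs ys n) \<longlonglongrightarrow> b"
proof -
  define An where "An n j k = (\<Sum>i<n. inner (xs i) (\<psi> j) * inner (xs i) (\<psi> k)) / real n" for n j k
  define r where "r n j = (\<Sum>i<n. inner (xs i) (\<psi> j) * (ys i - inner (xs i) b)) / real n" for n j
  define P where "P = (\<Sum>k<d. norm (\<psi> k))"
  obtain C where C: "0 \<le> C" and inj: "\<forall>\<^sub>F n in sequentially.
      \<forall>v. (\<Sum>j<d. \<bar>v j\<bar>) \<le> C * (\<Sum>j<d. \<bar>\<Sum>k<d. An n j k * v k\<bar>)"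
    by (rule eventually_uniformly_injective[of d An A B]) (use lim inv in \<open>auto simp: An_def\<close>)
  \<comment> \<open>Translates between coordinates and vectors: the matrix acts on \<open>v\<close>
    by taking empirical covariances with the combination of the \<open>\<psi> k\<close> that has
    these coefficients.\<close>
  have An_apply: "(\<Sum>k<d. An n j k * v k)
      = (\<Sum>i<n. inner (xs i) (\<psi> j) * inner (xs i) (\<Sum>k<d. v k *\<^sub>R \<psi> k)) / real n" for n j v
  proof -
    have "(\<Sum>k<d. An n j k * v k)
        = (\<Sum>k<d. \<Sum>i<n. inner (xs i) (\<psi> j) * (v k * inner (xs i) (\<psi> k))) / real n"
    proof -
      have "An n j k * v k = (\<Sum>i<n. inner (xs i) (\<psi> j) * (v k * inner (xs i) (\<psi> k))) / real n" for k
        by (simp add: An_def sum_distrib_left mult_ac)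
      then show ?thesis by (simp add: sum_divide_distrib)
    qed
    also have "(\<Sum>k<d. \<Sum>i<n. inner (xs i) (\<psi> j) * (v k * inner (xs i) (\<psi> k)))
        = (\<Sum>i<n. inner (xs i) (\<psi> j) * inner (xs i) (\<Sum>k<d. v k *\<^sub>R \<psi> k))"
      by (subst sum.swap) (simp add: inner_sum_right sum_distrib_left)
    finally show ?thesis .
  qed
  have key: "\<forall>\<^sub>F n in sequentially. (invertible_mat (gram_mat \<psi> d xs n) \<and> least_squares_unique D xs ys n)
      \<and> norm (least_squares D xs ys n - b) \<le> C * (\<Sum>j<d. \<bar>r n j\<bar>) * P"
    using inj eventually_gt_at_top[of 0]
  proof eventually_elim
    case (elim n)
    \<comment> \<open>The uniform bound also makes \<open>An n\<close> injective. Invertibility of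
      the Gram matrix and uniqueness of the minimiser for this n both come from here.\<close>
    have zero: "v k = 0" if "\<And>j. j < d \<Longrightarrow> (\<Sum>k<d. An n j k * v k) = 0" "k < d" for v k
    proof -
      have "(\<Sum>j<d. \<bar>v j\<bar>) \<le> 0" using elim(1)[rule_format, of v] that(1) by simp
      moreover have "\<bar>v k\<bar> \<le> (\<Sum>j<d. \<bar>v j\<bar>)"
        using that(2) by (intro member_le_sum[where f="\<lambda>j. \<bar>v j\<bar>"]) auto
      ultimately show ?thesis by linarith
    qed
    let ?G = "gram_mat \<psi> d xs n"
    have G: "vec_index (?G *\<^sub>v v) j = real n * (\<Sum>k<d. An n j k * vec_index v k)"
      if "v \<in> carrier_vec d" "j < d" for v j
    proof -
      have "?G $$ (j, k) = real n * An n j k" if "k < d" for k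
        using that \<open>j < d\<close> elim(2) by (simp add: gram_mat_index An_def)
      then show ?thesis
        unfolding mult_mat_vec_index_sum[OF gram_mat_carrier that] sum_distrib_left
        by (intro sum.cong) auto
    qed
    have "v = 0\<^sub>v d" if v: "v \<in> carrier_vec d" "?G *\<^sub>v v = 0\<^sub>v d" for v
    proof (rule eq_vecI)
      fix k assume "k < dim_vec (0\<^sub>v d :: real Matrix.vec)"
      then show "vec_index v k = vec_index (0\<^sub>v d) k"
        using G[OF v(1)] v(2) elim(2) zero[of "vec_index v" k] by simp
    qed (use v in auto)
    then obtain Gi where Gi: "Gi \<in> carrier_mat d d" "?G * Gi = 1\<^sub>m d" and inv: "invertible_mat ?G"
      using mat_inverse_of_trivial_kernel[OF gram_mat_carrier] by metis
    \<comment> \<open>The right-hand side of the normal equations in coordinates; \<open>a\<close>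
      is their solution.\<close>
    define u where "u = Matrix.vec d (\<lambda>j. \<Sum>i<n. inner (xs i) (\<psi> j) * ys i)"
    define a where "a k = vec_index (Gi *\<^sub>v u) k" for k
    have u: "u \<in> carrier_vec d" by (simp add: u_def)
    have "?G *\<^sub>v (Gi *\<^sub>v u) = u"
      using Gi u by (subst assoc_mult_mat_vec[symmetric, OF gram_mat_carrier Gi(1) u]) simp
    then have a: "real n * (\<Sum>k<d. An n j k * a k) = (\<Sum>i<n. inner (xs i) (\<psi> j) * ys i)" if "j < d" for j
      using G[of "Gi *\<^sub>v u" j] Gi(1) u that by (simp add: a_def u_def)
    define b0 where "b0 = (\<Sum>k<d. a k *\<^sub>R \<psi> k)"
    have b0: "b0 \<in> D" unfolding b0_def D by (intro span_sum span_scale span_base) auto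
    have normal_j: "(\<Sum>i<n. (ys i - inner (xs i) b0) * inner (xs i) (\<psi> j)) = 0" if "j < d" for j
      using a[OF that] elim(2) unfolding An_apply b0_def[symmetric]
      by (simp add: algebra_simps sum_subtractf)
    have normal: "(\<Sum>i<n. (ys i - inner (xs i) b0) * inner (xs i) b) = 0" if b: "b \<in> D" for b
    proof -
      from b[unfolded D] obtain c where c: "b = (\<Sum>k<d. c k *\<^sub>R \<psi> k)" by (rule span_image_lessThanE)
      have "(\<Sum>i<n. (ys i - inner (xs i) b0) * inner (xs i) b)
          = (\<Sum>i<n. \<Sum>k<d. c k * ((ys i - inner (xs i) b0) * inner (xs i) (\<psi> k)))"
        unfolding c inner_sum_right by (simp add: sum_distrib_left mult.left_commute)
      also have "\<dots> = (\<Sum>k<d. c k * (\<Sum>i<n. (ys i - inner (xs i) b0) * inner (xs i) (\<psi> k)))"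
        by (subst sum.swap) (simp add: sum_distrib_left)
      also have "\<dots> = 0" using normal_j by simp
      finally show ?thesis .
    qed
    have inj_D: "b = 0" if b: "b \<in> D" "\<And>i. i < n \<Longrightarrow> inner (xs i) b = 0" for b
    proof -
      from b(1)[unfolded D] obtain c where c: "b = (\<Sum>k<d. c k *\<^sub>R \<psi> k)" by (rule span_image_lessThanE)
      have "(\<Sum>k<d. An n j k * c k) = 0" for j
        unfolding An_apply c[symmetric] using b(2) by simp
      then have "c k = 0" if "k < d" for k using zero that by blast
      then show ?thesis by (simp add: c)
    qed
    have sD: "subspace D" by (simp add: D)
    have ls: "least_squares_unique D xs ys n" "least_squares D xs ys n = b0"
      by (rule least_squares_eqI[OF sD b0]; use normal inj_D in blast)+
    have "(\<Sum>k<d. An n j k * (a k - c k)) = r n j" if "j < d" for j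
    proof -
      have "(\<Sum>k<d. An n j k * (a k - c k)) = (\<Sum>k<d. An n j k * a k) - (\<Sum>k<d. An n j k * c k)"
        by (simp add: right_diff_distrib sum_subtractf)
      also have "(\<Sum>k<d. An n j k * a k) = (\<Sum>i<n. inner (xs i) (\<psi> j) * ys i) / real n"
        using a[OF that] elim(2) by (simp add: field_simps)
      also have "(\<Sum>k<d. An n j k * c k) = (\<Sum>i<n. inner (xs i) (\<psi> j) * inner (xs i) b) / real n"
        unfolding An_apply b_def ..
      finally show ?thesis
        by (simp add: r_def diff_divide_distrib right_diff_distrib sum_subtractf)
    qed
    then have ac: "(\<Sum>k<d. \<bar>a k - c k\<bar>) \<le> C * (\<Sum>j<d. \<bar>r n j\<bar>)"
      using elim(1)[rule_format, of "\<lambda>k. a k - c k"] by simp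
    have "norm (b0 - b) = norm (\<Sum>k<d. (a k - c k) *\<^sub>R \<psi> k)"
      by (simp add: b0_def b_def scaleR_diff_left sum_subtractf)
    also have "\<dots> \<le> (\<Sum>k<d. \<bar>a k - c k\<bar> * norm (\<psi> k))"
      by (rule order_trans[OF norm_sum]) simp
    also have "\<dots> \<le> (\<Sum>k<d. \<bar>a k - c k\<bar> * P)"
    proof (intro sum_mono mult_left_mono)
      fix k assume "k \<in> {..<d}"
      then show "norm (\<psi> k) \<le> P"
        unfolding P_def by (intro member_le_sum[where f="\<lambda>k. norm (\<psi> k)"]) auto
    qed auto
    also have "\<dots> = (\<Sum>k<d. \<bar>a k - c k\<bar>) * P" by (simp add: sum_distrib_right)
    also have "\<dots> \<le> C * (\<Sum>j<d. \<bar>r n j\<bar>) * P"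
      using ac by (rule mult_right_mono) (simp add: P_def sum_nonneg)
    finally show ?case unfolding ls(2) by (intro conjI inv ls(1))
  qed
  then show "\<forall>\<^sub>F n in sequentially. invertible_mat (gram_mat \<psi> d xs n) \<and> least_squares_unique D xs ys n"
    by eventually_elim simp
  have "(\<lambda>n. \<bar>r n j\<bar>) \<longlonglongrightarrow> \<bar>0\<bar>" if "j < d" for j
    using tendsto_rabs[OF res[OF that]] by (simp only: r_def)
  then have "(\<lambda>n. C * (\<Sum>j<d. \<bar>r n j\<bar>) * P) \<longlonglongrightarrow> C * (\<Sum>j<d. \<bar>0\<bar>) * P"
    by (intro tendsto_mult tendsto_const tendsto_sum) simp
  then have lim0: "(\<lambda>n. C * (\<Sum>j<d. \<bar>r n j\<bar>) * P) \<longlonglongrightarrow> 0" by simp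
  have "(\<lambda>n. least_squares D xs ys n - b) \<longlonglongrightarrow> 0"
    by (rule Lim_null_comparison[OF _ lim0]) (use key in \<open>auto elim: eventually_mono\<close>)
  then show "(\<lambda>n. least_squares D xs ys n) \<longlonglongrightarrow> b"
    by (simp add: LIM_zero_iff)
qed

section \<open>Bias terms and the second moment matrix\<close>

lemma of_coords_in_span: "dim_vec v \<le> d \<Longrightarrow> of_coords \<phi> v \<in> span (\<phi> ` {..<d})"
  unfolding of_coords_def by (intro span_sum span_scale span_base) auto

text \<open>Every matrix, including the unspecified one denoted by \<open>the None\<close>, sends
  the zero vector to a vector with zero entries.\<close>

lemma bias_n_0: "bias_n \<phi> d xs 0 n = 0"
proof -
  have "transpose_mat (design_mat \<phi> d xs n) *\<^sub>v Matrix.vec n (\<lambda>i. inner (xs i) 0) = 0\<^sub>v d"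
    by (rule eq_vecI) (auto simp: design_mat_def scalar_prod_def)
  then show ?thesis
    by (auto simp: bias_n_def of_coords_def scalar_prod_def intro!: sum.neutral)
qed

lemma bias_0: "bias M X \<phi> d 0 = 0"
  by (auto simp: bias_def of_coords_def scalar_prod_def intro!: sum.neutral)

lemma integrable_inner_mult_inner:
  fixes X :: "'w \<Rightarrow> L2"
  assumes [measurable]: "X \<in> borel_measurable M" and X: "integrable M (\<lambda>\<omega>. (norm (X \<omega>))\<^sup>2)"
  shows "integrable M (\<lambda>\<omega>. inner (X \<omega>) u * inner (X \<omega>) v)"
proof (rule Bochner_Integration.integrable_bound)
  show "integrable M (\<lambda>\<omega>. (norm u * norm v) * (norm (X \<omega>))\<^sup>2)" using X by simp
  have "\<bar>inner a u * inner a v\<bar> \<le> (norm u * norm v) * (norm a)\<^sup>2" for a :: L2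
  proof -
    have "\<bar>inner a u\<bar> * \<bar>inner a v\<bar> \<le> (norm a * norm u) * (norm a * norm v)"
      by (intro mult_mono Cauchy_Schwarz_ineq2) auto
    then show ?thesis by (simp add: abs_mult power2_eq_square mult_ac)
  qed
  then show "AE \<omega> in M. norm (inner (X \<omega>) u * inner (X \<omega>) v) \<le> norm ((norm u * norm v) * (norm (X \<omega>))\<^sup>2)"
    by (auto intro!: AE_I2 order_trans[OF _ abs_ge_self])
qed measurable

lemma second_moment_definite:
  fixes X :: "'w \<Rightarrow> L2"
  assumes "prob_space M" and X: "X \<in> borel_measurable M" "integrable M (\<lambda>\<omega>. (norm (X \<omega>))\<^sup>2)"
    and w: "w \<in> closed_span (rv_support M X)" "(\<integral>\<omega>. inner (X \<omega>) w * inner (X \<omega>) w \<partial>M) = 0"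
  shows "w = 0"
proof -
  have "AE \<omega> in M. inner (X \<omega>) w * inner (X \<omega>) w = 0"
    using w(2) integrable_inner_mult_inner[OF X]
    by (subst (asm) integral_nonneg_eq_0_iff_AE) auto
  then have AE: "AE \<omega> in M. X \<omega> \<in> orthogonal_comp {w}"
    by (auto simp: mem_orthogonal_comp_iff inner_commute)
  \<comment> \<open>The hyperplane orthogonal to \<open>w\<close> is a closed subspace that contains
    \<open>X\<close> almost surely, hence the support and its closed span.\<close>
  have "closed_span (rv_support M X) \<subseteq> orthogonal_comp {w}"
    by (intro closed_span_minimal closed_orthogonal_comp subspace_orthogonal_comp
        rv_support_subset_closed assms AE)
  with w(1) show ?thesis by (auto simp: mem_orthogonal_comp_iff)
qed

text \<open>The finite Fourier sum is exhibited as a candidate, and its residual is checked against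
  the basis vectors only.\<close>

lemma orth_proj_orthonormal:
  fixes \<phi> :: "nat \<Rightarrow> 'a :: real_inner"
  assumes on: "\<forall>j<d. \<forall>k<d. inner (\<phi> j) (\<phi> k) = (if j = k then 1 else 0)"
    and E: "span (\<phi> ` {..<d}) = E"
  shows "orth_proj E f \<in> E" "f - orth_proj E f \<in> orthogonal_comp E"
proof -
  define p where "p = (\<Sum>k<d. inner f (\<phi> k) *\<^sub>R \<phi> k)"
  have p: "p \<in> E" unfolding p_def E[symmetric] by (intro span_sum span_scale span_base) auto
  have "inner (\<phi> j) p = inner f (\<phi> j)" if "j < d" for j
  proof -
    have "inner (\<phi> j) p = (\<Sum>k<d. if k = j then inner f (\<phi> k) else 0)"
      unfolding p_def inner_sum_right using on that by (intro sum.cong) auto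
    then show ?thesis using that by simp
  qed
  then have "E \<subseteq> orthogonal_comp {f - p}"
    unfolding E[symmetric]
    by (intro span_minimal subspace_orthogonal_comp)
      (auto simp: mem_orthogonal_comp_iff inner_diff_left inner_diff_right inner_commute)
  then have perp: "f - p \<in> orthogonal_comp E"
    by (auto simp: mem_orthogonal_comp_iff inner_commute)
  have "orth_proj E f = p"
    by (intro orth_proj_eqI p perp) (simp add: E[symmetric])
  then show "orth_proj E f \<in> E" "f - orth_proj E f \<in> orthogonal_comp E"
    using p perp by simp_all
qed

text \<open>If \<open>A\<close> annihilates \<open>v\<close>, then the second moment of <X, w>
  vanishes for the vector \<open>w\<close> with coordinates \<open>v\<close>. Definiteness gives w =
  0, and orthonormality returns v = 0.\<close>

lemma second_moment_matrix_inverse: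
  fixes X :: "'w \<Rightarrow> L2"
  assumes M: "prob_space M" and X: "X \<in> borel_measurable M" "integrable M (\<lambda>\<omega>. (norm (X \<omega>))\<^sup>2)"
    and on: "\<forall>j<d. \<forall>k<d. inner (\<phi> j) (\<phi> k) = (if j = k then 1 else 0)"
    and S: "\<phi> ` {..<d} \<subseteq> closed_span (rv_support M X)"
  defines "A \<equiv> Matrix.mat d d (\<lambda>(j, k). \<integral>\<omega>. inner (X \<omega>) (\<phi> j) * inner (X \<omega>) (\<phi> k) \<partial>M)"
  obtains B where "mat_inverse A = Some B" "B \<in> carrier_mat d d" "A * B = 1\<^sub>m d" "B * A = 1\<^sub>m d"
proof -
  have A: "A \<in> carrier_mat d d" by (simp add: A_def)
  have "v = 0\<^sub>v d" if v: "v \<in> carrier_vec d" "A *\<^sub>v v = 0\<^sub>v d" for v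
  proof -
    define w where "w = (\<Sum>k<d. vec_index v k *\<^sub>R \<phi> k)"
    note int = integrable_inner_mult_inner[OF X]
    have Av: "(\<integral>\<omega>. inner (X \<omega>) (\<phi> j) * inner (X \<omega>) w \<partial>M) = 0" if j: "j < d" for j
    proof -
      have "0 = vec_index (A *\<^sub>v v) j" using v(2) j by simp
      also have "\<dots> = (\<Sum>k<d. vec_index v k * (\<integral>\<omega>. inner (X \<omega>) (\<phi> j) * inner (X \<omega>) (\<phi> k) \<partial>M))"
        unfolding mult_mat_vec_index_sum[OF A v(1) j] using j
        by (intro sum.cong) (auto simp: A_def)
      also have "\<dots> = (\<integral>\<omega>. (\<Sum>k<d. vec_index v k * (inner (X \<omega>) (\<phi> j) * inner (X \<omega>) (\<phi> k))) \<partial>M)"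
        by (subst Bochner_Integration.integral_sum) (auto intro: int)
      also have "\<dots> = (\<integral>\<omega>. inner (X \<omega>) (\<phi> j) * inner (X \<omega>) w \<partial>M)"
        unfolding w_def inner_sum_right by (simp add: sum_distrib_left mult.left_commute)
      finally show ?thesis by simp
    qed
    have "(\<integral>\<omega>. inner (X \<omega>) w * inner (X \<omega>) w \<partial>M)
        = (\<integral>\<omega>. (\<Sum>k<d. vec_index v k * (inner (X \<omega>) (\<phi> k) * inner (X \<omega>) w)) \<partial>M)"
    proof (rule Bochner_Integration.integral_cong[OF refl])
      fix \<omega>
      have "inner (X \<omega>) w * c = (\<Sum>k<d. vec_index v k * (inner (X \<omega>) (\<phi> k) * c))" for c
        by (simp add: w_def inner_sum_right sum_distrib_right mult.assoc)
      then show "inner (X \<omega>) w * inner (X \<omega>) w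
          = (\<Sum>k<d. vec_index v k * (inner (X \<omega>) (\<phi> k) * inner (X \<omega>) w))" .
    qed
    also have "\<dots> = (\<Sum>k<d. vec_index v k * (\<integral>\<omega>. inner (X \<omega>) (\<phi> k) * inner (X \<omega>) w \<partial>M))"
      by (subst Bochner_Integration.integral_sum) (auto intro: int)
    also have "\<dots> = 0" using Av by simp
    finally have 0: "(\<integral>\<omega>. inner (X \<omega>) w * inner (X \<omega>) w \<partial>M) = 0" .
    have "w \<in> closed_span (rv_support M X)"
      unfolding w_def using S by (intro subspace_sum subspace_scale subspace_closed_span) auto
    then have w0: "w = 0" using second_moment_definite[OF M X _ 0] by blast
    have "vec_index v j = 0" if "j < d" for j
    proof -
      have "inner w (\<phi> j) = (\<Sum>k<d. if k = j then vec_index v k else 0)"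
        unfolding w_def inner_sum_left using on that by (intro sum.cong) auto
      then show ?thesis using that w0 by simp
    qed
    then show ?thesis using v(1) by (intro eq_vecI) auto
  qed
  then show ?thesis using mat_inverse_of_trivial_kernel[OF A] that by metis
qed

text \<open>Almost every \<omega> eventually lies in the covering set \<open>A n\<close>, so
  dominated convergence drives the probabilities of these sets to 1. Working with the cover avoids
  any measurability of \<open>b n\<close>.\<close>

lemma not_consistent_estimator_of_AE_limit:
  assumes "prob_space M" and lim: "AE \<omega> in M. (\<lambda>n. b n \<omega>) \<longlonglongrightarrow> c" and ne: "c \<noteq> c'"
  shows "\<not> consistent_estimator M b c'"
proof
  interpret prob_space M by fact
  assume cons: "consistent_estimator M b c'"
  define e where "e = dist c c' / 2"
  have "0 < e" using ne by (simp add: e_def)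
  from cons[unfolded consistent_estimator_def, rule_format, OF this]
  obtain A where A: "\<forall>n. A n \<in> events \<and> {\<omega> \<in> space M. e < dist (b n \<omega>) c'} \<subseteq> A n"
    and A0: "(\<lambda>n. prob (A n)) \<longlonglongrightarrow> 0"
    by (elim exE conjE) (rule that)
  have A_meas: "A n \<in> events" for n using A by blast
  have "(\<lambda>n. expectation (indicat_real (A n))) \<longlonglongrightarrow> expectation (\<lambda>_. 1 :: real)"
  proof (rule integral_dominated_convergence[where w="\<lambda>_. 1"])
    show "AE \<omega> in M. (\<lambda>n. indicat_real (A n) \<omega>) \<longlonglongrightarrow> 1"
      using lim AE_space
    proof eventually_elim
      case (elim \<omega>)
      have "(\<lambda>n. dist (b n \<omega>) c') \<longlonglongrightarrow> dist c c'"
        by (rule tendsto_dist[OF elim(1) tendsto_const])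
      moreover have "e < dist c c'" using ne by (simp add: e_def)
      ultimately have "\<forall>\<^sub>F n in sequentially. e < dist (b n \<omega>) c'"
        by (rule order_tendstoD(1))
      then have "\<forall>\<^sub>F n in sequentially. indicat_real (A n) \<omega> = 1"
      proof eventually_elim
        case (elim n)
        then have "\<omega> \<in> A n" using A[rule_format, of n] \<open>\<omega> \<in> space M\<close> by blast
        then show ?case by simp
      qed
      then show ?case by (rule tendsto_eventually)
    qed
  qed (use A_meas in \<open>auto simp: indicator_def intro!: borel_measurable_indicator\<close>)
  then have "(\<lambda>n. prob (A n)) \<longlonglongrightarrow> 1"
    using A_meas by (simp add: prob_space)
  from LIMSEQ_unique[OF A0 this] show False by simp
qed

theorem mainTheorem2:
  fixes M :: "'w measure" and T :: "real set"
    and X :: "'w \<Rightarrow> L2" and x :: "nat \<Rightarrow> 'w \<Rightarrow> L2"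
    and \<epsilon> y :: "nat \<Rightarrow> 'w \<Rightarrow> real" and \<sigma> :: real
    and \<beta> \<beta>E \<beta>F \<beta>S \<gamma> :: L2 and D S Sperp E F :: "L2 set" and \<pi> :: "L2 \<Rightarrow> L2"
    and \<phi> :: "nat \<Rightarrow> L2" and d :: nat
    and \<beta>hat \<gamma>n :: "nat \<Rightarrow> 'w \<Rightarrow> L2"
  assumes "prob_space M" and "compact T"
    and "X \<in> borel_measurable M" and "\<forall>\<omega>\<in>space M. X \<omega> \<in> L2_on T"
    and "integrable M (\<lambda>\<omega>. (norm (X \<omega>))\<^sup>2)" and "integral\<^sup>L M X = 0"
    and "\<forall>i. x i \<in> borel_measurable M" and "\<forall>i. \<forall>\<omega>\<in>space M. x i \<omega> \<in> L2_on T"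
    and "\<forall>i. distr M borel (x i) = distr M borel X"
    and "prob_space.indep_vars M (\<lambda>_. borel) x UNIV"
    and "\<forall>i. \<epsilon> i \<in> borel_measurable M"
    and "prob_space.indep_set M
           (sets (vimage_algebra (space M) (\<lambda>\<omega> i. x i \<omega>) (\<Pi>\<^sub>M i\<in>UNIV. borel)))
           (sets (vimage_algebra (space M) (\<lambda>\<omega> i. \<epsilon> i \<omega>) (\<Pi>\<^sub>M i\<in>UNIV. borel)))"
    and "\<forall>i. integrable M (\<epsilon> i) \<and> integral\<^sup>L M (\<epsilon> i) = 0"
    and "\<forall>i. integrable M (\<lambda>\<omega>. (\<epsilon> i \<omega>)\<^sup>2) \<and> prob_space.variance M (\<epsilon> i) = \<sigma>\<^sup>2" and "0 < \<sigma>\<^sup>2"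
    and "\<beta> \<in> L2_on T"
    and "\<forall>i. \<forall>\<omega>\<in>space M. y i \<omega> = inner (x i \<omega>) \<beta> + \<epsilon> i \<omega>"
    and "S = closed_span (rv_support M X)" and "Sperp = L2_on T \<inter> orthogonal_comp S"
    and "subspace D" and "\<exists>B. finite B \<and> span B = D" and "D \<subseteq> L2_on T"
    and "D \<inter> Sperp = {0}"
    and "\<pi> = restrict (orth_proj S) D" and "E = \<pi> ` D" and "F = S \<inter> orthogonal_comp E"
    and "\<beta>E = orth_proj E \<beta>" and "\<beta>F = orth_proj F \<beta>" and "\<beta>S = orth_proj Sperp \<beta>"
    and "\<forall>j<d. \<forall>k<d. inner (\<phi> j) (\<phi> k) = (if j = k then 1 else 0)" and "span (\<phi> ` {..<d}) = E"
    and "\<forall>n \<omega>. \<gamma>n n \<omega> = bias_n \<phi> d (\<lambda>i. x i \<omega>) \<beta>F n" and "\<gamma> = bias M X \<phi> d \<beta>F"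
    and "\<forall>n \<omega>. \<beta>hat n \<omega> = least_squares D (\<lambda>i. x i \<omega>) (\<lambda>i. y i \<omega>) n"
  shows "bij_betw \<pi> D E \<and> \<beta> = \<beta>E + \<beta>F + \<beta>S \<and>
    (AE \<omega> in M. (\<forall>\<^sub>F n in sequentially. invertible_mat (gram_mat \<phi> d (\<lambda>i. x i \<omega>) n) \<and>
         least_squares_unique D (\<lambda>i. x i \<omega>) (\<lambda>i. y i \<omega>) n) \<and>
       (\<lambda>n. \<beta>hat n \<omega>) \<longlonglongrightarrow> inv_into D \<pi> (\<beta>E + \<gamma>)) \<and>
    (\<beta> \<in> D \<longrightarrow>
       \<beta>F = 0 \<and> \<gamma> = 0 \<and>
       (\<forall>n\<ge>1. \<forall>\<omega>\<in>space M. invertible_mat (gram_mat \<phi> d (\<lambda>i. x i \<omega>) n) \<longrightarrow> \<gamma>n n \<omega> = 0) \<and>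
       inv_into D \<pi> \<beta>E = \<beta>E + \<beta>S \<and>
       (AE \<omega> in M. (\<lambda>n. norm (\<beta>hat n \<omega> - \<beta>)) \<longlonglongrightarrow> 0)) \<and>
    (\<beta> \<notin> D \<and> \<beta>F = 0 \<longrightarrow>
       \<gamma> = 0 \<and>
       (\<forall>n\<ge>1. \<forall>\<omega>\<in>space M. invertible_mat (gram_mat \<phi> d (\<lambda>i. x i \<omega>) n) \<longrightarrow> \<gamma>n n \<omega> = 0) \<and>
       (AE \<omega> in M. (\<lambda>n. norm (\<beta>hat n \<omega> - \<beta>)) \<longlonglongrightarrow> norm ((inv_into D \<pi> \<beta>E - \<beta>E) - \<beta>S)) \<and>
       (inv_into D \<pi> \<beta>E - \<beta>E) - \<beta>S \<in> Sperp \<and>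
       inv_into D \<pi> \<beta>E \<noteq> \<beta>E + \<beta>S \<and>
       \<not> consistent_estimator M \<beta>hat \<beta>) \<and>
    (\<beta> \<notin> D \<and> \<beta>F \<noteq> 0 \<longrightarrow>
       (AE \<omega> in M. (\<lambda>n. (norm (\<beta>hat n \<omega> - \<beta>))\<^sup>2) \<longlonglongrightarrow>
          (norm \<beta>F)\<^sup>2 + (norm \<gamma>)\<^sup>2 + (norm ((inv_into D \<pi> (\<beta>E + \<gamma>) - (\<beta>E + \<gamma>)) - \<beta>S))\<^sup>2) \<and>
       \<beta>F \<in> F \<and> \<gamma> \<in> E \<and>
       (inv_into D \<pi> (\<beta>E + \<gamma>) - (\<beta>E + \<gamma>)) - \<beta>S \<in> Sperp)"
proof -
  interpret prob_space M by fact
  note X = assms(3) and X2 = assms(5)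
  note [measurable] = X
  have x [measurable]: "random_variable borel (x i)" for i using assms(7) by blast
  have \<epsilon> [measurable]: "random_variable borel (\<epsilon> i)" for i using assms(11) by blast
  have x_distr: "distr M borel (x i) = distr M borel X" for i using assms(9) by blast
  note S_def = assms(18) and Sperp_def = assms(19) and D = assms(20) and DT = assms(22)
    and ident = assms(23) and \<pi>_def = assms(24) and E_def = assms(25) and F_def = assms(26)
    and on = assms(30) and E_span = assms(31)
  note int = integrable_inner_mult_inner[OF X X2]

  \<comment> \<open>The closed subspaces of the model\<close>
  have T: "T \<in> sets borel" using assms(2) by (intro borel_closed compact_imp_closed)
  have L2T: "closed (L2_on T)" "subspace (L2_on T)"
    unfolding L2_on_eq_orthogonal_comp[OF T]
    by (rule closed_orthogonal_comp, rule subspace_orthogonal_comp)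
  have supp: "rv_support M X \<subseteq> L2_on T"
    using assms(1,4) L2T by (intro rv_support_subset_closed X AE_I2) auto
  have S: "closed S" "subspace S" "S \<subseteq> L2_on T"
    unfolding S_def using closed_closed_span subspace_closed_span closed_span_minimal[OF supp L2T] by auto
  have Sperp: "subspace Sperp"
    unfolding Sperp_def by (intro subspace_inter L2T subspace_orthogonal_comp)

  \<comment> \<open>The projection onto \<open>S\<close> and its inverse on \<open>E\<close>\<close>
  define P where "P = orth_proj S"
  have P_lin: "linear P" unfolding P_def by (rule linear_orth_proj[OF S(1,2)])
  have P_in: "P f \<in> S" and P_perp: "f - P f \<in> orthogonal_comp S" for f
    unfolding P_def using orth_proj[OF S(1,2)] by auto
  have \<pi>: "\<pi> b = P b" if "b \<in> D" for b using that by (simp add: \<pi>_def P_def)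
  have E: "E = P ` D" using \<pi> E_def by auto
  have ES: "E \<subseteq> S" using E P_in by auto
  have E_sub: "subspace E" using E_span by auto
  have perp_Sperp: "f - P f \<in> Sperp" if "f \<in> L2_on T" for f
    unfolding Sperp_def using that P_perp P_in S(3) L2T(2) by (auto intro: subspace_diff)
  have inner_P: "inner s f = inner s (P f)" if "s \<in> S" for s f
    using P_perp[of f] that by (auto simp: mem_orthogonal_comp_iff inner_diff_right)
  \<comment> \<open>Identifiability in action: the difference of two points of \<open>D\<close> with
    equal projection lies in \<open>Sperp\<close>.\<close>
  have P_inj: "inj_on P D"
  proof (rule inj_onI)
    fix a b assume ab: "a \<in> D" "b \<in> D" "P a = P b"
    then have d: "a - b \<in> D" using D by (intro subspace_diff)
    have "P (a - b) = 0" using ab P_lin by (simp add: linear_diff)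
    moreover have "(a - b) - P (a - b) \<in> Sperp" using d DT by (intro perp_Sperp) blast
    ultimately have "a - b \<in> D \<inter> Sperp" using d by simp
    then show "a = b" unfolding ident by simp
  qed
  have bij: "bij_betw \<pi> D E"
  proof (rule bij_betw_imageI)
    show "inj_on \<pi> D" using P_inj \<pi> by (subst inj_on_cong[where g=P]) auto
    show "\<pi> ` D = E" by (rule E_def[symmetric])
  qed
  have inv_in: "inv_into D \<pi> e \<in> D" and P_inv: "P (inv_into D \<pi> e) = e" if "e \<in> E" for e
  proof -
    have e: "e \<in> \<pi> ` D" using that unfolding E_def .
    show "inv_into D \<pi> e \<in> D" by (rule inv_into_into[OF e])
    from \<pi>[OF this] show "P (inv_into D \<pi> e) = e" using f_inv_into_f[OF e] by simp
  qed
  have inv_eqI: "inv_into D \<pi> e = b" if "b \<in> D" "P b = e" for b e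
    using bij_betw_inv_into_left[OF bij that(1)] \<pi>[OF that(1)] that(2) by simp

  \<comment> \<open>The orthogonal decomposition of \<beta>\<close>
  have \<beta>E: "\<beta>E \<in> E" "\<beta> - \<beta>E \<in> orthogonal_comp E"
    unfolding assms(27) by (rule orth_proj_orthonormal[OF on E_span])+
  have perpE: "u \<in> orthogonal_comp E" if "u \<in> orthogonal_comp S" for u
    using that ES by (auto simp: mem_orthogonal_comp_iff)
  \<comment> \<open>The candidate for \<open>\<beta>F\<close> is what the projection onto
    \<open>S\<close> keeps after removal of the component in \<open>E\<close>. It is orthogonal to
    \<open>E\<close> as a difference of two vectors that are.\<close>
  have PF: "P \<beta> - \<beta>E \<in> F"
  proof -
    have "(\<beta> - \<beta>E) - (\<beta> - P \<beta>) \<in> orthogonal_comp E"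
      by (intro subspace_diff subspace_orthogonal_comp \<beta>E perpE P_perp)
    moreover have "P \<beta> - \<beta>E \<in> S" using S(2) P_in \<beta>E(1) ES by (intro subspace_diff) auto
    ultimately show ?thesis by (simp add: F_def)
  qed
  have F_sub: "subspace F" unfolding F_def by (intro subspace_inter S subspace_orthogonal_comp)
  have \<beta>F: "\<beta>F = P \<beta> - \<beta>E"
    unfolding assms(28)
  proof (rule orth_proj_eqI[OF F_sub PF])
    have "inner f \<beta>E = 0" "inner f (\<beta> - P \<beta>) = 0" if "f \<in> F" for f
      using that \<beta>E(1) P_perp[of \<beta>] by (auto simp: F_def mem_orthogonal_comp_iff inner_commute)
    then have "inner f (\<beta>E + (\<beta> - P \<beta>)) = 0" if "f \<in> F" for f
      using that by (simp add: inner_add_right)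
    then show "\<beta> - (P \<beta> - \<beta>E) \<in> orthogonal_comp F"
      by (simp add: mem_orthogonal_comp_iff algebra_simps)
  qed
  have \<beta>S: "\<beta>S = \<beta> - P \<beta>"
    unfolding assms(29)
  proof (rule orth_proj_eqI[OF Sperp perp_Sperp])
    show "\<beta> \<in> L2_on T" by fact
    have "inner v (P \<beta>) = 0" if "v \<in> Sperp" for v
      using that P_in[of \<beta>] by (auto simp: Sperp_def mem_orthogonal_comp_iff inner_commute)
    then show "\<beta> - (\<beta> - P \<beta>) \<in> orthogonal_comp Sperp"
      by (simp add: mem_orthogonal_comp_iff)
  qed
  have decomp: "\<beta> = \<beta>E + \<beta>F + \<beta>S" by (simp add: \<beta>F \<beta>S)
  have \<beta>F_in: "\<beta>F \<in> F" using PF \<beta>F by simp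
  have \<beta>S_in: "\<beta>S \<in> Sperp" using perp_Sperp assms(16) \<beta>S by simp

  \<comment> \<open>The basis of \<open>D\<close> over the orthonormal basis of
    \<open>E\<close>\<close>
  define \<psi> where "\<psi> j = inv_into D \<pi> (\<phi> j)" for j
  have \<phi>E: "\<phi> j \<in> E" if "j < d" for j
    unfolding E_span[symmetric] using that by (intro span_base) auto
  have \<psi>D: "\<psi> j \<in> D" and P\<psi>: "P (\<psi> j) = \<phi> j" if "j < d" for j
    unfolding \<psi>_def using inv_in P_inv \<phi>E[OF that] by auto
  have P_comb: "P (\<Sum>k<d. c k *\<^sub>R \<psi> k) = (\<Sum>k<d. c k *\<^sub>R \<phi> k)" for c
    using P\<psi> P_lin by (simp add: linear_sum linear_scale)
  have comb_D: "(\<Sum>k<d. c k *\<^sub>R \<psi> k) \<in> D" for c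
    using D \<psi>D by (intro subspace_sum subspace_scale) auto
  have D_span: "D = span (\<psi> ` {..<d})"
  proof
    show "span (\<psi> ` {..<d}) \<subseteq> D" using \<psi>D D by (intro span_minimal) auto
    show "D \<subseteq> span (\<psi> ` {..<d})"
    proof
      fix b assume b: "b \<in> D"
      then have "P b \<in> span (\<phi> ` {..<d})" using E E_span by auto
      then obtain c where "P b = (\<Sum>k<d. c k *\<^sub>R \<phi> k)" by (rule span_image_lessThanE)
      then have "b = (\<Sum>k<d. c k *\<^sub>R \<psi> k)"
        using inj_onD[OF P_inj _ b comb_D] P_comb by simp
      also have "\<dots> \<in> span (\<psi> ` {..<d})"
        by (intro span_sum span_scale span_base imageI)
      finally show "b \<in> span (\<psi> ` {..<d})" .
    qed
  qed

  \<comment> \<open>The second moment matrix and the bias \<gamma>\<close>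
  define A where "A j k = expectation (\<lambda>\<omega>. inner (X \<omega>) (\<phi> j) * inner (X \<omega>) (\<phi> k))" for j k
  define G where "G = Matrix.mat d d (\<lambda>(j, k). A j k)"
  have G: "G \<in> carrier_mat d d" by (simp add: G_def)
  obtain B where B: "mat_inverse G = Some B" "B \<in> carrier_mat d d" "G * B = 1\<^sub>m d" "B * G = 1\<^sub>m d"
  proof (rule second_moment_matrix_inverse[OF assms(1) X X2 on])
    show "\<phi> ` {..<d} \<subseteq> closed_span (rv_support M X)" using \<phi>E ES S_def by auto
  qed (auto simp: G_def A_def intro: that)
  have G_apply: "vec_index (G *\<^sub>v v) j = (\<Sum>k<d. A j k * vec_index v k)"
    if "v \<in> carrier_vec d" "j < d" for v j
    unfolding mult_mat_vec_index_sum[OF G that] using that by (intro sum.cong) (auto simp: G_def)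
  have B_inv: "(\<Sum>k<d. B $$ (j, k) * (\<Sum>l<d. A k l * v l)) = v j" if j: "j < d" for v j
  proof -
    let ?v = "Matrix.vec d v"
    have v: "?v \<in> carrier_vec d" by simp
    have "B *\<^sub>v (G *\<^sub>v ?v) = ?v"
      by (subst assoc_mult_mat_vec[symmetric, OF B(2) G v]) (simp add: B(4))
    then have "v j = vec_index (B *\<^sub>v (G *\<^sub>v ?v)) j" using j by simp
    also have "\<dots> = (\<Sum>k<d. B $$ (j, k) * vec_index (G *\<^sub>v ?v) k)"
      using mult_mat_vec_index_sum[OF B(2) _ j] G v by (meson mult_mat_vec_carrier)
    also have "\<dots> = (\<Sum>k<d. B $$ (j, k) * (\<Sum>l<d. A k l * v l))"
      using G_apply[OF v] by simp
    finally show ?thesis by simp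
  qed
  define u where "u = Matrix.vec d (\<lambda>j. expectation (\<lambda>\<omega>. inner (X \<omega>) (\<phi> j) * inner (X \<omega>) \<beta>F))"
  have u: "u \<in> carrier_vec d" by (simp add: u_def)
  have Bu: "B *\<^sub>v u \<in> carrier_vec d" using B(2) u by simp
  have \<gamma>_coords: "\<gamma> = of_coords \<phi> (B *\<^sub>v u)"
    using B(1) unfolding assms(33) bias_def G_def A_def u_def by simp
  have \<gamma>E: "\<gamma> \<in> E"
    unfolding \<gamma>_coords E_span[symmetric] using B(2) by (intro of_coords_in_span) auto
  \<comment> \<open>The population normal equations: \<open>G * (B * u) = u\<close>, read row by
    row, says that <X, \<beta>F - \<gamma>> is uncorrelated with each <X, \<phi> j>.\<close>
  have \<gamma>: "expectation (\<lambda>\<omega>. inner (X \<omega>) (\<phi> j) * inner (X \<omega>) (\<beta>F - \<gamma>)) = 0" if j: "j < d" for j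
  proof -
    have "\<gamma> = (\<Sum>k<d. vec_index (B *\<^sub>v u) k *\<^sub>R \<phi> k)"
      using B(2) by (simp add: \<gamma>_coords of_coords_def)
    then have "expectation (\<lambda>\<omega>. inner (X \<omega>) (\<phi> j) * inner (X \<omega>) \<gamma>)
        = expectation (\<lambda>\<omega>. \<Sum>k<d. vec_index (B *\<^sub>v u) k * (inner (X \<omega>) (\<phi> j) * inner (X \<omega>) (\<phi> k)))"
      by (simp add: inner_sum_right sum_distrib_left mult.left_commute)
    also have "\<dots> = (\<Sum>k<d. A j k * vec_index (B *\<^sub>v u) k)"
      by (subst Bochner_Integration.integral_sum) (auto simp: A_def mult.commute intro: int)
    also have "\<dots> = vec_index (G *\<^sub>v (B *\<^sub>v u)) j" using G_apply[OF Bu j] by simp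
    also have "G *\<^sub>v (B *\<^sub>v u) = u"
      by (subst assoc_mult_mat_vec[symmetric, OF G B(2) u]) (simp add: B(3) u)
    finally show ?thesis
      using j int by (simp add: inner_diff_right right_diff_distrib u_def)
  qed

  \<comment> \<open>The limit and the almost sure statements\<close>
  define a where "a = \<beta>E + \<gamma>"
  have aE: "a \<in> E" unfolding a_def using E_sub \<beta>E(1) \<gamma>E by (rule subspace_add)
  \<comment> \<open>The coordinates of \<open>a\<close> in the basis \<open>\<phi>\<close> are used
    with \<open>\<psi>\<close>; this is the preimage of \<open>a\<close> in the form that the limit
    theorem expects.\<close>
  define b where "b = (\<Sum>k<d. inner a (\<phi> k) *\<^sub>R \<psi> k)"
  have Pb: "P b = a"
    unfolding b_def P_comb using orthonormal_expansion[OF on, of a] aE E_span by simp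
  have b: "inv_into D \<pi> a = b" unfolding b_def using Pb comb_D by (intro inv_eqI) (auto simp: b_def)

  have x_S: "AE \<omega> in M. \<forall>i. x i \<omega> \<in> S"
    unfolding AE_all_countable
  proof
    fix i
    have "rv_support M (x i) = rv_support M X" by (simp add: rv_support_def x_distr)
    moreover have "AE \<omega> in M. x i \<omega> \<in> rv_support M (x i)"
      using assms(1) x by (rule AE_in_rv_support)
    ultimately show "AE \<omega> in M. x i \<omega> \<in> S"
      using subset_closed_span[of "rv_support M X"] S_def by auto
  qed
  have slln: "AE \<omega> in M. (\<lambda>n. (\<Sum>i<n. inner (x i \<omega>) v * inner (x i \<omega>) w) / real n)
      \<longlonglongrightarrow> expectation (\<lambda>\<omega>. inner (X \<omega>) v * inner (X \<omega>) w)" for v w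
  proof -
    let ?h = "\<lambda>f. inner f v * inner f w"
    have [measurable]: "?h \<in> borel_measurable borel" by measurable
    have "AE \<omega> in M. (\<lambda>n. (\<Sum>i<n. ?h (x i \<omega>)) / real n) \<longlonglongrightarrow> expectation (\<lambda>\<omega>. ?h (x 0 \<omega>))"
    proof (rule strong_law_iid)
      show "indep_vars (\<lambda>_. borel) (\<lambda>i \<omega>. ?h (x i \<omega>)) UNIV"
        by (rule indep_vars_compose2[OF assms(10)]) measurable
      have "distr M borel (\<lambda>\<omega>. ?h (x i \<omega>)) = distr (distr M borel (x i)) borel ?h" for i
        by (subst distr_distr) (auto simp: comp_def)
      then show "distr M borel (\<lambda>\<omega>. ?h (x i \<omega>)) = distr M borel (\<lambda>\<omega>. ?h (x 0 \<omega>))" for i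
        by (simp add: x_distr)
      show "integrable M (\<lambda>\<omega>. ?h (x 0 \<omega>))"
        using integral_cong_distr(1)[OF x_distr x X, of ?h 0] int by simp
    qed
    then show ?thesis
      using integral_cong_distr(2)[OF x_distr x X, of ?h 0] by simp
  qed
  have noise: "AE \<omega> in M. (\<lambda>n. (\<Sum>i<n. inner (x i \<omega>) v * \<epsilon> i \<omega>) / real n) \<longlonglongrightarrow> 0" for v
  proof (rule strong_law_independent_noise[where h="\<lambda>f. inner f v" and s="\<sigma>\<^sup>2"])
    show "indep_vars (\<lambda>_. borel) x UNIV" by fact
    show "integrable M (\<lambda>\<omega>. (\<epsilon> i \<omega>)\<^sup>2)" for i using assms(14) by blast
    \<comment> \<open>The noise is centred, so its second moment is its variance.\<close>
    show "expectation (\<lambda>\<omega>. (\<epsilon> i \<omega>)\<^sup>2) \<le> \<sigma>\<^sup>2" for i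
      using assms(13,14) by (metis (no_types, lifting) diff_zero Bochner_Integration.integral_cong order_refl)
    show "integrable M (\<lambda>\<omega>. (inner (x 0 \<omega>) v)\<^sup>2)"
      using integral_cong_distr(1)[OF x_distr x X, of "\<lambda>f. (inner f v)\<^sup>2" 0] int[of v v]
      by (simp add: power2_eq_square)
    have "integrable M X"
    proof -
      have "integrable M (\<lambda>\<omega>. norm (X \<omega>))"
        by (rule square_integrable_imp_integrable) (use X2 in auto)
      then show ?thesis by (simp add: integrable_norm_iff)
    qed
    then have "expectation (\<lambda>\<omega>. inner (X \<omega>) v) = 0"
      using assms(6) by (subst integral_inner_left) auto
    then show "expectation (\<lambda>\<omega>. inner (x 0 \<omega>) v) = 0"
      using integral_cong_distr(2)[OF x_distr x X, of "\<lambda>f. inner f v" 0] by simp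
  qed (use assms(12) x_distr in auto)

  have main: "AE \<omega> in M. (\<forall>\<^sub>F n in sequentially. invertible_mat (gram_mat \<phi> d (\<lambda>i. x i \<omega>) n) \<and>
         least_squares_unique D (\<lambda>i. x i \<omega>) (\<lambda>i. y i \<omega>) n) \<and> (\<lambda>n. \<beta>hat n \<omega>) \<longlonglongrightarrow> b"
  proof -
    \<comment> \<open>All natural j and k are taken, because a countable universal quantifier can be
      moved inside \<open>AE\<close>.\<close>
    have "AE \<omega> in M. \<forall>j k. (\<lambda>n. (\<Sum>i<n. inner (x i \<omega>) (\<phi> j) * inner (x i \<omega>) (\<phi> k)) / real n)
        \<longlonglongrightarrow> A j k"
      unfolding AE_all_countable A_def by (intro allI slln)
    moreover have "AE \<omega> in M. \<forall>j. (\<lambda>n. (\<Sum>i<n. inner (x i \<omega>) (\<phi> j) * inner (x i \<omega>) (\<beta>F - \<gamma>)) / real n)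
        \<longlonglongrightarrow> expectation (\<lambda>\<omega>. inner (X \<omega>) (\<phi> j) * inner (X \<omega>) (\<beta>F - \<gamma>))"
      unfolding AE_all_countable by (intro allI slln)
    moreover have "AE \<omega> in M. \<forall>j. (\<lambda>n. (\<Sum>i<n. inner (x i \<omega>) (\<phi> j) * \<epsilon> i \<omega>) / real n) \<longlonglongrightarrow> 0"
      unfolding AE_all_countable by (intro allI noise)
    ultimately show ?thesis
      using x_S AE_space
    proof eventually_elim
      case (elim \<omega>)
      let ?x = "\<lambda>i. x i \<omega>" and ?y = "\<lambda>i. y i \<omega>"
      have x\<psi>: "inner (x i \<omega>) (\<psi> j) = inner (x i \<omega>) (\<phi> j)" if "j < d" for i j
        using inner_P[of "x i \<omega>" "\<psi> j"] elim(4) P\<psi>[OF that] by simp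
      have res: "y i \<omega> - inner (x i \<omega>) b = inner (x i \<omega>) (\<beta>F - \<gamma>) + \<epsilon> i \<omega>" for i
      proof -
        have "inner (x i \<omega>) \<beta> = inner (x i \<omega>) (\<beta>E + \<beta>F)"
          using inner_P[of "x i \<omega>" \<beta>] elim(4) by (simp add: \<beta>F)
        moreover have "inner (x i \<omega>) b = inner (x i \<omega>) (\<beta>E + \<gamma>)"
          using inner_P[of "x i \<omega>" b] elim(4) by (simp add: Pb a_def)
        moreover have "y i \<omega> = inner (x i \<omega>) \<beta> + \<epsilon> i \<omega>"
          using assms(17) elim(5) by blast
        ultimately show ?thesis by (simp add: inner_add_right inner_diff_right)
      qed
      have "gram_mat \<psi> d ?x n = gram_mat \<phi> d ?x n" for n
      proof -
        have "design_mat \<psi> d ?x n = design_mat \<phi> d ?x n"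
          unfolding design_mat_def by (rule cong_mat) (auto simp: x\<psi>)
        then show ?thesis by (simp add: gram_mat_def)
      qed
      moreover have "(\<lambda>n. (\<Sum>i<n. inner (?x i) (\<psi> j) * inner (?x i) (\<psi> k)) / real n) \<longlonglongrightarrow> A j k"
        if "j < d" "k < d" for j k
        using elim(1) by (simp add: x\<psi> that)
      moreover have "(\<lambda>n. (\<Sum>i<n. inner (?x i) (\<psi> j) * (?y i - inner (?x i) b)) / real n) \<longlonglongrightarrow> 0"
        if "j < d" for j
      proof -
        have "(\<lambda>n. (\<Sum>i<n. inner (?x i) (\<phi> j) * inner (?x i) (\<beta>F - \<gamma>)) / real n
            + (\<Sum>i<n. inner (?x i) (\<phi> j) * \<epsilon> i \<omega>) / real n) \<longlonglongrightarrow> 0 + 0"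
          using elim(2)[rule_format, of j] elim(3)[rule_format, of j]
          unfolding \<gamma>[OF that] by (rule tendsto_add)
        then show ?thesis
          by (simp add: x\<psi>[OF that] res distrib_left sum.distrib add_divide_distrib)
      qed
      ultimately show ?case
        using least_squares_LIMSEQ[OF D_span, of ?x A "\<lambda>j k. B $$ (j, k)" ?y "\<lambda>k. inner a (\<phi> k)"] B_inv
        unfolding b_def[symmetric] assms(34)[rule_format] by simp
    qed
  qed
  have lim: "AE \<omega> in M. (\<lambda>n. \<beta>hat n \<omega>) \<longlonglongrightarrow> b" using main by eventually_elim simp
  have norm_lim: "AE \<omega> in M. (\<lambda>n. norm (\<beta>hat n \<omega> - \<beta>)) \<longlonglongrightarrow> norm (b - \<beta>)"
    using lim by eventually_elim (intro tendsto_intros)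

  \<comment> \<open>The three cases for \<beta>\<close>
  have zero: "\<gamma> = 0" "\<gamma>n n \<omega> = 0" if "\<beta>F = 0" for n \<omega>
    using that by (simp_all add: assms(32)[rule_format] assms(33) bias_0 bias_n_0)
  have bD: "b \<in> D" unfolding b_def by (rule comb_D)
  have rest: "(b - a) - \<beta>S \<in> Sperp"
  proof -
    have "b - a \<in> Sperp" using perp_Sperp[of b] bD DT Pb by auto
    from subspace_diff[OF Sperp this \<beta>S_in] show ?thesis .
  qed

  have caseA: "\<beta>F = 0 \<and> \<gamma> = 0 \<and> inv_into D \<pi> \<beta>E = \<beta>E + \<beta>S \<and> b = \<beta>" if "\<beta> \<in> D"
  proof -
    have "P \<beta> \<in> E" using that E by auto
    \<comment> \<open>The projection of \<beta> onto \<open>S\<close> already lies in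
      \<open>E\<close>, hence is also its projection onto \<open>E\<close>, and nothing is left for
      \<open>F\<close>.\<close>
    moreover have "orth_proj E \<beta> = P \<beta>"
      using \<open>P \<beta> \<in> E\<close> by (intro orth_proj_eqI E_sub perpE P_perp)
    ultimately have "\<beta>E = P \<beta>" using assms(27) by simp
    moreover from this have "\<beta>F = 0" by (simp add: \<beta>F)
    moreover from this have "\<gamma> = 0" by (rule zero)
    moreover have "inv_into D \<pi> \<beta>E = \<beta>"
      using that \<open>\<beta>E = P \<beta>\<close> by (intro inv_eqI) auto
    ultimately show ?thesis using decomp b by (simp add: a_def)
  qed
  have pyth: "(norm (b - \<beta>))\<^sup>2 = (norm \<beta>F)\<^sup>2 + (norm \<gamma>)\<^sup>2 + (norm ((b - a) - \<beta>S))\<^sup>2"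
  proof -
    let ?r = "(b - a) - \<beta>S"
    \<comment> \<open>Three mutually orthogonal pieces: \<gamma> in \<open>E\<close>, \<beta>F in
      \<open>F\<close>, both inside \<open>S\<close>, and the remainder in
      \<open>Sperp\<close>.\<close>
    have eq: "b - \<beta> = (\<gamma> - \<beta>F) + ?r" by (subst decomp) (simp add: a_def)
    have "inner \<gamma> \<beta>F = 0" using \<gamma>E \<beta>F_in by (auto simp: F_def mem_orthogonal_comp_iff)
    moreover have "?r \<in> orthogonal_comp S" using rest unfolding Sperp_def by (rule IntD2)
    then have r: "\<forall>v\<in>S. inner v ?r = 0" unfolding mem_orthogonal_comp_iff .
    have "\<gamma> \<in> S" "\<beta>F \<in> S" using \<gamma>E ES \<beta>F_in F_def by auto
    then have "inner \<gamma> ?r = 0" "inner \<beta>F ?r = 0" using r by auto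
    moreover have "(norm ((p - q) + r))\<^sup>2 = (norm q)\<^sup>2 + (norm p)\<^sup>2 + (norm r)\<^sup>2"
      if "inner p q = 0" "inner p r = 0" "inner q r = 0" for p q r :: L2
    proof -
      from that have "inner q p = 0" "inner r p = 0" "inner r q = 0"
        by (simp_all add: inner_commute)
      with that show ?thesis
        by (simp add: power2_norm_eq_inner inner_add_left inner_add_right inner_diff_left inner_diff_right)
    qed
    ultimately show ?thesis unfolding eq by blast
  qed
  have b0: "inv_into D \<pi> \<beta>E = b" "a = \<beta>E" if "\<beta>F = 0"
    using b zero(1)[OF that] by (simp_all add: a_def)
  show ?thesis
  proof (intro conjI impI allI ballI)
    show "bij_betw \<pi> D E" by (rule bij)
    show "\<beta> = \<beta>E + \<beta>F + \<beta>S" by (rule decomp)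
    show "AE \<omega> in M. (\<forall>\<^sub>F n in sequentially. invertible_mat (gram_mat \<phi> d (\<lambda>i. x i \<omega>) n) \<and>
         least_squares_unique D (\<lambda>i. x i \<omega>) (\<lambda>i. y i \<omega>) n) \<and>
       (\<lambda>n. \<beta>hat n \<omega>) \<longlonglongrightarrow> inv_into D \<pi> (\<beta>E + \<gamma>)"
      using main b by (simp add: a_def)
  next
    assume "\<beta> \<in> D"
    note c = caseA[OF this]
    show "\<beta>F = 0" "\<gamma> = 0" "inv_into D \<pi> \<beta>E = \<beta>E + \<beta>S" using c by auto
    show "\<gamma>n n \<omega> = 0" for n \<omega> using c by (intro zero) simp
    show "AE \<omega> in M. (\<lambda>n. norm (\<beta>hat n \<omega> - \<beta>)) \<longlonglongrightarrow> 0" using norm_lim c by simp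
  next
    assume c: "\<beta> \<notin> D \<and> \<beta>F = 0"
    then have F0: "\<beta>F = 0" by simp
    show "\<gamma> = 0" "\<gamma>n n \<omega> = 0" for n \<omega> using F0 by (auto intro: zero)
    have "(b - \<beta>E) - \<beta>S = b - \<beta>"
      by (subst decomp) (simp add: F0)
    then show "AE \<omega> in M. (\<lambda>n. norm (\<beta>hat n \<omega> - \<beta>)) \<longlonglongrightarrow> norm ((inv_into D \<pi> \<beta>E - \<beta>E) - \<beta>S)"
      unfolding b0(1)[OF F0] using norm_lim by (simp only:)
    show "(inv_into D \<pi> \<beta>E - \<beta>E) - \<beta>S \<in> Sperp" using rest b0[OF F0] by simp
    \<comment> \<open>The limit stays in \<open>D\<close>, which \<beta> does not belong to.\<close>
    have "b \<noteq> \<beta>" using bD c by auto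
    then show "inv_into D \<pi> \<beta>E \<noteq> \<beta>E + \<beta>S" using b0[OF F0] decomp F0 by simp
    show "\<not> consistent_estimator M \<beta>hat \<beta>"
      by (rule not_consistent_estimator_of_AE_limit[OF assms(1) lim \<open>b \<noteq> \<beta>\<close>])
  next
    have "AE \<omega> in M. (\<lambda>n. (norm (\<beta>hat n \<omega> - \<beta>))\<^sup>2) \<longlonglongrightarrow> (norm (b - \<beta>))\<^sup>2"
      using norm_lim by eventually_elim (rule tendsto_power)
    then show "AE \<omega> in M. (\<lambda>n. (norm (\<beta>hat n \<omega> - \<beta>))\<^sup>2) \<longlonglongrightarrow>
          (norm \<beta>F)\<^sup>2 + (norm \<gamma>)\<^sup>2 + (norm ((inv_into D \<pi> (\<beta>E + \<gamma>) - (\<beta>E + \<gamma>)) - \<beta>S))\<^sup>2"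
      using pyth b by (simp add: a_def)
    show "\<beta>F \<in> F" "\<gamma> \<in> E" by (rule \<beta>F_in, rule \<gamma>E)
    show "(inv_into D \<pi> (\<beta>E + \<gamma>) - (\<beta>E + \<gamma>)) - \<beta>S \<in> Sperp"
      using rest b by (simp add: a_def)
  qed
qed

end
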